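(* Let $n$ and $a$ be positive integers, let $k$ be a field of characteristic zero or of positive characteristic $p\ge a+n$, and let $R=k[x_1,\dots,x_n]$. Consider the deformation retract $$i_\infty\colon \mathbb L_a\to\mathbb X_a,\qquad p_\infty\colon\mathbb X_a\to\mathbb L_a$$ with associated homotopy $h_\infty$, where $\mathbb X_a$, $\mathbb L_a$, $i_\infty$, $p_\infty$, $h_\infty$ are as defined in the context. Defining the product of $\alpha,\beta\in\mathbb L_a$ by $$\alpha\beta=p_\infty\bigl(i_\infty(\alpha)\,i_\infty(\beta)\bigr),$$ where the product inside the parentheses is the one in $\mathbb X_a$, yields a dg algebra structure on $\mathbb L_a$. Furthermore, with this structure the map $i_\infty$ is a homomorphism of dg algebras.
   Context: Dg algebras: a dg algebra over $R$ is a complex of $R$-modules (homologically graded) in nonnegative degrees with an associative, unitary product given by a chain map $X\otimes_RX\to X$ (so the differential satisfies $\partial(\alpha\beta)=\partial(\alpha)\beta+(-1)^{|\alpha|}\alpha\partial(\beta)$), which is strictly graded commutative: $\alpha\beta=(-1)^{|\alpha||\beta|}\beta\alpha$, and $\alpha^2=0$ for $|\alpha|$ odd. Homomorphisms of dg algebras are chain maps preserving $1$ and products. A deformation retract is a pair of quasi-isomorphisms $i\colon Y\to X$, $p\colon X\to Y$ with a homotopy $h$ on $X$ such that $ip=1+\partial^Xh+h\partial^X$ and $pi=1$. The complex $\mathbb S$: let $S=R[y_1,\dots,y_n]=\bigoplus_m S_m$ (graded by degree in the $y$'s) and let $\Lambda=\bigoplus_i\Lambda^i$ be the exterior algebra over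 $R$ on $e_1,\dots,e_n$; tensor products are over $R$. Define $$\kappa_{i,m}\colon\Lambda^i\otimes S_m\to\Lambda^{i-1}\otimes S_{m+1},\quad \kappa(e_{t_1}\wedge\cdots\wedge e_{t_i}\otimes q)=\sum_{j=1}^i(-1)^{j+1}e_{t_1}\wedge\cdots\wedge\widehat{e_{t_j}}\wedge\cdots\wedge e_{t_i}\otimes y_{t_j}q,$$ and $d_{i,m}=\mathrm{kos}_i\otimes1\colon\Lambda^i\otimes S_m\to\Lambda^{i-1}\otimes S_m$, where $\mathrm{kos}_i$ is the $i$th differential of the Koszul complex on $x_1,\dots,x_n$ over $R$. $\mathbb S$ is the totalization of the resulting anticommutative double complex $\{\Lambda^i\otimes S_m\mid i,m\ge0\}$: homological degree is the $\Lambda$-degree $i$, and the differential is $\kappa+d$. With multiplication $(\lambda\otimes s)(\lambda'\otimes s')=\lambda\wedge\lambda'\otimes ss'$, $\mathbb S$ is a dg algebra, and $\mathrm{tr}_{\ge a}(\mathbb S)=\{\Lambda^i\otimes S_m\mid m\ge a\}$ is a dg ideal. The dg algebra $\mathbb X_a$: $\mathbb X_a=\mathbb S/\mathrm{tr}_{\ge a}(\mathbb S)$, with modules $\Lambda^i\otimes S_m$, $m\le a-1$, differential $\kappa+d$ and the induced product (terms with $m\ge a$ are set to zero). The complex $\mathbb L_a$: for $0\le i\le n-1$ let $L_{i,a}=\operatorname{im}\kappa_{i+1,a-1}=\ker\kappa_{i,a}\subseteq\Lambda^i\otimes S_a$ (so $L_{0,a}=\Lambda^0\otimes S_a\cong S_a$).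 Let $\varepsilon\colon\Lambda^0\otimes S_m\cong S_m\to R$ be the $R$-linear evaluation $y_j\mapsto x_j$. The maps $d$ induce maps $d\colon L_{i,a}\to L_{i-1,a}$, and $\mathbb L_a$ is the complex $$0\to L_{n-1,a}\xrightarrow{d}L_{n-2,a}\xrightarrow{d}\cdots\to L_{0,a}\xrightarrow{\varepsilon}R\to0$$ with $(\mathbb L_a)_0=R$ and $(\mathbb L_a)_{i+1}=L_{i,a}$. It is the Buchsbaum–Eisenbud minimal free resolution of $R/\mathfrak m^a$, where $\mathfrak m=(x_1,\dots,x_n)$. The homotopy $\sigma$ (a scaled de Rham differential): $\sigma_{i,m}\colon\Lambda^i\otimes S_m\to\Lambda^{i+1}\otimes S_{m-1}$ is, for $i+m>0$, $$\sigma_{i,m}(e_{t_1}\wedge\cdots\wedge e_{t_i}\otimes y_{p_1}\cdots y_{p_m})=\frac1{i+m}\sum_{j=1}^m e_{p_j}\wedge e_{t_1}\wedge\cdots\wedge e_{t_i}\otimes y_{p_1}\cdots\widehat{y_{p_j}}\cdots y_{p_m},$$ with $\sigma_{i,m}=0$ when $m=0$ or $i=n$. The maps of the retract are $$i_\infty=\begin{cases}(1+(-\sigma d)+(-\sigma d)^2+\cdots)\,\sigma&\text{on }L_{i,a}\\ \varepsilon^{-1}\colon R\to\Lambda^0\otimes S_0&\text{on }R,\end{cases}$$ $$p_\infty=\begin{cases}\kappa&\text{on }\Lambda^i\otimes S_{a-1}\text{ for }i>0\\ \varepsilon&\text{on }\Lambda^0\otimes S_j\text{ for all }j\\ 0&\text{else,}\end{cases}$$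 $$h_\infty=-\sigma(1+(-d\sigma)+(-d\sigma)^2+\cdots)$$ (all sums are finite).
   Formalization: Signs are corrected: the Koszul differential is taken with kos(e_t) = −x_t, and the differential of L_a is (−d, −ε) instead of (d, ε); with the usual signs p_∞ is not a chain map (for a ≥ 2, ε(∂e_t) = 2x_t while p_∞(e_t⊗1) = 0). *)

theory Defs
  imports Complex_Main "HOL-Library.Poly_Mapping" "HOL-Library.Cardinality"
    "HOL-Library.Product_Plus"
begin

section \<open>Dg algebras and deformation retracts\<close>

text \<open>
  A nonnegatively graded complex of modules over a commutative ring is a family of submodules
  \<open>component X i\<close> of one ambient module, together with a map \<open>boundary X\<close> of which only the
  restrictions to the components matter. Likewise only the products of homogeneous elements matter
  in a dg algebra.
\<close>

record ('r, 'm) cpx =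
  action :: "'r \<Rightarrow> 'm \<Rightarrow> 'm"
  component :: "nat \<Rightarrow> 'm set"
  boundary :: "'m \<Rightarrow> 'm"

record ('r, 'm) dga = "('r, 'm) cpx" +
  product :: "'m \<Rightarrow> 'm \<Rightarrow> 'm"
  unit_elem :: 'm

text \<open>\<open>s\<close> is the degree of the map: degree \<open>i\<close> is sent to degree \<open>i + s\<close>.\<close>

definition graded_linear ::
  "nat \<Rightarrow> ('r::comm_ring_1, 'm::ab_group_add, 'u) cpx_scheme \<Rightarrow>
   ('r, 'l::ab_group_add, 'v) cpx_scheme \<Rightarrow> ('m \<Rightarrow> 'l) \<Rightarrow> bool" where
  "graded_linear s X Y f \<longleftrightarrow>
     (\<forall>i. \<forall>x\<in>component X i. f x \<in> component Y (i + s)) \<and>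
     (\<forall>i. \<forall>x\<in>component X i. \<forall>y\<in>component X i. f (x + y) = f x + f y) \<and>
     (\<forall>i. \<forall>r. \<forall>x\<in>component X i. f (action X r x) = action Y r (f x))"

definition is_complex :: "('r::comm_ring_1, 'm::ab_group_add, 'u) cpx_scheme \<Rightarrow> bool" where
  "is_complex X \<longleftrightarrow>
     module (action X) \<and>
     (\<forall>i. module.subspace (action X) (component X i)) \<and>
     (\<forall>x\<in>component X 0. boundary X x = 0) \<and>
     (\<forall>i. \<forall>x\<in>component X (Suc i). boundary X x \<in> component X i) \<and>
     (\<forall>i. \<forall>x\<in>component X i. \<forall>y\<in>component X i.
        boundary X (x + y) = boundary X x + boundary X y) \<and>
     (\<forall>i. \<forall>r. \<forall>x\<in>component X i. boundary X (action X r x) = action X r (boundary X x)) \<and>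
     (\<forall>i. \<forall>x\<in>component X i. boundary X (boundary X x) = 0)"

definition chain_map ::
  "('r::comm_ring_1, 'm::ab_group_add, 'u) cpx_scheme \<Rightarrow>
   ('r, 'l::ab_group_add, 'v) cpx_scheme \<Rightarrow> ('m \<Rightarrow> 'l) \<Rightarrow> bool" where
  "chain_map X Y f \<longleftrightarrow>
     is_complex X \<and> is_complex Y \<and> graded_linear 0 X Y f \<and>
     (\<forall>i. \<forall>x\<in>component X i. f (boundary X x) = boundary Y (f x))"

definition cycles :: "('r, 'm::ab_group_add, 'u) cpx_scheme \<Rightarrow> nat \<Rightarrow> 'm set" where
  "cycles X i = {x \<in> component X i. boundary X x = 0}"

definition homologous :: "('r, 'm::ab_group_add, 'u) cpx_scheme \<Rightarrow> nat \<Rightarrow> ('m \<times> 'm) set" where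
  "homologous X i = {(x, y). x \<in> cycles X i \<and> y \<in> cycles X i \<and>
     x - y \<in> boundary X ` component X (Suc i)}"

definition homology :: "('r, 'm::ab_group_add, 'u) cpx_scheme \<Rightarrow> nat \<Rightarrow> 'm set set" where
  "homology X i = cycles X i // homologous X i"

definition quasi_isomorphism ::
  "('r::comm_ring_1, 'm::ab_group_add, 'u) cpx_scheme \<Rightarrow>
   ('r, 'l::ab_group_add, 'v) cpx_scheme \<Rightarrow> ('m \<Rightarrow> 'l) \<Rightarrow> bool" where
  "quasi_isomorphism X Y f \<longleftrightarrow>
     chain_map X Y f \<and>
     (\<forall>i. bij_betw (\<lambda>c. homologous Y i `` (f ` c)) (homology X i) (homology Y i))"

definition deformation_retract ::
  "('r::comm_ring_1, 'm::ab_group_add, 'u) cpx_scheme \<Rightarrow>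
   ('r, 'l::ab_group_add, 'v) cpx_scheme \<Rightarrow> ('l \<Rightarrow> 'm) \<Rightarrow> ('m \<Rightarrow> 'l) \<Rightarrow> ('m \<Rightarrow> 'm) \<Rightarrow> bool" where
  "deformation_retract X Y i p h \<longleftrightarrow>
     quasi_isomorphism Y X i \<and> quasi_isomorphism X Y p \<and> graded_linear 1 X X h \<and>
     (\<forall>j. \<forall>x\<in>component X j. i (p x) = x + boundary X (h x) + h (boundary X x)) \<and>
     (\<forall>j. \<forall>y\<in>component Y j. p (i y) = y)"

definition dg_algebra :: "('r::comm_ring_1, 'm::ab_group_add, 'u) dga_scheme \<Rightarrow> bool" where
  "dg_algebra A \<longleftrightarrow>
     is_complex A \<and>
     (\<forall>i j. \<forall>x\<in>component A i. \<forall>y\<in>component A j. product A x y \<in> component A (i + j)) \<and>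
     (\<forall>i j. \<forall>x\<in>component A i. \<forall>x'\<in>component A i. \<forall>y\<in>component A j.
        product A (x + x') y = product A x y + product A x' y) \<and>
     (\<forall>i j. \<forall>x\<in>component A i. \<forall>y\<in>component A j. \<forall>y'\<in>component A j.
        product A x (y + y') = product A x y + product A x y') \<and>
     (\<forall>i j. \<forall>r. \<forall>x\<in>component A i. \<forall>y\<in>component A j.
        product A (action A r x) y = action A r (product A x y) \<and>
        product A x (action A r y) = action A r (product A x y)) \<and>
     (\<forall>i j. \<forall>x\<in>component A i. \<forall>y\<in>component A j.
        boundary A (product A x y) =
          product A (boundary A x) y + action A ((-1) ^ i) (product A x (boundary A y))) \<and>
     (\<forall>i j k. \<forall>x\<in>component A i. \<forall>y\<in>component A j. \<forall>z\<in>component A k.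
        product A (product A x y) z = product A x (product A y z)) \<and>
     unit_elem A \<in> component A 0 \<and>
     (\<forall>i. \<forall>x\<in>component A i. product A (unit_elem A) x = x \<and> product A x (unit_elem A) = x) \<and>
     (\<forall>i j. \<forall>x\<in>component A i. \<forall>y\<in>component A j.
        product A x y = action A ((-1) ^ (i * j)) (product A y x)) \<and>
     (\<forall>i. odd i \<longrightarrow> (\<forall>x\<in>component A i. product A x x = 0))"

definition dg_algebra_hom ::
  "('r::comm_ring_1, 'm::ab_group_add, 'u) dga_scheme \<Rightarrow>
   ('r, 'l::ab_group_add, 'v) dga_scheme \<Rightarrow> ('m \<Rightarrow> 'l) \<Rightarrow> bool" where
  "dg_algebra_hom A B f \<longleftrightarrow>
     dg_algebra A \<and> dg_algebra B \<and> chain_map A B f \<and>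
     f (unit_elem A) = unit_elem B \<and>
     (\<forall>i j. \<forall>x\<in>component A i. \<forall>y\<in>component A j.
        f (product A x y) = product B (f x) (f y))"


section \<open>The module \<open>\<Lambda> \<otimes> S\<close>\<close>

text \<open>
  The indices \<open>1 < \<dots> < n\<close> are the elements of a finite linearly ordered type \<open>'n\<close>. A monomial is
  its exponent vector, \<open>R\<close> is \<open>('n, 'k) polyR\<close> and \<open>S = R[y]\<close> is \<open>('n, 'k) polyS\<close>. The exterior
  algebra has the \<open>R\<close>-basis \<open>e\<^sub>I = e\<^sub>t\<^sub>1 \<and> \<dots> \<and> e\<^sub>t\<^sub>i\<close> for \<open>I = {t\<^sub>1 < \<dots> < t\<^sub>i}\<close>, so an element of
  \<open>\<Lambda> \<otimes> S\<close> is its family of coefficients in \<open>S\<close>, and \<open>e\<^sub>I \<otimes> q\<close> is \<open>Poly_Mapping.single I q\<close>.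
\<close>

type_synonym ('n, 'k) polyR = "('n \<Rightarrow>\<^sub>0 nat) \<Rightarrow>\<^sub>0 'k"
type_synonym ('n, 'k) polyS = "('n \<Rightarrow>\<^sub>0 nat) \<Rightarrow>\<^sub>0 ('n, 'k) polyR"
type_synonym ('n, 'k) extS = "'n set \<Rightarrow>\<^sub>0 ('n, 'k) polyS"

abbreviation lookup :: "('a \<Rightarrow>\<^sub>0 'b::zero) \<Rightarrow> 'a \<Rightarrow> 'b" where
  "lookup \<equiv> Poly_Mapping.lookup"

abbreviation keys :: "('a \<Rightarrow>\<^sub>0 'b::zero) \<Rightarrow> 'a set" where
  "keys \<equiv> Poly_Mapping.keys"

definition const :: "'c::zero \<Rightarrow> ('n \<Rightarrow>\<^sub>0 nat) \<Rightarrow>\<^sub>0 'c" where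
  "const c = Poly_Mapping.single 0 c"

text \<open>The variable \<open>x\<^sub>t\<close> of \<open>R\<close> and the variable \<open>y\<^sub>t\<close> of \<open>S\<close>, depending on the type.\<close>

definition indet :: "'n \<Rightarrow> ('n \<Rightarrow>\<^sub>0 nat) \<Rightarrow>\<^sub>0 'c::zero_neq_one" where
  "indet t = Poly_Mapping.single (Poly_Mapping.single t 1) 1"

definition mdeg :: "('n::finite \<Rightarrow>\<^sub>0 nat) \<Rightarrow> nat" where
  "mdeg \<mu> = (\<Sum>t\<in>UNIV. lookup \<mu> t)"

definition scaleR_ext :: "('n::finite, 'k::field) polyR \<Rightarrow> ('n, 'k) extS \<Rightarrow> ('n, 'k) extS" where
  "scaleR_ext r \<xi> = (\<Sum>I\<in>UNIV. Poly_Mapping.single I (const r * lookup \<xi> I))"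

text \<open>
  \<open>bigraded P\<close> is the direct sum of the \<open>\<Lambda>\<^sup>i \<otimes> S\<^sub>m\<close> over all \<open>i, m\<close> with \<open>P i m\<close>, and
  \<open>bipart P\<close> is the projection of \<open>\<Lambda> \<otimes> S\<close> onto it.
\<close>

definition bigraded :: "(nat \<Rightarrow> nat \<Rightarrow> bool) \<Rightarrow> ('n::finite, 'k::field) extS set" where
  "bigraded P = {\<xi>. \<forall>I\<in>keys \<xi>. \<forall>\<mu>\<in>keys (lookup \<xi> I). P (card I) (mdeg \<mu>)}"

definition bipart ::
  "(nat \<Rightarrow> nat \<Rightarrow> bool) \<Rightarrow> ('n::finite, 'k::field) extS \<Rightarrow> ('n, 'k) extS" where
  "bipart P \<xi> = (\<Sum>I\<in>UNIV. \<Sum>\<mu>\<in>{\<mu>\<in>keys (lookup \<xi> I). P (card I) (mdeg \<mu>)}.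
     Poly_Mapping.single I (Poly_Mapping.single \<mu> (lookup (lookup \<xi> I) \<mu>)))"

text \<open>\<open>e\<^sub>I \<and> e\<^sub>J = wedge_sign I J e\<^bsub>I \<union> J\<^esub>\<close>\<close>

definition wedge_sign :: "'n::{finite,linorder} set \<Rightarrow> 'n set \<Rightarrow> 'c::ring_1" where
  "wedge_sign I J =
     (if I \<inter> J = {} then (-1) ^ card {(s, t). s \<in> I \<and> t \<in> J \<and> t < s} else 0)"

definition ext_mult ::
  "('n::{finite,linorder}, 'k::field) extS \<Rightarrow> ('n, 'k) extS \<Rightarrow> ('n, 'k) extS" where
  "ext_mult \<xi> \<eta> = (\<Sum>I\<in>UNIV. \<Sum>J\<in>UNIV.
     Poly_Mapping.single (I \<union> J) (wedge_sign I J * (lookup \<xi> I * lookup \<eta> J)))"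

text \<open>If \<open>t\<close> is the \<open>j\<close>-th element of \<open>I\<close>, then \<open>card {s \<in> I. s < t} = j - 1\<close>.\<close>

definition kappa :: "('n::{finite,linorder}, 'k::field) extS \<Rightarrow> ('n, 'k) extS" where
  "kappa \<xi> = (\<Sum>I\<in>UNIV. \<Sum>t\<in>I.
     Poly_Mapping.single (I - {t}) ((-1) ^ card {s\<in>I. s < t} * (indet t * lookup \<xi> I)))"

text \<open>
  The map \<open>d = kos \<otimes> 1\<close>. The Koszul differential is normalised by \<open>kos (e\<^sub>t) = - x\<^sub>t\<close>, that is,
  \<open>kos (e\<^sub>t\<^sub>1 \<and> \<dots> \<and> e\<^sub>t\<^sub>i) = (\<Sum>j. (-1)^j x\<^sub>t\<^sub>j e\<^sub>t\<^sub>1 \<and> \<dots> (omit e\<^sub>t\<^sub>j) \<dots> \<and> e\<^sub>t\<^sub>i)\<close>. This is the sign for which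
  \<open>\<kappa> + d\<close> sends \<open>e\<^sub>t\<close> to \<open>y\<^sub>t - x\<^sub>t\<close>, as it must if the evaluation \<open>y\<^sub>t \<mapsto> x\<^sub>t\<close> is to annihilate
  boundaries.
\<close>

definition kos :: "('n::{finite,linorder}, 'k::field) extS \<Rightarrow> ('n, 'k) extS" where
  "kos \<xi> = (\<Sum>I\<in>UNIV. \<Sum>t\<in>I.
     Poly_Mapping.single (I - {t})
       ((-1) ^ (card {s\<in>I. s < t} + 1) * (const (indet t) * lookup \<xi> I)))"

text \<open>The evaluation \<open>S \<rightarrow> R\<close>, \<open>y\<^sub>t \<mapsto> x\<^sub>t\<close>\<close>

definition evalS :: "('n::finite, 'k::field) polyS \<Rightarrow> ('n, 'k) polyR" where
  "evalS q = (\<Sum>\<mu>\<in>keys q. lookup q \<mu> * (\<Prod>t\<in>UNIV. indet t ^ lookup \<mu> t))"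

text \<open>
  On \<open>e\<^sub>I \<otimes> y\<^sup>\<mu>\<close> the sum over the \<open>m\<close> factors of \<open>y\<^sup>\<mu>\<close> becomes a sum over the distinct variables
  \<open>y\<^sub>t\<close> dividing \<open>y\<^sup>\<mu>\<close>, weighted by their multiplicity. For \<open>m = 0\<close> the sum is empty. The inverse of
  \<open>i + m\<close> is taken in \<open>k\<close>; in the range where \<open>\<sigma>\<close> is used, \<open>i + m\<close> is less than \<open>a + n\<close>.
\<close>

definition sigma :: "('n::{finite,linorder}, 'k::field) extS \<Rightarrow> ('n, 'k) extS" where
  "sigma \<xi> = (\<Sum>I\<in>UNIV. \<Sum>\<mu>\<in>keys (lookup \<xi> I). \<Sum>t\<in>keys \<mu>.
     ext_mult (Poly_Mapping.single {t} 1)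
       (Poly_Mapping.single I (Poly_Mapping.single (\<mu> - Poly_Mapping.single t 1)
         (const (of_nat (lookup \<mu> t) / of_nat (card I + mdeg \<mu>)) * lookup (lookup \<xi> I) \<mu>))))"


section \<open>The dg algebra \<open>\<X>\<^sub>a\<close>, the complex \<open>\<L>\<^sub>a\<close> and the retract\<close>

text \<open>The quotient of \<open>\<S>\<close> by the part with \<open>m \<ge> a\<close>, realised on the \<open>\<Lambda>\<^sup>i \<otimes> S\<^sub>m\<close> with \<open>m < a\<close>\<close>

definition XX ::
  "nat \<Rightarrow> (('n::{finite,linorder}, 'k::field) polyR, ('n, 'k) extS) dga" where
  "XX a = \<lparr>action = scaleR_ext,
     component = (\<lambda>i. bigraded (\<lambda>j m. j = i \<and> m < a)),
     boundary = (\<lambda>\<xi>. bipart (\<lambda>j m. m < a) (kappa \<xi> + kos \<xi>)),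
     product = (\<lambda>\<xi> \<eta>. bipart (\<lambda>j m. m < a) (ext_mult \<xi> \<eta>)),
     unit_elem = Poly_Mapping.single {} 1\<rparr>"

definition Lmod :: "nat \<Rightarrow> nat \<Rightarrow> ('n::{finite,linorder}, 'k::field) extS set" where
  "Lmod a i = kappa ` bigraded (\<lambda>j m. j = i + 1 \<and> m = a - 1)"

text \<open>
  The ambient module of \<open>\<L>\<^sub>a\<close> is \<open>R \<times> (\<Lambda> \<otimes> S)\<close>: degree \<open>0\<close> is \<open>R\<close>, in the first factor, and degree
  \<open>i + 1\<close> is \<open>L\<^bsub>i,a\<^esub>\<close>, in the second; \<open>L\<^bsub>i,a\<^esub>\<close> vanishes for \<open>i \<ge> n\<close>. Since \<open>L\<^bsub>i,a\<^esub>\<close> is shifted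
  into degree \<open>i + 1\<close>, the differential carries the sign of a suspension: it is \<open>-d\<close> and \<open>-\<epsilon>\<close>. Without
  this sign \<open>i\<^sub>\<infinity>\<close> and \<open>p\<^sub>\<infinity>\<close> would anticommute with the differentials, because
  \<open>\<kappa> d = - d \<kappa>\<close>.
\<close>

definition LL ::
  "nat \<Rightarrow> (('n::{finite,linorder}, 'k::field) polyR, ('n, 'k) polyR \<times> ('n, 'k) extS) cpx" where
  "LL a = \<lparr>action = (\<lambda>r (u, \<xi>). (r * u, scaleR_ext r \<xi>)),
     component = (\<lambda>i. case i of 0 \<Rightarrow> UNIV \<times> {0} | Suc j \<Rightarrow> {0} \<times> Lmod a j),
     boundary = (\<lambda>(u, \<xi>). (- evalS (lookup \<xi> {}), - kos \<xi>))\<rparr>"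

text \<open>
  \<open>Sum_any\<close> is the sum of the nonzero terms of a family with finitely many nonzero terms.
\<close>

definition i_inf ::
  "('n::{finite,linorder}, 'k::field) polyR \<times> ('n, 'k) extS \<Rightarrow> ('n, 'k) extS" where
  "i_inf = (\<lambda>(u, \<xi>). Poly_Mapping.single {} (const u) +
     Sum_any (\<lambda>k. ((\<lambda>\<eta>. - sigma (kos \<eta>)) ^^ k) (sigma \<xi>)))"

definition p_inf ::
  "nat \<Rightarrow> ('n::{finite,linorder}, 'k::field) extS \<Rightarrow> ('n, 'k) polyR \<times> ('n, 'k) extS" where
  "p_inf a \<xi> = (evalS (lookup \<xi> {}), kappa (bipart (\<lambda>i m. 0 < i \<and> m = a - 1) \<xi>))"

definition h_inf :: "('n::{finite,linorder}, 'k::field) extS \<Rightarrow> ('n, 'k) extS" where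
  "h_inf \<xi> = - sigma (Sum_any (\<lambda>k. ((\<lambda>\<eta>. - kos (sigma \<eta>)) ^^ k) \<xi>))"

definition LL_dga ::
  "nat \<Rightarrow> (('n::{finite,linorder}, 'k::field) polyR, ('n, 'k) polyR \<times> ('n, 'k) extS) dga" where
  "LL_dga a = cpx.extend (LL a)
     (dga.fields (\<lambda>\<alpha> \<beta>. p_inf a (product (XX a) (i_inf \<alpha>) (i_inf \<beta>))) (1, 0))"

end

theory Submission
  imports Defs
begin

text \<open>
  On \<open>\<Lambda> \<otimes> S\<close> both \<open>\<kappa>\<close> and \<open>d\<close> are contractions with a family of elements of \<open>S\<close>, hence
  antiderivations, and the de Rham map \<open>D = \<Sum>\<^sub>t e\<^sub>t \<partial>/\<partial>y\<^sub>t\<close> is an antiderivation with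
  \<open>D D = 0\<close> and \<open>\<kappa> D + D \<kappa> = i + m\<close> on \<open>\<Lambda>\<^sup>i \<otimes> S\<^sub>m\<close>; such identities only have to be checked
  on the algebra generators \<open>e\<^sub>t\<close>, \<open>y\<^sub>t\<close>. The map \<open>\<sigma>\<close> is \<open>D\<close> divided by \<open>i + m\<close>, so \<open>\<kappa> \<sigma> + \<sigma> \<kappa> = 1\<close>
  off \<open>\<Lambda>\<^sup>0 \<otimes> S\<^sub>0\<close>.

  Instead of manipulating the series for \<open>i\<^sub>\<infinity>\<close> and \<open>h\<^sub>\<infinity>\<close>, one uses that \<open>1 + \<sigma> d\<close> is injective and that
  \<open>(1 + \<sigma> d) i\<^sub>\<infinity> = \<sigma>\<close> and \<open>(1 + \<sigma> d) h\<^sub>\<infinity> = - \<sigma>\<close>. This yields the retract, and it shows that the image of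
  \<open>i\<^sub>\<infinity>\<close> consists of the \<open>\<xi>\<close> with \<open>\<sigma> \<xi> = 0\<close> and \<open>\<sigma> \<partial> \<xi> = 0\<close>, because there the homotopy vanishes. As
  \<open>\<sigma> \<xi> = 0\<close> is equivalent to \<open>D \<xi> = 0\<close>, and \<open>D\<close> and \<open>\<partial>\<close> are antiderivations, this image is a dg
  subalgebra, whose structure is transported to \<open>\<L>\<^sub>a\<close>.
\<close>

section \<open>Homotopy equivalences and transfer of products\<close>

lemma component_closed:
  assumes "is_complex X"
  shows component_zero: "0 \<in> component X i"
    and component_add: "x \<in> component X i \<Longrightarrow> y \<in> component X i \<Longrightarrow> x + y \<in> component X i"
    and component_action: "x \<in> component X i \<Longrightarrow> action X r x \<in> component X i"
    and component_diff: "x \<in> component X i \<Longrightarrow> y \<in> component X i \<Longrightarrow> x - y \<in> component X i"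
proof -
  have m: "module (action X)" and s: "module.subspace (action X) (component X i)" for i
    using assms by (auto simp: is_complex_def)
  show "0 \<in> component X i" "x \<in> component X i \<Longrightarrow> y \<in> component X i \<Longrightarrow> x + y \<in> component X i"
    "x \<in> component X i \<Longrightarrow> action X r x \<in> component X i"
    "x \<in> component X i \<Longrightarrow> y \<in> component X i \<Longrightarrow> x - y \<in> component X i"
    using module.subspace_0[OF m s] module.subspace_add[OF m s] module.subspace_scale[OF m s]
      module.subspace_diff[OF m s] by auto
qed

lemma boundary_diff:
  assumes "is_complex X" "x \<in> component X i" "y \<in> component X i"
  shows "boundary X (x - y) = boundary X x - boundary X y"
proof -
  have "boundary X ((x - y) + y) = boundary X (x - y) + boundary X y"
    using assms component_diff[OF assms] unfolding is_complex_def by blast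
  then show ?thesis by simp
qed

lemma graded_linear_diff:
  assumes "is_complex X" "graded_linear s X Y f" "x \<in> component X i" "y \<in> component X i"
  shows "f (x - y) = f x - f y"
proof -
  have "f ((x - y) + y) = f (x - y) + f y"
    using assms component_diff[OF assms(1,3,4)] unfolding graded_linear_def by blast
  then show ?thesis by simp
qed

lemma graded_linear_zero:
  assumes "is_complex X" "graded_linear s X Y f"
  shows "f 0 = 0"
proof -
  have "f (0 - 0) = f 0 - f 0"
    \<comment> \<open>\<open>undefined\<close> stands for an arbitrary degree: \<open>0\<close> lies
      in every component.\<close>
    by (rule graded_linear_diff[OF assms]; rule component_zero[OF assms(1), of undefined])
  then show ?thesis by simp
qed

section \<open>Maps induced on homology\<close>

lemma chain_map_cycles:
  assumes "chain_map X Y f" "x \<in> cycles X i"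
  shows "f x \<in> cycles Y i"
  using assms graded_linear_zero[of X 0 Y f]
  unfolding chain_map_def cycles_def graded_linear_def by auto metis

lemma equiv_homologous:
  assumes "is_complex X"
  shows "equiv (cycles X i) (homologous X i)"
proof (rule equivI)
  let ?B = "boundary X ` component X (Suc i)"
  have zero: "0 \<in> ?B"
    using boundary_diff[OF assms component_zero component_zero] component_zero[OF assms, of "Suc i"] assms
    by (metis cancel_comm_monoid_add_class.diff_cancel image_eqI)
  have diff: "b - b' \<in> ?B" if "b \<in> ?B" "b' \<in> ?B" for b b'
    using that by (auto simp flip: boundary_diff[OF assms] intro: component_diff[OF assms])
  show "refl_on (cycles X i) (homologous X i)"
    using zero by (auto simp: refl_on_def homologous_def)
  show "homologous X i \<subseteq> cycles X i \<times> cycles X i"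
    by (auto simp: homologous_def)
  have "y - x \<in> ?B" if "x - y \<in> ?B" for x y
    using diff[OF zero that] by simp
  then show "sym (homologous X i)"
    unfolding sym_def homologous_def by blast
  have "x - z \<in> ?B" if "x - y \<in> ?B" "y - z \<in> ?B" for x y z
    using diff[OF that(1) diff[OF zero that(2)]] by simp
  then show "trans (homologous X i)"
    unfolding trans_def homologous_def by blast
qed

lemma chain_map_homologous:
  assumes "chain_map X Y f" "(x, y) \<in> homologous X i"
  shows "(f x, f y) \<in> homologous Y i"
proof -
  have X: "is_complex X" and f: "graded_linear 0 X Y f"
    and comm: "\<And>i x. x \<in> component X i \<Longrightarrow> f (boundary X x) = boundary Y (f x)"
    using assms(1) by (auto simp: chain_map_def)
  obtain w where w: "x \<in> cycles X i" "y \<in> cycles X i" "w \<in> component X (Suc i)" "x - y = boundary X w"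
    using assms(2) by (auto simp: homologous_def)
  then have "f x - f y = boundary Y (f w)"
    using graded_linear_diff[OF X f, of x i y] comm by (simp add: cycles_def)
  moreover have "f w \<in> component Y (Suc i)" using f w by (auto simp: graded_linear_def)
  ultimately show ?thesis using w chain_map_cycles[OF assms(1)] by (auto simp: homologous_def)
qed

text \<open>Reduces the induced map to one representative: the images of homologous cycles are
  homologous, so saturating the image of a class yields a single class.\<close>

lemma homology_map_class:
  assumes "chain_map X Y f" "x \<in> cycles X i"
  shows "homologous Y i `` (f ` (homologous X i `` {x})) = homologous Y i `` {f x}"
proof -
  have e: "equiv (cycles X i) (homologous X i)" "equiv (cycles Y i) (homologous Y i)"
    using assms(1) by (auto simp: chain_map_def intro: equiv_homologous)
  have "(x, x) \<in> homologous X i" using e(1) assms(2) by (meson equivE refl_onD)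
  moreover have "(f x, z) \<in> homologous Y i" if "(x, y) \<in> homologous X i" "(f y, z) \<in> homologous Y i" for y z
    using chain_map_homologous[OF assms(1) that(1)] that(2) e(2) by (meson equivE transD)
  ultimately show ?thesis by blast
qed

text \<open>The map induced by \<open>g\<close> is a two-sided inverse on homology. The conditions
  concern cycles only, where the term \<open>h (boundary X x)\<close> of a chain homotopy
  disappears.\<close>

lemma homotopy_equivalence_quasi_isomorphism:
  assumes f: "chain_map X Y f" and g: "chain_map Y X g"
    and gf: "\<And>i x. x \<in> cycles X i \<Longrightarrow> g (f x) - x \<in> boundary X ` component X (Suc i)"
    and fg: "\<And>i y. y \<in> cycles Y i \<Longrightarrow> f (g y) - y \<in> boundary Y ` component Y (Suc i)"
  shows "quasi_isomorphism X Y f"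
  unfolding quasi_isomorphism_def
proof (intro conjI allI f)
  fix i
  let ?F = "\<lambda>c. homologous Y i `` (f ` c)" and ?G = "\<lambda>c. homologous X i `` (g ` c)"
  have e: "equiv (cycles X i) (homologous X i)" "equiv (cycles Y i) (homologous Y i)"
    using f by (auto simp: chain_map_def intro: equiv_homologous)
  have F: "?F (homologous X i `` {x}) = homologous Y i `` {f x}" if "x \<in> cycles X i" for x
    by (rule homology_map_class[OF f that])
  have G: "?G (homologous Y i `` {y}) = homologous X i `` {g y}" if "y \<in> cycles Y i" for y
    by (rule homology_map_class[OF g that])
  have GF: "?G (?F c) = c" if "c \<in> homology X i" for c
  proof -
    obtain x where x: "x \<in> cycles X i" "c = homologous X i `` {x}"
      using \<open>c \<in> homology X i\<close> by (auto simp: homology_def elim: quotientE)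
    have "f x \<in> cycles Y i" "g (f x) \<in> cycles X i"
      using x chain_map_cycles[OF f] chain_map_cycles[OF g] by auto
    then have "?G (?F c) = homologous X i `` {g (f x)}" using x F G by simp
    also have "\<dots> = c" unfolding x(2)
      by (rule equiv_class_eq[OF e(1)]) (use x gf \<open>g (f x) \<in> cycles X i\<close> in \<open>auto simp: homologous_def\<close>)
    finally show ?thesis .
  qed
  have FG: "?F (?G c) = c" if "c \<in> homology Y i" for c
  proof -
    obtain y where y: "y \<in> cycles Y i" "c = homologous Y i `` {y}"
      using \<open>c \<in> homology Y i\<close> by (auto simp: homology_def elim: quotientE)
    have "g y \<in> cycles X i" "f (g y) \<in> cycles Y i"
      using y chain_map_cycles[OF f] chain_map_cycles[OF g] by auto
    then have "?F (?G c) = homologous Y i `` {f (g y)}" using y F G by simp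
    also have "\<dots> = c" unfolding y(2)
      by (rule equiv_class_eq[OF e(2)]) (use y fg \<open>f (g y) \<in> cycles Y i\<close> in \<open>auto simp: homologous_def\<close>)
    finally show ?thesis .
  qed
  show "bij_betw ?F (homology X i) (homology Y i)"
  proof (rule bij_betw_byWitness[where f' = ?G])
    show "?F ` homology X i \<subseteq> homology Y i"
      unfolding homology_def
      by (auto elim!: quotientE simp: F intro!: quotientI chain_map_cycles[OF f])
    show "?G ` homology Y i \<subseteq> homology X i"
      unfolding homology_def
      by (auto elim!: quotientE simp: G intro!: quotientI chain_map_cycles[OF g])
  qed (use GF FG in auto)
qed

text \<open>
  It suffices to know that \<open>p\<close> is a chain map: then \<open>i\<close> is one, because
  \<open>i \<partial> = i \<partial> p i = i p \<partial> i = \<partial> i p i = \<partial> i\<close>.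
\<close>

lemma deformation_retractI:
  assumes p: "chain_map X Y p" and i: "graded_linear 0 Y X i" and h: "graded_linear 1 X X h"
    and ip: "\<And>j x. x \<in> component X j \<Longrightarrow> i (p x) = x + boundary X (h x) + h (boundary X x)"
    and pi: "\<And>j y. y \<in> component Y j \<Longrightarrow> p (i y) = y"
  shows "deformation_retract X Y i p h"
proof -
  have X: "is_complex X" and Y: "is_complex Y" using p by (auto simp: chain_map_def)
  \<comment> \<open>Truncated subtraction: in degree \<open>0\<close> the boundary is
    \<open>0\<close>, which lies in component \<open>0 - 1 = 0\<close>.\<close>
  have X_boundary: "boundary X x \<in> component X (j - 1)" if "x \<in> component X j" for x j
    using X that component_zero[OF X] by (cases j) (auto simp: is_complex_def)
  have Y_boundary: "boundary Y y \<in> component Y (j - 1)" if "y \<in> component Y j" for y j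
    using Y that component_zero[OF Y] by (cases j) (auto simp: is_complex_def)
  have X2: "boundary X (boundary X x) = 0" if "x \<in> component X j" for x j
    using X that by (auto simp: is_complex_def)
  have h0: "h 0 = 0" by (rule graded_linear_zero[OF X h])
  have hc: "h x \<in> component X (Suc j)" if "x \<in> component X j" for x j
    using h that by (auto simp: graded_linear_def)
  have ic: "i y \<in> component X j" if "y \<in> component Y j" for y j
    using i that by (auto simp: graded_linear_def)
  have ip_comm: "i (p (boundary X x)) = boundary X (i (p x))" if x: "x \<in> component X j" for x j
  proof -
    have add: "boundary X (x + y) = boundary X x + boundary X y" if "x \<in> component X j" "y \<in> component X j" for x y j
      using X that by (auto simp: is_complex_def)
    have hb: "h (boundary X x) \<in> component X j"
    proof (cases j)
      case 0
      then have "boundary X x = 0" using X x by (auto simp: is_complex_def)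
      then show ?thesis using component_zero[OF X] h0 by simp
    next
      case (Suc k)
      then show ?thesis using hc[OF X_boundary[OF x]] by simp
    qed
    have bh: "boundary X (h x) \<in> component X j" using X_boundary[OF hc[OF x]] by simp
    \<comment> \<open>Expanding \<open>i p\<close> leaves
      \<open>\<partial> x + \<partial> h \<partial> x\<close> on both sides, as
      \<open>\<partial> \<partial> = 0\<close> and \<open>h 0 = 0\<close>.\<close>
    show ?thesis
      using x hb bh X2[OF x] X2[OF hc[OF x]] ip[OF x] ip[OF X_boundary[OF x]]
      by (simp add: add[of _ j] component_add[OF X] h0)
  qed
  have i_chain: "chain_map Y X i"
    unfolding chain_map_def
  proof (intro conjI allI ballI X Y i)
    fix j y assume y: "y \<in> component Y j"
    have "boundary Y y = p (boundary X (i y))"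
      using p ic[OF y] pi[OF y] unfolding chain_map_def by metis
    then show "i (boundary Y y) = boundary X (i y)"
      using ip_comm[OF ic[OF y]] pi[OF y] by simp
  qed
  have "i (p x) - x \<in> boundary X ` component X (Suc j)" if "x \<in> cycles X j" for x j
    using that ip[of x j] hc[of x j] h0 by (auto simp: cycles_def)
  moreover have "p (i y) - y \<in> boundary Y ` component Y (Suc j)" if "y \<in> cycles Y j" for y j
  proof -
    have "boundary Y 0 = boundary Y 0 - boundary Y 0"
      using boundary_diff[OF Y component_zero[OF Y] component_zero[OF Y]] by simp
    then have "0 \<in> boundary Y ` component Y (Suc j)"
      using component_zero[OF Y, of "Suc j"] by (metis cancel_comm_monoid_add_class.diff_cancel image_eqI)
    then show ?thesis using that pi[of y j] by (simp add: cycles_def)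
  qed
  ultimately have "quasi_isomorphism Y X i" "quasi_isomorphism X Y p"
    by (auto intro: homotopy_equivalence_quasi_isomorphism p i_chain)
  then show ?thesis
    unfolding deformation_retract_def using h ip pi by blast
qed

section \<open>Transport of a dg algebra structure along a split injection\<close>

lemma dg_algebraD:
  assumes "dg_algebra A"
  shows dga_complex: "is_complex A"
    and dga_closed: "x \<in> component A i \<Longrightarrow> y \<in> component A j \<Longrightarrow> product A x y \<in> component A (i + j)"
    and dga_add_left: "x \<in> component A i \<Longrightarrow> x' \<in> component A i \<Longrightarrow> y \<in> component A j \<Longrightarrow>
      product A (x + x') y = product A x y + product A x' y"
    and dga_add_right: "x \<in> component A i \<Longrightarrow> y \<in> component A j \<Longrightarrow> y' \<in> component A j \<Longrightarrow>
      product A x (y + y') = product A x y + product A x y'"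
    and dga_action_left: "x \<in> component A i \<Longrightarrow> y \<in> component A j \<Longrightarrow>
      product A (action A r x) y = action A r (product A x y)"
    and dga_action_right: "x \<in> component A i \<Longrightarrow> y \<in> component A j \<Longrightarrow>
      product A x (action A r y) = action A r (product A x y)"
    and dga_leibniz: "x \<in> component A i \<Longrightarrow> y \<in> component A j \<Longrightarrow> boundary A (product A x y) =
      product A (boundary A x) y + action A ((-1) ^ i) (product A x (boundary A y))"
    and dga_assoc: "x \<in> component A i \<Longrightarrow> y \<in> component A j \<Longrightarrow> z \<in> component A k \<Longrightarrow>
      product A (product A x y) z = product A x (product A y z)"
    and dga_unit_left: "x \<in> component A i \<Longrightarrow> product A (unit_elem A) x = x"
    and dga_unit_right: "x \<in> component A i \<Longrightarrow> product A x (unit_elem A) = x"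
    and dga_commute: "x \<in> component A i \<Longrightarrow> y \<in> component A j \<Longrightarrow>
      product A x y = action A ((-1) ^ (i * j)) (product A y x)"
    and dga_square: "odd i \<Longrightarrow> x \<in> component A i \<Longrightarrow> product A x x = 0"
proof -
  note c1 = assms[unfolded dg_algebra_def]
  note c2 = conjunct2[OF c1]
  note c3 = conjunct2[OF c2]
  note c4 = conjunct2[OF c3]
  note c5 = conjunct2[OF c4]
  note c6 = conjunct2[OF c5]
  note c7 = conjunct2[OF c6]
  note c8 = conjunct2[OF c7]
  note c9 = conjunct2[OF c8]
  note c10 = conjunct2[OF c9]
  note c11 = conjunct2[OF c10]
  show "is_complex A"
    using conjunct1[OF c1] by blast
  show "x \<in> component A i \<Longrightarrow> y \<in> component A j \<Longrightarrow> product A x y \<in> component A (i + j)"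
    using conjunct1[OF c2] by blast
  show "x \<in> component A i \<Longrightarrow> x' \<in> component A i \<Longrightarrow> y \<in> component A j \<Longrightarrow>
      product A (x + x') y = product A x y + product A x' y"
    using conjunct1[OF c3] by blast
  show "x \<in> component A i \<Longrightarrow> y \<in> component A j \<Longrightarrow> y' \<in> component A j \<Longrightarrow>
      product A x (y + y') = product A x y + product A x y'"
    using conjunct1[OF c4] by blast
  show "x \<in> component A i \<Longrightarrow> y \<in> component A j \<Longrightarrow>
      product A (action A r x) y = action A r (product A x y)"
    using conjunct1[OF c5] by blast
  show "x \<in> component A i \<Longrightarrow> y \<in> component A j \<Longrightarrow>
      product A x (action A r y) = action A r (product A x y)"
    using conjunct1[OF c5] by blast
  show "x \<in> component A i \<Longrightarrow> y \<in> component A j \<Longrightarrow> boundary A (product A x y) =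
      product A (boundary A x) y + action A ((-1) ^ i) (product A x (boundary A y))"
    using conjunct1[OF c6] by blast
  show "x \<in> component A i \<Longrightarrow> y \<in> component A j \<Longrightarrow> z \<in> component A k \<Longrightarrow>
      product A (product A x y) z = product A x (product A y z)"
    using conjunct1[OF c7] by blast
  show "x \<in> component A i \<Longrightarrow> product A (unit_elem A) x = x"
    using conjunct1[OF c9] by blast
  show "x \<in> component A i \<Longrightarrow> product A x (unit_elem A) = x"
    using conjunct1[OF c9] by blast
  show "x \<in> component A i \<Longrightarrow> y \<in> component A j \<Longrightarrow>
      product A x y = action A ((-1) ^ (i * j)) (product A y x)"
    using conjunct1[OF c10] by blast
  show "odd i \<Longrightarrow> x \<in> component A i \<Longrightarrow> product A x x = 0"
    using c11 by blast
qed

text \<open>\<open>closed\<close> makes \<open>i\<close> multiplicative and the left inverse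
  \<open>p\<close> makes it injective, so nearly every axiom can be checked in \<open>X\<close>
  after applying \<open>i\<close>.\<close>

lemma dg_algebra_transfer:
  fixes A :: "('r::comm_ring_1, 'm::ab_group_add, 'u) dga_scheme"
    and X :: "('r, 'l::ab_group_add, 'v) dga_scheme"
  assumes X: "dg_algebra X" and i: "chain_map A X i" and p: "chain_map X A p"
    and pi: "\<And>j y. y \<in> component A j \<Longrightarrow> p (i y) = y"
    and product: "\<And>x y. product A x y = p (product X (i x) (i y))"
    and closed: "\<And>j k x y. x \<in> component A j \<Longrightarrow> y \<in> component A k \<Longrightarrow>
      i (p (product X (i x) (i y))) = product X (i x) (i y)"
    and one: "unit_elem A \<in> component A 0" "i (unit_elem A) = unit_elem X"
  shows "dg_algebra A \<and> dg_algebra_hom A X i"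
proof -
  have cA: "is_complex A" using i by (simp add: chain_map_def)
  note comp = component_closed[OF cA]
  have ic: "i x \<in> component X j" if "x \<in> component A j" for x j
    using i that by (auto simp: chain_map_def graded_linear_def)
  have i_add: "i (x + y) = i x + i y" if "x \<in> component A j" "y \<in> component A j" for x y j
    using i that by (auto simp: chain_map_def graded_linear_def)
  have i_act: "i (action A r x) = action X r (i x)" if "x \<in> component A j" for r x j
    using i that by (auto simp: chain_map_def graded_linear_def)
  have i_bd: "i (boundary A x) = boundary X (i x)" if "x \<in> component A j" for x j
    using i that by (auto simp: chain_map_def)
  have pc: "p x \<in> component A j" if "x \<in> component X j" for x j
    using p that by (auto simp: chain_map_def graded_linear_def)
  have X_mult: "product X x y \<in> component X (j + k)" if "x \<in> component X j" "y \<in> component X k" for x y j k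
    by (rule dga_closed[OF X that])
  have mult: "product A x y \<in> component A (j + k)" if "x \<in> component A j" "y \<in> component A k" for x y j k
    unfolding product by (intro pc X_mult ic that)
  have i_mult: "i (product A x y) = product X (i x) (i y)" if "x \<in> component A j" "y \<in> component A k" for x y j k
    unfolding product by (rule closed[OF that])
  have inj: "x = y" if "i x = i y" "x \<in> component A j" "y \<in> component A j" for x y j
    using pi[OF that(2)] pi[OF that(3)] unfolding that(1) by (rule trans[OF sym])
  have bd: "boundary A x \<in> component A (j - 1)" if "x \<in> component A j" for x j
    using cA that component_zero[OF cA] by (cases j) (auto simp: is_complex_def)
  \<comment> \<open>For \<open>j = 0\<close> or \<open>k = 0\<close> the truncated index
    \<open>j + k - 1\<close> need not be the sum of the degrees of the factors. The boundary
    involved is then \<open>0\<close>, and a product with \<open>0\<close> has to lie in every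
    component.\<close>
  have bd_mult: "product A (boundary A x) y \<in> component A (j + k - 1)"
    "product A x (boundary A y) \<in> component A (j + k - 1)"
    if x: "x \<in> component A j" and y: "y \<in> component A k" for x y j k
  proof -
    have zero: "product A 0 y \<in> component A l" "product A x 0 \<in> component A l" for l
    proof -
      note X0 = component_zero[OF dga_complex[OF X], of 0]
      \<comment> \<open>Since \<open>0 + 0 = 0\<close>, biadditivity forces a product with
        \<open>0\<close> to vanish.\<close>
      have "product X (0 + 0) (i y) = product X 0 (i y) + product X 0 (i y)"
        "product X (i x) (0 + 0) = product X (i x) 0 + product X (i x) 0"
        by (rule dga_add_left[OF X X0 X0 ic[OF y]] dga_add_right[OF X ic[OF x] X0 X0])+
      moreover have "i 0 = 0" "p 0 = 0"
        using i p graded_linear_zero unfolding chain_map_def by blast+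
      ultimately show "product A 0 y \<in> component A l" "product A x 0 \<in> component A l"
        by (simp_all add: product component_zero[OF cA])
    qed
    show "product A (boundary A x) y \<in> component A (j + k - 1)"
    proof (cases j)
      case 0
      then have "boundary A x = 0" using cA x by (auto simp: is_complex_def)
      then show ?thesis using zero by simp
    next
      case (Suc j')
      then show ?thesis using mult[OF bd[OF x] y] by simp
    qed
    show "product A x (boundary A y) \<in> component A (j + k - 1)"
    proof (cases k)
      case 0
      then have "boundary A y = 0" using cA y by (auto simp: is_complex_def)
      then show ?thesis using zero by simp
    next
      case (Suc k')
      then show ?thesis using mult[OF x bd[OF y]] by simp
    qed
  qed
  have addl: "product A (x + x') y = product A x y + product A x' y"
    if "x \<in> component A j" "x' \<in> component A j" "y \<in> component A k" for x x' y j k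
  proof (rule inj[where j = "j + k"])
    have "i (product A x y + product A x' y) = product X (i x) (i y) + product X (i x') (i y)"
      using that by (simp add: i_add[of _ "j + k"] mult i_mult)
    also have "\<dots> = product X (i (x + x')) (i y)"
      using that by (simp add: i_add[of _ j] dga_add_left[OF X ic ic ic])
    also have "\<dots> = i (product A (x + x') y)"
      by (rule i_mult[symmetric]) (use that comp in auto)
    finally show "i (product A (x + x') y) = i (product A x y + product A x' y)" by simp
  qed (use that in \<open>auto intro: comp mult\<close>)
  have addr: "product A x (y + y') = product A x y + product A x y'"
    if "x \<in> component A j" "y \<in> component A k" "y' \<in> component A k" for x y y' j k
  proof (rule inj[where j = "j + k"])
    have "i (product A x y + product A x y') = product X (i x) (i y) + product X (i x) (i y')"
      using that by (simp add: i_add[of _ "j + k"] mult i_mult)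
    also have "\<dots> = product X (i x) (i (y + y'))"
      using that by (simp add: i_add[of _ k] dga_add_right[OF X ic ic ic])
    also have "\<dots> = i (product A x (y + y'))"
      by (rule i_mult[symmetric]) (use that comp in auto)
    finally show "i (product A x (y + y')) = i (product A x y + product A x y')" by simp
  qed (use that in \<open>auto intro: comp mult\<close>)
  have act: "product A (action A r x) y = action A r (product A x y)"
    "product A x (action A r y) = action A r (product A x y)"
    if "x \<in> component A j" "y \<in> component A k" for x y j k r
  proof -
    have r: "i (action A r (product A x y)) = action X r (product X (i x) (i y))"
      using i_act[OF mult[OF that]] i_mult[OF that] by simp
    have "product X (i (action A r x)) (i y) = action X r (product X (i x) (i y))"
      "product X (i x) (i (action A r y)) = action X r (product X (i x) (i y))"
      using that by (simp_all add: i_act dga_action_left[OF X ic ic] dga_action_right[OF X ic ic])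
    moreover have "product X (i (action A r x)) (i y) = i (product A (action A r x) y)"
      "product X (i x) (i (action A r y)) = i (product A x (action A r y))"
      using that comp by (auto intro!: i_mult[symmetric])
    ultimately show "product A (action A r x) y = action A r (product A x y)"
      "product A x (action A r y) = action A r (product A x y)"
      using r that by (auto intro!: inj[where j = "j + k"] comp mult)
  qed
  have leib: "boundary A (product A x y) =
      product A (boundary A x) y + action A ((-1) ^ j) (product A x (boundary A y))"
    if "x \<in> component A j" "y \<in> component A k" for x y j k
  proof (rule inj[where j = "j + k - 1"])
    have "i (product A (boundary A x) y + action A ((-1) ^ j) (product A x (boundary A y))) =
      product X (i (boundary A x)) (i y) + action X ((-1) ^ j) (product X (i x) (i (boundary A y)))"
      using bd_mult[OF that] i_mult[OF bd[OF that(1)] that(2)] i_mult[OF that(1) bd[OF that(2)]]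
      by (simp add: i_add[of _ "j + k - 1"] i_act[of _ "j + k - 1"] comp(3))
    also have "\<dots> = product X (boundary X (i x)) (i y) + action X ((-1) ^ j) (product X (i x) (boundary X (i y)))"
      by (simp only: i_bd[OF that(1)] i_bd[OF that(2)])
    also have "\<dots> = boundary X (product X (i x) (i y))"
      by (rule dga_leibniz[OF X ic[OF that(1)] ic[OF that(2)], symmetric])
    also have "\<dots> = i (boundary A (product A x y))"
      using i_bd[OF mult[OF that]] i_mult[OF that] by simp
    finally show "i (boundary A (product A x y)) =
      i (product A (boundary A x) y + action A ((-1) ^ j) (product A x (boundary A y)))" by simp
    show "boundary A (product A x y) \<in> component A (j + k - 1)"
      by (rule bd[OF mult[OF that]])
    show "product A (boundary A x) y + action A ((-1) ^ j) (product A x (boundary A y)) \<in> component A (j + k - 1)"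
      using bd_mult[OF that] by (intro comp)
  qed
  have assoc: "product A (product A x y) z = product A x (product A y z)"
    if "x \<in> component A j" "y \<in> component A k" "z \<in> component A l" for x y z j k l
  proof (rule inj[where j = "j + k + l"])
    have "product X (product X (i x) (i y)) (i z) = product X (i x) (product X (i y) (i z))"
      by (rule dga_assoc[OF X that[THEN ic]])
    then show "i (product A (product A x y) z) = i (product A x (product A y z))"
      using that by (simp add: i_mult[OF mult[OF that(1,2)] that(3)] i_mult[OF that(1) mult[OF that(2,3)]] i_mult)
    show "product A (product A x y) z \<in> component A (j + k + l)"
      using mult[OF mult[OF that(1,2)] that(3)] .
    show "product A x (product A y z) \<in> component A (j + k + l)"
      using mult[OF that(1) mult[OF that(2,3)]] by (simp add: add.assoc)
  qed
  have unit: "product A (unit_elem A) x = x" "product A x (unit_elem A) = x"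
    if "x \<in> component A j" for x j
    using dga_unit_left[OF X ic[OF that]] dga_unit_right[OF X ic[OF that]] pi[OF that]
    unfolding product one by simp_all
  have comm: "product A x y = action A ((-1) ^ (j * k)) (product A y x)"
    if "x \<in> component A j" "y \<in> component A k" for x y j k
  proof (rule inj[where j = "j + k"])
    have "product X (i x) (i y) = action X ((-1) ^ (j * k)) (product X (i y) (i x))"
      by (rule dga_commute[OF X ic[OF that(1)] ic[OF that(2)]])
    then show "i (product A x y) = i (action A ((-1) ^ (j * k)) (product A y x))"
      using i_act[OF mult[OF that(2,1)]] i_mult[OF that] i_mult[OF that(2,1)] by simp
    show "action A ((-1) ^ (j * k)) (product A y x) \<in> component A (j + k)"
      using comp(3)[OF mult[OF that(2,1)]] by (simp add: add.commute)
  qed (rule mult[OF that])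
  have odd: "product A x x = 0" if "odd j" "x \<in> component A j" for x j
  proof -
    have "product X (i x) (i x) = 0" by (rule dga_square[OF X that(1) ic[OF that(2)]])
    moreover have "p 0 = 0" using p graded_linear_zero unfolding chain_map_def by blast
    ultimately show ?thesis by (simp add: product)
  qed
  have "dg_algebra A"
    unfolding dg_algebra_def
    by (intro conjI allI ballI impI)
      (rule cA mult addl addr act leib assoc one(1) unit comm odd; assumption)+
  then show ?thesis
    unfolding dg_algebra_hom_def using X i one(2) i_mult by blast
qed

section \<open>The algebra \<open>\<Lambda> \<otimes> S\<close>\<close>

lemma const_mult: "const a * const b = const (a * b)"
  by (simp add: const_def mult_single)

lemma const_add: "const (a + b) = const a + const b"
  by (simp add: const_def single_add)

lemma const_zero [simp]: "const 0 = 0"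
  by (simp add: const_def)

lemma const_one [simp]: "const 1 = 1"
  by (simp add: const_def)

lemma const_mult_single: "const r * Poly_Mapping.single \<mu> s = Poly_Mapping.single \<mu> (r * s)"
  by (simp add: const_def mult_single)

lemma poly_mapping_eq_sum_single:
  fixes p :: "'a \<Rightarrow>\<^sub>0 'b::comm_monoid_add"
  assumes "finite A" "keys p \<subseteq> A"
  shows "p = (\<Sum>x\<in>A. Poly_Mapping.single x (lookup p x))"
proof (rule poly_mapping_eqI)
  fix k
  have "(\<Sum>x\<in>A. lookup (Poly_Mapping.single x (lookup p x)) k)
      = (\<Sum>x\<in>A. if x = k then lookup p k else 0)"
    by (intro sum.cong) (auto simp: lookup_single when_def)
  also have "\<dots> = lookup p k"
    using assms by (auto simp: sum.delta' in_keys_iff)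
  finally show "lookup p k = lookup (\<Sum>x\<in>A. Poly_Mapping.single x (lookup p x)) k"
    by (simp add: lookup_sum)
qed

lemma lookup_const_mult: "lookup (const r * p) \<mu> = r * lookup p \<mu>"
  for p :: "('n \<Rightarrow>\<^sub>0 nat) \<Rightarrow>\<^sub>0 'c::comm_ring_1"
proof -
  have "const r * p = (\<Sum>\<nu>\<in>keys p. Poly_Mapping.single \<nu> (r * lookup p \<nu>))"
    by (subst (1) poly_mapping_eq_sum_single[of "keys p" p])
      (simp_all add: sum_distrib_left const_mult_single)
  then show ?thesis
    by (auto simp: lookup_sum lookup_single when_def sum.delta in_keys_iff)
qed

lemma single_sum: "Poly_Mapping.single x (\<Sum>a\<in>A. f a) = (\<Sum>a\<in>A. Poly_Mapping.single x (f a))"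
  by (induction A rule: infinite_finite_induct) (simp_all add: single_add)

lemma mdeg_add: "mdeg (\<mu> + \<nu>) = mdeg \<mu> + mdeg \<nu>"
  by (simp add: mdeg_def lookup_add sum.distrib)

lemma mdeg_zero [simp]: "mdeg 0 = 0"
  by (simp add: mdeg_def)

lemma mdeg_single [simp]: "mdeg (Poly_Mapping.single t k) = k"
  by (simp add: mdeg_def lookup_single when_def)

lemma ext_expand:
  fixes \<xi> :: "('n::finite, 'k::field) extS"
  shows "\<xi> = (\<Sum>I\<in>UNIV. \<Sum>\<mu>\<in>keys (lookup \<xi> I).
     Poly_Mapping.single I (Poly_Mapping.single \<mu> (lookup (lookup \<xi> I) \<mu>)))"
proof -
  have "\<xi> = (\<Sum>I\<in>UNIV. Poly_Mapping.single I (lookup \<xi> I))"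
    by (rule poly_mapping_eq_sum_single) auto
  also have "\<dots> = (\<Sum>I\<in>UNIV. Poly_Mapping.single I
      (\<Sum>\<mu>\<in>keys (lookup \<xi> I). Poly_Mapping.single \<mu> (lookup (lookup \<xi> I) \<mu>)))"
    by (intro sum.cong refl arg_cong[where f = "Poly_Mapping.single _"] poly_mapping_eq_sum_single) auto
  finally show ?thesis by (simp add: single_sum)
qed

text \<open>Each element is the sum of its terms \<open>r e_I y^\<mu>\<close>, and membership in
  \<open>bigraded P\<close> passes to these terms. Identities between additive maps thus reduce to
  basis elements.\<close>

lemma bigraded_induct [consumes 1, case_names zero add basis]:
  fixes \<xi> :: "('n::finite, 'k::field) extS"
  assumes "\<xi> \<in> bigraded P"
    and zero: "Q 0"
    and add: "\<And>\<xi> \<eta>. Q \<xi> \<Longrightarrow> Q \<eta> \<Longrightarrow> Q (\<xi> + \<eta>)"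
    and basis: "\<And>I \<mu> r. P (card I) (mdeg \<mu>) \<Longrightarrow> Q (Poly_Mapping.single I (Poly_Mapping.single \<mu> r))"
  shows "Q \<xi>"
proof -
  have sumQ: "Q (\<Sum>x\<in>A. f x)" if "\<And>x. x \<in> A \<Longrightarrow> Q (f x)"
    for A :: "'n set set" and f
    using that by (induction A rule: infinite_finite_induct) (auto intro: zero add)
  have sumQ': "Q (\<Sum>x\<in>A. f x)" if "\<And>x. x \<in> A \<Longrightarrow> Q (f x)"
    for A :: "('n \<Rightarrow>\<^sub>0 nat) set" and f
    using that by (induction A rule: infinite_finite_induct) (auto intro: zero add)
  have key: "P (card I) (mdeg \<mu>)" if "\<mu> \<in> keys (lookup \<xi> I)" for I \<mu>
    using assms(1) that unfolding bigraded_def by (metis (no_types, lifting) in_keys_iff keys_zero mem_Collect_eq empty_iff)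
  show ?thesis
    by (subst ext_expand) (intro sumQ sumQ' basis key)
qed

lemma ext_induct [case_names zero add basis]:
  fixes \<xi> :: "('n::finite, 'k::field) extS"
  assumes "Q 0" "\<And>\<xi> \<eta>. Q \<xi> \<Longrightarrow> Q \<eta> \<Longrightarrow> Q (\<xi> + \<eta>)"
    and "\<And>I \<mu> r. Q (Poly_Mapping.single I (Poly_Mapping.single \<mu> r))"
  shows "Q \<xi>"
  by (rule bigraded_induct[where P = "\<lambda>_ _. True"]) (use assms in \<open>auto simp: bigraded_def\<close>)

lemma ext_eqI:
  assumes "\<And>I \<mu>. lookup (lookup \<xi> I) \<mu> = lookup (lookup \<eta> I) \<mu>"
  shows "\<xi> = \<eta>"
  using assms by (intro poly_mapping_eqI) auto

lemma bigraded_iff: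
  "\<xi> \<in> bigraded P \<longleftrightarrow> (\<forall>I \<mu>. \<not> P (card I) (mdeg \<mu>) \<longrightarrow> lookup (lookup \<xi> I) \<mu> = 0)"
  unfolding bigraded_def by (force simp: in_keys_iff)

lemma sum_keys_superset:
  assumes "finite A" "keys p \<subseteq> A" "\<And>\<mu>. f \<mu> 0 = 0"
  shows "(\<Sum>\<mu>\<in>keys p. f \<mu> (lookup p \<mu>)) = (\<Sum>\<mu>\<in>A. f \<mu> (lookup p \<mu>))"
  using assms by (intro sum.mono_neutral_left) (auto simp: in_keys_iff)

text \<open>Cancellation may shrink the support of a sum, so all three sums are first extended to
  the union of both supports, where the new terms vanish.\<close>

lemma sum_keys_add:
  fixes p q :: "'a \<Rightarrow>\<^sub>0 'b::comm_monoid_add"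
  assumes "\<And>\<mu>. f \<mu> 0 = 0" "\<And>\<mu> r s. f \<mu> (r + s) = f \<mu> r + f \<mu> s"
  shows "(\<Sum>\<mu>\<in>keys (p + q). f \<mu> (lookup (p + q) \<mu>))
    = (\<Sum>\<mu>\<in>keys p. f \<mu> (lookup p \<mu>)) + (\<Sum>\<mu>\<in>keys q. f \<mu> (lookup q \<mu>))"
proof -
  let ?A = "keys p \<union> keys q"
  have "(\<Sum>\<mu>\<in>keys (p + q). f \<mu> (lookup (p + q) \<mu>)) = (\<Sum>\<mu>\<in>?A. f \<mu> (lookup (p + q) \<mu>))"
    "(\<Sum>\<mu>\<in>keys p. f \<mu> (lookup p \<mu>)) = (\<Sum>\<mu>\<in>?A. f \<mu> (lookup p \<mu>))"
    "(\<Sum>\<mu>\<in>keys q. f \<mu> (lookup q \<mu>)) = (\<Sum>\<mu>\<in>?A. f \<mu> (lookup q \<mu>))"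
    by (rule sum_keys_superset; use assms Poly_Mapping.keys_add[of p q] in auto)+
  then show ?thesis
    by (simp add: assms lookup_add sum.distrib)
qed

text \<open>The common shape of \<open>sigma\<close> and of the bidegree weights \<open>wt\<close>:
  maps prescribed on basis elements.\<close>

definition ext_lin :: "('n set \<Rightarrow> ('n \<Rightarrow>\<^sub>0 nat) \<Rightarrow> ('n::finite, 'k::field) polyR \<Rightarrow> 'z::comm_monoid_add)
    \<Rightarrow> ('n, 'k) extS \<Rightarrow> 'z" where
  "ext_lin f \<xi> = (\<Sum>I\<in>UNIV. \<Sum>\<mu>\<in>keys (lookup \<xi> I). f I \<mu> (lookup (lookup \<xi> I) \<mu>))"

lemma ext_lin_add:
  assumes "\<And>I \<mu>. f I \<mu> 0 = 0" "\<And>I \<mu> r s. f I \<mu> (r + s) = f I \<mu> r + f I \<mu> s"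
  shows "ext_lin f (\<xi> + \<eta>) = ext_lin f \<xi> + ext_lin f \<eta>"
  unfolding ext_lin_def lookup_add[of \<xi> \<eta>]
  by (subst sum_keys_add[where f = "f _"]) (simp_all add: assms sum.distrib)

lemma ext_lin_basis:
  assumes "\<And>I \<mu>. f I \<mu> 0 = 0"
  shows "ext_lin f (Poly_Mapping.single I (Poly_Mapping.single \<mu> r)) = f I \<mu> r"
proof -
  have "ext_lin f (Poly_Mapping.single I (Poly_Mapping.single \<mu> r)) =
     (\<Sum>J\<in>UNIV. if J = I then f I \<mu> r else 0)"
    unfolding ext_lin_def
    by (intro sum.cong refl) (auto simp: lookup_single when_def assms)
  then show ?thesis by simp
qed

text \<open>One operator for everything that rescales by bidegree: the projections
  \<open>bipart\<close>, the sign \<open>(-1)^i\<close>, the Euler operator \<open>i + m\<close> and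
  the denominators of \<open>sigma\<close>. A single family of commutation rules then covers them
  all.\<close>

definition wt :: "(nat \<Rightarrow> nat \<Rightarrow> 'k) \<Rightarrow> ('n::finite, 'k::field) extS \<Rightarrow> ('n, 'k) extS" where
  "wt f = ext_lin (\<lambda>I \<mu> r. Poly_Mapping.single I (Poly_Mapping.single \<mu> (const (f (card I) (mdeg \<mu>)) * r)))"

lemma wt_add: "wt f (\<xi> + \<eta>) = wt f \<xi> + wt f \<eta>"
  unfolding wt_def by (rule ext_lin_add) (simp_all add: distrib_left single_add)

lemma wt_zero [simp]: "wt f 0 = 0"
  by (simp add: wt_def ext_lin_def)

lemma wt_basis: "wt f (Poly_Mapping.single I (Poly_Mapping.single \<mu> r)) =
    Poly_Mapping.single I (Poly_Mapping.single \<mu> (const (f (card I) (mdeg \<mu>)) * r))"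
  unfolding wt_def by (rule ext_lin_basis) simp

lemma lookup_wt: "lookup (lookup (wt f \<xi>) I) \<mu> = const (f (card I) (mdeg \<mu>)) * lookup (lookup \<xi> I) \<mu>"
  by (induction \<xi> rule: ext_induct)
    (auto simp: wt_add wt_basis lookup_add distrib_left lookup_single when_def)

lemma wt_uminus: "wt f (- \<xi>) = - wt f \<xi>"
  by (rule ext_eqI) (simp add: lookup_wt lookup_uminus)

lemma wt_diff: "wt f (\<xi> - \<eta>) = wt f \<xi> - wt f \<eta>"
  by (rule ext_eqI) (simp add: lookup_wt lookup_minus right_diff_distrib)

lemma wt_wt: "wt f (wt g \<xi>) = wt (\<lambda>i m. f i m * g i m) \<xi>"
  by (rule ext_eqI) (simp add: lookup_wt const_mult[symmetric] mult.assoc)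

lemma wt_cong:
  assumes "\<xi> \<in> bigraded P" "\<And>i m. P i m \<Longrightarrow> f i m = g i m"
  shows "wt f \<xi> = wt g \<xi>"
proof (rule ext_eqI)
  fix I \<mu>
  show "lookup (lookup (wt f \<xi>) I) \<mu> = lookup (lookup (wt g \<xi>) I) \<mu>"
    using assms by (cases "P (card I) (mdeg \<mu>)") (auto simp: bigraded_iff lookup_wt)
qed

lemma wt_one: "wt (\<lambda>_ _. 1) \<xi> = \<xi>"
  by (rule ext_eqI) (simp add: lookup_wt)

section \<open>Projections onto sums of bidegrees\<close>

lemma bipart_eq_wt: "bipart P = wt (\<lambda>i m. if P i m then 1 else 0)"
proof
  fix \<xi> :: "('n::finite, 'k::field) extS"
  show "bipart P \<xi> = wt (\<lambda>i m. if P i m then 1 else 0) \<xi>"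
    unfolding bipart_def wt_def ext_lin_def
    by (intro sum.cong[OF refl] sum.mono_neutral_cong_left) auto
qed

lemma lookup_bipart:
  "lookup (lookup (bipart P \<xi>) I) \<mu> = (if P (card I) (mdeg \<mu>) then lookup (lookup \<xi> I) \<mu> else 0)"
  by (simp add: bipart_eq_wt lookup_wt)

lemma bipart_id: "\<xi> \<in> bigraded P \<Longrightarrow> bipart P \<xi> = \<xi>"
  by (rule ext_eqI) (auto simp: lookup_bipart bigraded_iff)

lemma bipart_in_bigraded: "\<xi> \<in> bigraded Q \<Longrightarrow> bipart P \<xi> \<in> bigraded (\<lambda>i m. P i m \<and> Q i m)"
  by (auto simp: lookup_bipart bigraded_iff)

lemma bigraded_UNIV: "\<xi> \<in> bigraded (\<lambda>_ _. True)"
  by (simp add: bigraded_iff)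

lemma bigraded_mono: "\<xi> \<in> bigraded P \<Longrightarrow> (\<And>i m. P i m \<Longrightarrow> Q i m) \<Longrightarrow> \<xi> \<in> bigraded Q"
  by (auto simp: bigraded_iff)

lemma bigraded_zero [simp]: "0 \<in> bigraded P"
  by (simp add: bigraded_iff)

lemma bigraded_add: "\<xi> \<in> bigraded P \<Longrightarrow> \<eta> \<in> bigraded P \<Longrightarrow> \<xi> + \<eta> \<in> bigraded P"
  by (simp add: bigraded_iff lookup_add)

lemma bigraded_uminus: "\<xi> \<in> bigraded P \<Longrightarrow> - \<xi> \<in> bigraded P"
  by (simp add: bigraded_iff lookup_uminus)

lemma bigraded_sum: "(\<And>x. x \<in> A \<Longrightarrow> f x \<in> bigraded P) \<Longrightarrow> sum f A \<in> bigraded P"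
  by (induction A rule: infinite_finite_induct) (auto intro: bigraded_add)

lemma bigraded_wt: "\<xi> \<in> bigraded P \<Longrightarrow> wt f \<xi> \<in> bigraded P"
  by (simp add: bigraded_iff lookup_wt)

lemma bigraded_basis: "P (card I) (mdeg \<mu>) \<Longrightarrow> Poly_Mapping.single I (Poly_Mapping.single \<mu> r) \<in> bigraded P"
  by (auto simp: bigraded_iff lookup_single when_def)

subsection \<open>The exterior product\<close>

lemma ext_mult_add_left: "ext_mult (\<xi> + \<xi>') \<eta> = ext_mult \<xi> \<eta> + ext_mult \<xi>' \<eta>"
  by (simp add: ext_mult_def lookup_add distrib_left distrib_right single_add sum.distrib)

lemma ext_mult_add_right: "ext_mult \<eta> (\<xi> + \<xi>') = ext_mult \<eta> \<xi> + ext_mult \<eta> \<xi>'"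
  by (simp add: ext_mult_def lookup_add distrib_left distrib_right single_add sum.distrib)

lemma ext_mult_zero_left [simp]: "ext_mult 0 \<eta> = 0"
  by (simp add: ext_mult_def)

lemma ext_mult_zero_right [simp]: "ext_mult \<eta> 0 = 0"
  by (simp add: ext_mult_def)

lemma ext_mult_uminus_left: "ext_mult (- \<xi>) \<eta> = - ext_mult \<xi> \<eta>"
  by (metis add.inverse_unique add.right_inverse ext_mult_add_left ext_mult_zero_left)

lemma ext_mult_uminus_right: "ext_mult \<xi> (- \<eta>) = - ext_mult \<xi> \<eta>"
  by (metis add.inverse_unique add.right_inverse ext_mult_add_right ext_mult_zero_right)

lemma ext_mult_diff_left: "ext_mult (\<xi> - \<xi>') \<eta> = ext_mult \<xi> \<eta> - ext_mult \<xi>' \<eta>"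
  by (metis add_diff_cancel_right' diff_add_cancel ext_mult_add_left)

lemma ext_mult_diff_right: "ext_mult \<eta> (\<xi> - \<xi>') = ext_mult \<eta> \<xi> - ext_mult \<eta> \<xi>'"
  by (metis add_diff_cancel_right' diff_add_cancel ext_mult_add_right)

lemma ext_mult_sum_right: "ext_mult \<eta> (sum f A) = (\<Sum>x\<in>A. ext_mult \<eta> (f x))"
  by (induction A rule: infinite_finite_induct) (simp_all add: ext_mult_add_right)

lemma ext_mult_single:
  "ext_mult (Poly_Mapping.single I p) (Poly_Mapping.single J q) =
     Poly_Mapping.single (I \<union> J) (wedge_sign I J * (p * q))"
proof -
  have *: "Poly_Mapping.single (I' \<union> J') (wedge_sign I' J' *
      (lookup (Poly_Mapping.single I p) I' * lookup (Poly_Mapping.single J q) J')) =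
    (if J' = J then if I' = I then Poly_Mapping.single (I \<union> J) (wedge_sign I J * (p * q)) else 0 else 0)"
    for I' J'
    by (auto simp: lookup_single when_def)
  show ?thesis
    unfolding ext_mult_def * by simp
qed

definition inversions :: "'n::linorder set \<Rightarrow> 'n set \<Rightarrow> nat" where
  "inversions I J = card {(s, t). s \<in> I \<and> t \<in> J \<and> t < s}"

lemma inversions_union_left:
  fixes I J K :: "'n::{finite,linorder} set"
  assumes "I \<inter> J = {}"
  shows "inversions (I \<union> J) K = inversions I K + inversions J K"
  unfolding inversions_def using assms
  by (subst card_Un_disjoint[symmetric]) (auto intro!: arg_cong[where f = card])

lemma inversions_union_right:
  fixes I J K :: "'n::{finite,linorder} set"
  assumes "J \<inter> K = {}"
  shows "inversions I (J \<union> K) = inversions I J + inversions I K"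
  unfolding inversions_def using assms
  by (subst card_Un_disjoint[symmetric]) (auto intro!: arg_cong[where f = card])

text \<open>Disjointness excludes ties, so each pair in \<open>I \<times> J\<close> is an inversion
  for exactly one of the two orders.\<close>

lemma inversions_swap:
  fixes I J :: "'n::{finite,linorder} set"
  assumes "I \<inter> J = {}"
  shows "inversions I J + inversions J I = card I * card J"
proof -
  have "inversions J I = card (prod.swap ` {(s, t). s \<in> J \<and> t \<in> I \<and> t < s})"
    unfolding inversions_def by (intro card_image[symmetric]) auto
  also have "prod.swap ` {(s, t). s \<in> J \<and> t \<in> I \<and> t < s} = {(s, t). s \<in> I \<and> t \<in> J \<and> s < t}"
    by (auto simp: image_iff)
  finally have "inversions I J + inversions J I =
      card ({(s, t). s \<in> I \<and> t \<in> J \<and> t < s} \<union> {(s, t). s \<in> I \<and> t \<in> J \<and> s < t})"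
    unfolding inversions_def by (subst card_Un_disjoint) auto
  also have "{(s, t). s \<in> I \<and> t \<in> J \<and> t < s} \<union> {(s, t). s \<in> I \<and> t \<in> J \<and> s < t} = I \<times> J"
    using assms by force
  finally show ?thesis by (simp add: card_cartesian_product)
qed

lemma wedge_sign_alt: "wedge_sign I J = (if I \<inter> J = {} then (-1) ^ inversions I J else 0)"
  by (simp add: wedge_sign_def inversions_def)

text \<open>Both sides vanish unless the three sets are pairwise disjoint; then both exponents count
  the inversions between \<open>I\<close> and \<open>J\<close>, \<open>I\<close> and
  \<open>K\<close>, \<open>J\<close> and \<open>K\<close>.\<close>

lemma wedge_sign_assoc:
  "(wedge_sign I J :: 'c::ring_1) * wedge_sign (I \<union> J) K = wedge_sign J K * wedge_sign I (J \<union> K)"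
  by (auto simp: wedge_sign_alt inversions_union_left inversions_union_right power_add[symmetric] Int_Un_distrib Int_Un_distrib2
     intro!: arg_cong[where f = "\<lambda>n. (-1) ^ n"])

lemma wedge_sign_commute: "wedge_sign I J = (-1) ^ (card I * card J) * (wedge_sign J I :: 'c::ring_1)"
proof (cases "I \<inter> J = {}")
  case True
  have "(-1) ^ (card I * card J) = (-1 :: 'c) ^ inversions I J * (-1) ^ inversions J I"
    by (simp add: inversions_swap[OF True, symmetric] power_add)
  then show ?thesis using True
    by (simp add: wedge_sign_alt Int_commute minus_one_power_iff)
next
  case False
  then show ?thesis by (simp add: wedge_sign_alt Int_commute)
qed

lemma wedge_sign_mult_single:
  "wedge_sign I J * Poly_Mapping.single \<mu> (r :: 'c::comm_ring_1) =
     Poly_Mapping.single \<mu> (wedge_sign I J * r)"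
  for \<mu> :: "'m::comm_monoid_add"
proof -
  have "wedge_sign I J = (Poly_Mapping.single 0 (wedge_sign I J) :: 'm \<Rightarrow>\<^sub>0 'c)"
    by (auto simp: wedge_sign_alt minus_one_power_iff single_uminus)
  then show ?thesis by (metis mult_single add_0)
qed

lemma ext_mult_assoc: "ext_mult (ext_mult \<xi> \<eta>) \<zeta> = ext_mult \<xi> (ext_mult \<eta> \<zeta>)"
proof (induction \<xi> rule: ext_induct)
  case (basis I \<mu> r)
  show ?case
  proof (induction \<eta> rule: ext_induct)
    case (basis J \<nu> s)
    show ?case
    proof (induction \<zeta> rule: ext_induct)
      case (basis K \<pi> t)
      define p q w where "p = Poly_Mapping.single \<mu> r" "q = Poly_Mapping.single \<nu> s" "w = Poly_Mapping.single \<pi> t"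
      have "wedge_sign (I \<union> J) K * (wedge_sign I J * (p * q) * w) =
        (wedge_sign I J * wedge_sign (I \<union> J) K) * (p * q * w)" by (simp add: algebra_simps)
      also have "\<dots> = wedge_sign I (J \<union> K) * (p * (wedge_sign J K * (q * w)))"
        by (simp add: wedge_sign_assoc algebra_simps)
      finally show ?case
        unfolding p_q_w_def[symmetric] ext_mult_single Un_assoc by (rule arg_cong)
    qed (auto simp: ext_mult_add_right)
  qed (auto simp: ext_mult_add_right ext_mult_add_left)
qed (auto simp: ext_mult_add_left)

lemma ext_mult_one_left [simp]: "ext_mult (Poly_Mapping.single {} 1) \<xi> = \<xi>"
  by (induction \<xi> rule: ext_induct) (simp_all add: ext_mult_add_right ext_mult_single wedge_sign_def)

lemma ext_mult_one_right [simp]: "ext_mult \<xi> (Poly_Mapping.single {} 1) = \<xi>"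
  by (induction \<xi> rule: ext_induct) (simp_all add: ext_mult_add_left ext_mult_single wedge_sign_def)

lemma bigraded_mult:
  assumes "\<xi> \<in> bigraded P" "\<eta> \<in> bigraded Q"
    and "\<And>i m j l. P i m \<Longrightarrow> Q j l \<Longrightarrow> R (i + j) (m + l)"
  shows "ext_mult \<xi> \<eta> \<in> bigraded R"
  using assms(1)
proof (induction \<xi> rule: bigraded_induct)
  case (basis I \<mu> r)
  note 1 = basis
  show ?case using assms(2)
  proof (induction \<eta> rule: bigraded_induct)
    case (basis J \<nu> s)
    show ?case
    proof (cases "I \<inter> J = {}")
      case True
      then show ?thesis using assms(3)[OF 1 basis]
        by (auto simp: ext_mult_single mult_single wedge_sign_mult_single mdeg_add card_Un_disjoint
            intro!: bigraded_basis)
    qed (simp add: ext_mult_single wedge_sign_def)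
  qed (auto simp: ext_mult_add_right bigraded_add)
qed (auto simp: ext_mult_add_left bigraded_add)

text \<open>Truncations are compatible with products because \<open>tr\<^bsub>\<ge>a\<^esub>\<close> is an ideal.\<close>

lemma bipart_ext_mult_bipart:
  "bipart (\<lambda>j m. m < a) (ext_mult (bipart (\<lambda>j m. m < a) \<xi>) \<eta>) = bipart (\<lambda>j m. m < a) (ext_mult \<xi> \<eta>)"
  "bipart (\<lambda>j m. m < a) (ext_mult \<eta> (bipart (\<lambda>j m. m < a) \<xi>)) = bipart (\<lambda>j m. m < a) (ext_mult \<eta> \<xi>)"
proof -
  let ?T = "bipart (\<lambda>j m. m < a)"
  have 0: "\<xi> - ?T \<xi> \<in> bigraded (\<lambda>j m. a \<le> m)"
    by (simp add: bigraded_iff lookup_minus lookup_bipart)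
  have T0: "?T \<zeta> = 0" if "\<zeta> \<in> bigraded (\<lambda>j m. a \<le> m)" for \<zeta> :: "('a, 'b) extS"
    using that by (intro ext_eqI) (auto simp: lookup_bipart bigraded_iff)
  have "?T (ext_mult (\<xi> - ?T \<xi>) \<eta>) = 0" "?T (ext_mult \<eta> (\<xi> - ?T \<xi>)) = 0"
    by (rule T0; rule bigraded_mult[OF 0 bigraded_UNIV] bigraded_mult[OF bigraded_UNIV 0]; simp)+
  then show "?T (ext_mult (?T \<xi>) \<eta>) = ?T (ext_mult \<xi> \<eta>)" "?T (ext_mult \<eta> (?T \<xi>)) = ?T (ext_mult \<eta> \<xi>)"
    by (simp_all add: ext_mult_diff_left ext_mult_diff_right bipart_eq_wt wt_diff)
qed

lemma ext_mult_commute: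
  assumes "\<xi> \<in> bigraded (\<lambda>l _. l = i)" "\<eta> \<in> bigraded (\<lambda>l _. l = j)"
  shows "ext_mult \<xi> \<eta> = wt (\<lambda>_ _. (-1) ^ (i * j)) (ext_mult \<eta> \<xi>)"
  using assms(1)
proof (induction \<xi> rule: bigraded_induct)
  case (basis I \<mu> r)
  note 1 = basis
  show ?case using assms(2)
  proof (induction \<eta> rule: bigraded_induct)
    case (basis J \<nu> s)
    have "const ((-1) ^ (i * j)) = ((-1) ^ (i * j) :: ('a, 'b) polyR)"
      by (simp add: minus_one_power_iff const_def single_uminus)
    then show ?case using 1 basis wedge_sign_commute[of I J, where 'c = "('a, 'b) polyR"]
      by (auto simp: ext_mult_single mult_single wedge_sign_mult_single wt_basis algebra_simps Un_commute)
  qed (auto simp: ext_mult_add_right ext_mult_add_left wt_add)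
qed (auto simp: ext_mult_add_left ext_mult_add_right wt_add)

text \<open>Graded commutativity does not give this in characteristic two. Basis elements with
  nonempty \<open>I\<close> square to zero by \<open>I \<inter> I \<noteq> {}\<close>, and the cross
  terms of a sum cancel.\<close>

lemma ext_mult_self_odd:
  assumes "\<xi> \<in> bigraded (\<lambda>l _. l = i)" "odd i"
  shows "ext_mult \<xi> \<xi> = 0"
proof -
  \<comment> \<open>The degree is carried through the induction because the cross terms cancel only
    for homogeneous summands.\<close>
  have "ext_mult \<xi> \<xi> = 0 \<and> \<xi> \<in> bigraded (\<lambda>l _. l = i)"
    using assms(1)
  proof (induction \<xi> rule: bigraded_induct)
    case (add \<xi> \<eta>)
    have "ext_mult \<eta> \<xi> = wt (\<lambda>_ _. - 1) (ext_mult \<xi> \<eta>)"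
      using ext_mult_commute[of \<eta> i \<xi> i] add \<open>odd i\<close> by simp
    also have "\<dots> = - ext_mult \<xi> \<eta>"
      by (rule ext_eqI) (simp add: lookup_wt lookup_uminus const_def single_uminus)
    finally show ?case using add
      by (simp add: bigraded_add ext_mult_add_left ext_mult_add_right)
  next
    case (basis I \<mu> r)
    have "I \<noteq> {}" using basis \<open>odd i\<close> by auto
    then show ?case using basis
      by (auto simp: ext_mult_single wedge_sign_def intro: bigraded_basis)
  qed auto
  then show ?thesis ..
qed

subsection \<open>Contractions\<close>

text \<open>Contraction with the \<open>S\<close>-linear form \<open>e_t \<mapsto> c t\<close>. The
  coefficients \<open>y_t\<close>, \<open>- x_t\<close> and \<open>y_t - x_t\<close> give
  \<open>\<kappa>\<close>, \<open>d\<close> and the differential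
  \<open>\<kappa> + d\<close>.\<close>

definition contr :: "('n \<Rightarrow> ('n, 'k) polyS) \<Rightarrow> ('n::{finite,linorder}, 'k::field) extS \<Rightarrow> ('n, 'k) extS" where
  "contr c \<xi> = (\<Sum>I\<in>UNIV. \<Sum>t\<in>I.
     Poly_Mapping.single (I - {t}) ((-1) ^ card {s\<in>I. s < t} * (c t * lookup \<xi> I)))"

abbreviation gen :: "'n \<Rightarrow> ('n::{finite,linorder}, 'k::field) extS" where
  "gen t \<equiv> Poly_Mapping.single {t} 1"

abbreviation ofS :: "('n::{finite,linorder}, 'k::field) polyS \<Rightarrow> ('n, 'k) extS" where
  "ofS q \<equiv> Poly_Mapping.single {} q"

lemma kappa_eq_contr: "kappa = contr indet"
  by (rule ext) (simp add: kappa_def contr_def)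

lemma kos_eq_contr: "kos = contr (\<lambda>t. - const (indet t))"
  by (rule ext) (simp add: kos_def contr_def)

lemma contr_add: "contr c (\<xi> + \<eta>) = contr c \<xi> + contr c \<eta>"
  by (simp add: contr_def lookup_add distrib_left single_add sum.distrib)

lemma contr_add_coeffs: "contr (\<lambda>t. c t + c' t) \<xi> = contr c \<xi> + contr c' \<xi>"
  by (simp add: contr_def distrib_left distrib_right single_add sum.distrib)

lemma contr_zero [simp]: "contr c 0 = 0"
  by (simp add: contr_def)

lemma contr_uminus: "contr c (- \<xi>) = - contr c \<xi>"
  by (metis add.inverse_unique add.right_inverse contr_add contr_zero)

lemma contr_diff: "contr c (\<xi> - \<eta>) = contr c \<xi> - contr c \<eta>"
  by (metis add_diff_cancel_right' diff_add_cancel contr_add)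

lemma contr_single: "contr c (Poly_Mapping.single I p) =
    (\<Sum>t\<in>I. Poly_Mapping.single (I - {t}) ((-1) ^ card {s\<in>I. s < t} * (c t * p)))"
proof -
  have "contr c (Poly_Mapping.single I p) = (\<Sum>J\<in>UNIV. if J = I then
      (\<Sum>t\<in>I. Poly_Mapping.single (I - {t}) ((-1) ^ card {s\<in>I. s < t} * (c t * p))) else 0)"
    unfolding contr_def by (intro sum.cong refl) (auto simp: lookup_single when_def)
  then show ?thesis by simp
qed

lemma contr_ofS [simp]: "contr c (ofS p) = 0"
  by (simp add: contr_single)

lemma ofS_mult_single: "ext_mult (ofS q) (Poly_Mapping.single I p) = Poly_Mapping.single I (q * p)"
  by (simp add: ext_mult_single wedge_sign_def)

lemma gen_mult_single: "ext_mult (gen t) (Poly_Mapping.single I p) =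
   (if t \<in> I then 0 else Poly_Mapping.single (insert t I) ((-1) ^ card {s\<in>I. s < t} * p))"
proof -
  have "{(s, r). s = t \<and> r \<in> I \<and> r < s} = Pair t ` {s\<in>I. s < t}" by auto
  then have "card {(s, r). s = t \<and> r \<in> I \<and> r < s} = card {s\<in>I. s < t}"
    by (simp add: card_image inj_on_def)
  then show ?thesis by (simp add: ext_mult_single wedge_sign_def)
qed

lemma gen_mult_gen: "ext_mult (gen s) (ext_mult (gen t) \<xi>) = - ext_mult (gen t) (ext_mult (gen s) \<xi>)"
proof -
  have *: "{r. r = t \<and> r < s} = (if t < s then {t} else {})" for s t :: 'a by auto
  have "ext_mult (gen s) (gen t) = (- ext_mult (gen t) (gen s) :: ('a, 'b) extS)" for s t
    by (cases s t rule: linorder_cases) (auto simp: gen_mult_single * insert_commute single_uminus)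
  then show ?thesis by (simp add: ext_mult_assoc[symmetric] ext_mult_uminus_left[symmetric])
qed

lemma ofS_mult_gen: "ext_mult (ofS q) (ext_mult (gen t) \<xi>) = ext_mult (gen t) (ext_mult (ofS q) \<xi>)"
  by (simp add: ext_mult_assoc[symmetric] ext_mult_single wedge_sign_def)

lemma ofS_mult_ofS: "ext_mult (ofS q) (ext_mult (ofS p) \<xi>) = ext_mult (ofS (q * p)) \<xi>"
  by (simp add: ext_mult_assoc[symmetric] ext_mult_single wedge_sign_def)

lemma lookup_ofS_mult: "lookup (ext_mult (ofS q) \<xi>) I = q * lookup \<xi> I"
  by (induction \<xi> rule: ext_induct)
    (auto simp: ext_mult_add_right lookup_add distrib_left ofS_mult_single lookup_single when_def)

text \<open>Turns the \<open>R\<close>-action into a product, so that \<open>R\<close>-linearity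
  follows from the multiplication rules.\<close>

lemma scaleR_ext_eq: "scaleR_ext r \<xi> = ext_mult (ofS (const r)) \<xi>"
  by (rule poly_mapping_eqI) (simp add: scaleR_ext_def lookup_sum lookup_single lookup_ofS_mult when_def)

lemma contr_ofS_mult: "contr c (ext_mult (ofS q) \<xi>) = ext_mult (ofS q) (contr c \<xi>)"
  by (induction \<xi> rule: ext_induct)
    (auto simp: ext_mult_add_right contr_add ofS_mult_single contr_single ext_mult_sum_right algebra_simps)

text \<open>Together with \<open>S\<close>-linearity this determines a contraction; later identities
  rest on these two rules instead of explicit signs.\<close>

lemma contr_gen_mult:
  "contr c (ext_mult (gen t) \<xi>) = ext_mult (ofS (c t)) \<xi> - ext_mult (gen t) (contr c \<xi>)"
proof (induction \<xi> rule: ext_induct)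
  case (basis I \<mu> r)
  define p where "p = Poly_Mapping.single \<mu> r"
  define f where "f s J = card {r\<in>J. r < s}" for s :: 'a and J
  let ?m = "(-1 :: ('a, 'b) polyS)"
  show ?case
  proof (cases "t \<in> I")
    case True
    \<comment> \<open>Only the summand from which \<open>t\<close> was removed survives the product
      with \<open>e_t\<close>; its two equal signs cancel.\<close>
    have "ext_mult (gen t) (contr c (Poly_Mapping.single I p)) =
      (\<Sum>s\<in>I. if s = t then Poly_Mapping.single I (c t * p) else 0)"
      unfolding contr_single ext_mult_sum_right
    proof (intro sum.cong refl)
      fix s assume "s \<in> I"
      have "{r \<in> I. (r \<in> I \<longrightarrow> r \<noteq> t) \<and> r < t} = {r \<in> I. r < t}" by auto
      moreover have "{r \<in> I. r \<noteq> t \<and> r < t} = {r \<in> I. r < t}" by auto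
      ultimately show "ext_mult (gen t) (Poly_Mapping.single (I - {s}) (?m ^ card {r \<in> I. r < s} * (c s * p))) =
        (if s = t then Poly_Mapping.single I (c t * p) else 0)"
        using True by (auto simp: gen_mult_single insert_absorb mult.assoc[symmetric] power_add[symmetric]
            mult_2[symmetric])
    qed
    also have "\<dots> = Poly_Mapping.single I (c t * p)" using True by simp
    finally show ?thesis using True by (simp add: gen_mult_single ofS_mult_single flip: p_def)
  next
    case False
    let ?I = "insert t I"
    have f1: "f t ?I = f t I" unfolding f_def by (rule arg_cong[where f = card]) auto
    \<comment> \<open>Inserting \<open>t\<close> and removing \<open>s\<close> in the two orders:
      exactly one of the positions of \<open>s\<close> and \<open>t\<close> shifts by one, namely
      that of the larger index.\<close>
    have f2: "?m ^ f s ?I * ?m ^ f t I = - (?m ^ f t (I - {s}) * ?m ^ f s I)" if "s \<in> I" for s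
    proof (cases "t < s")
      case True
      have "{r\<in>?I. r < s} = insert t {r\<in>I. r < s}" "{r\<in>I - {s}. r < t} = {r\<in>I. r < t}"
        using True by auto
      then show ?thesis using False by (simp add: f_def)
    next
      case ts: False
      have "{r\<in>?I. r < s} = {r\<in>I. r < s}" "{r\<in>I. r < t} = insert s {r\<in>I - {s}. r < t}"
        using ts that False by (auto simp: not_less le_less)
      then show ?thesis by (simp add: f_def)
    qed
    have "contr c (ext_mult (gen t) (Poly_Mapping.single I p)) =
      (\<Sum>s\<in>?I. Poly_Mapping.single (?I - {s}) (?m ^ f s ?I * (c s * (?m ^ f t I * p))))"
      using False by (simp add: gen_mult_single contr_single f_def)
    also have "\<dots> = Poly_Mapping.single I (c t * p) +
       (\<Sum>s\<in>I. Poly_Mapping.single (?I - {s}) (?m ^ f s ?I * (c s * (?m ^ f t I * p))))"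
    proof -
      have *: "?m ^ f t I * (c t * (?m ^ f t I * p)) = c t * p"
        by (simp add: minus_one_power_iff)
      show ?thesis using False by (simp add: f1 *)
    qed
    also have "(\<Sum>s\<in>I. Poly_Mapping.single (?I - {s}) (?m ^ f s ?I * (c s * (?m ^ f t I * p)))) =
       - ext_mult (gen t) (contr c (Poly_Mapping.single I p))"
      unfolding contr_single ext_mult_sum_right sum_negf[symmetric]
    proof (intro sum.cong refl)
      fix s assume s: "s \<in> I"
      have "?m ^ f s ?I * (c s * (?m ^ f t I * p)) = (?m ^ f s ?I * ?m ^ f t I) * (c s * p)"
        by (simp add: mult_ac)
      also have "\<dots> = - (?m ^ f t (I - {s}) * (?m ^ f s I * (c s * p)))"
        unfolding f2[OF s] by (simp add: mult_ac)
      finally have *: "?m ^ f s ?I * (c s * (?m ^ f t I * p)) = - (?m ^ f t (I - {s}) * (?m ^ f s I * (c s * p)))" .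
      have "?I - {s} = insert t (I - {s})" using s False by auto
      then show "Poly_Mapping.single (?I - {s}) (?m ^ f s ?I * (c s * (?m ^ f t I * p))) =
        - ext_mult (gen t) (Poly_Mapping.single (I - {s}) (?m ^ card {r \<in> I. r < s} * (c s * p)))"
        using s False unfolding * by (simp add: gen_mult_single single_uminus f_def)
    qed
    finally show ?thesis by (simp add: ofS_mult_single p_def)
  qed
qed (auto simp: ext_mult_add_right contr_add)

text \<open>As an algebra, \<open>\<Lambda> \<otimes> S\<close> is generated over \<open>R\<close> by the \<open>e\<^sub>t\<close> and the \<open>y\<^sub>t\<close>.\<close>

lemma ext_gen_induct [case_names add const gen var]:
  fixes \<xi> :: "('n::{finite,linorder}, 'k::field) extS"
  assumes add: "\<And>\<xi> \<eta>. Q \<xi> \<Longrightarrow> Q \<eta> \<Longrightarrow> Q (\<xi> + \<eta>)"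
    and const: "\<And>r. Q (ofS (const r))"
    and gen: "\<And>t \<xi>. Q \<xi> \<Longrightarrow> Q (ext_mult (gen t) \<xi>)"
    and var: "\<And>t \<xi>. Q \<xi> \<Longrightarrow> Q (ext_mult (ofS (indet t)) \<xi>)"
  shows "Q \<xi>"
proof (induction \<xi> rule: ext_induct)
  case zero
  then show ?case using const[of 0] by simp
next
  case (add \<xi> \<eta>)
  then show ?case by (rule assms(1))
next
  case (basis I \<mu> r)
  have "finite I" by simp
  then show ?case
  proof (induction I arbitrary: r)
    case empty
    show ?case
    proof (induction "mdeg \<mu>" arbitrary: \<mu>)
      case 0
      then have "\<mu> = 0" by (intro poly_mapping_eqI) (simp add: mdeg_def)
      then show ?case using const[of r] by (simp add: const_def)
    next
      case (Suc k)
      then obtain t where t: "lookup \<mu> t \<noteq> 0"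
        by (metis mdeg_def nat.distinct(1) sum.neutral)
      \<comment> \<open>Split off a variable that divides the monomial, which lowers the degree by
        one.\<close>
      define \<nu> where "\<nu> = \<mu> - Poly_Mapping.single t 1"
      have \<mu>: "\<mu> = Poly_Mapping.single t 1 + \<nu>"
        using t by (intro poly_mapping_eqI) (auto simp: \<nu>_def lookup_add lookup_minus lookup_single when_def)
      then have "mdeg \<mu> = Suc (mdeg \<nu>)" by (simp add: mdeg_add)
      then have "Q (ofS (Poly_Mapping.single \<nu> r))" using Suc by simp
      from var[OF this, of t] show ?case
        by (simp add: ofS_mult_single \<mu> indet_def mult_single)
    qed
  next
    case (insert t I)
    \<comment> \<open>\<open>?s\<close> compensates the sign that arises when \<open>e_t\<close> is
      moved to its place in \<open>insert t I\<close>.\<close>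
    let ?s = "(-1) ^ card {s\<in>I. s < t} :: ('n, 'k) polyR"
    have "Q (ext_mult (gen t) (Poly_Mapping.single I (Poly_Mapping.single \<mu> (?s * r))))"
      by (rule gen) (rule insert.IH)
    also have "ext_mult (gen t) (Poly_Mapping.single I (Poly_Mapping.single \<mu> (?s * r))) =
        Poly_Mapping.single (insert t I) (Poly_Mapping.single \<mu> r)"
      using insert.hyps by (simp add: gen_mult_single minus_one_power_iff single_uminus)
    finally show ?case .
  qed
qed

section \<open>Contractions as anticommuting antiderivations, and their interaction with
  weights\<close>

lemma contr_contr: "contr c (contr c \<xi>) = 0"
proof (induction \<xi> rule: ext_gen_induct)
  case (gen t \<xi>)
  then show ?case by (simp add: contr_gen_mult contr_diff contr_ofS_mult)
qed (simp_all add: contr_add contr_ofS_mult)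

text \<open>Polarization of \<open>contr_contr\<close>: the family \<open>c + c'\<close> also gives
  a square-zero contraction.\<close>

lemma contr_anticommute: "contr c (contr c' \<xi>) = - contr c' (contr c \<xi>)"
  using contr_contr[of "\<lambda>t. c t + c' t" \<xi>]
  by (simp add: contr_add_coeffs contr_add contr_contr eq_neg_iff_add_eq_0)

lemma wt_minus: "wt (\<lambda>i m. - f i m) \<xi> = - wt f \<xi>"
  by (rule ext_eqI) (simp add: lookup_wt lookup_uminus const_def single_uminus)

text \<open>Carries the sign of the left factor in a Leibniz rule, so that antiderivation rules hold
  for inhomogeneous elements and can be proved by induction over sums.\<close>

abbreviation grade_inv :: "('n::finite, 'k::field) extS \<Rightarrow> ('n, 'k) extS" where
  "grade_inv \<equiv> wt (\<lambda>i m. (-1) ^ i)"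

text \<open>A weight passes through a bihomogeneous map once its indices are shifted by the bidegree
  of that map: \<open>(1, 0)\<close> for \<open>e_t\<close>, \<open>(0, 1)\<close> for
  \<open>y_t\<close>, and below \<open>(-1, k)\<close> for contractions and \<open>(1, -1)\<close>
  for \<open>deRham\<close>.\<close>

lemma wt_gen_mult:
  assumes "\<And>i m. f (Suc i) m = g i m"
  shows "wt f (ext_mult (gen t) \<xi>) = ext_mult (gen t) (wt g \<xi>)"
proof (induction \<xi> rule: ext_induct)
  case (basis I \<mu> r)
  show ?case
    by (auto simp: gen_mult_single wt_basis assms minus_one_power_iff single_uminus[symmetric])
qed (auto simp: ext_mult_add_right wt_add)

lemma wt_indet_mult:
  assumes "\<And>i m. f i (Suc m) = g i m"
  shows "wt f (ext_mult (ofS (indet t)) \<xi>) = ext_mult (ofS (indet t)) (wt g \<xi>)"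
  by (induction \<xi> rule: ext_induct)
    (auto simp: ext_mult_add_right wt_add ofS_mult_single indet_def mult_single mdeg_add wt_basis assms)

lemma wt_const_mult: "wt f (ext_mult (ofS (const r)) \<xi>) = ext_mult (ofS (const r)) (wt f \<xi>)"
  by (rule ext_eqI) (simp add: lookup_wt lookup_ofS_mult lookup_const_mult mult_ac)

lemma wt_scaleR: "wt f (scaleR_ext r \<xi>) = scaleR_ext r (wt f \<xi>)"
  for \<xi> :: "('n::{finite,linorder}, 'k::field) extS"
  by (simp add: scaleR_ext_eq wt_const_mult)

lemma grade_inv_gen_mult: "grade_inv (ext_mult (gen t) \<xi>) = - ext_mult (gen t) (grade_inv \<xi>)"
  by (subst wt_gen_mult[where g = "\<lambda>i m. - ((-1) ^ i)"]) (simp_all add: wt_minus ext_mult_uminus_right)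

text \<open>Induction over algebra generators in the left factor: the rule is compatible with sums
  and with left multiplication by \<open>e_t\<close> and \<open>y_t\<close>.\<close>

lemma contr_mult:
  "contr c (ext_mult \<xi> \<eta>) = ext_mult (contr c \<xi>) \<eta> + ext_mult (grade_inv \<xi>) (contr c \<eta>)"
proof (induction \<xi> rule: ext_gen_induct)
  case (add \<xi> \<xi>')
  then show ?case by (simp add: ext_mult_add_left contr_add wt_add)
next
  case (const r)
  have "grade_inv (ofS (const r)) = ofS (const r)" by (simp add: const_def wt_basis)
  then show ?case by (simp add: contr_ofS_mult)
next
  case (gen t \<xi>)
  then show ?case using gen
    by (simp add: ext_mult_assoc contr_gen_mult grade_inv_gen_mult ext_mult_add_right ext_mult_diff_left ext_mult_uminus_left)
next
  case (var t \<xi>)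
  have "grade_inv (ext_mult (ofS (indet t)) \<xi>) = ext_mult (ofS (indet t)) (grade_inv \<xi>)"
    by (rule wt_indet_mult) simp
  then show ?case using var
    by (simp add: ext_mult_assoc contr_ofS_mult ext_mult_add_right)
qed

lemma wt_sum: "wt f (sum g A) = (\<Sum>x\<in>A. wt f (g x))"
  by (induction A rule: infinite_finite_induct) (simp_all add: wt_add)

lemma minus_one_power_mult_single:
  "(-1) ^ k * Poly_Mapping.single \<mu> (r :: 'c::comm_ring_1) = Poly_Mapping.single \<mu> ((-1) ^ k * r)"
  for \<mu> :: "'m::comm_monoid_add"
  by (cases "even k") (simp_all add: single_uminus)

text \<open>Coefficients that are monomials of one degree \<open>k\<close> make the contraction
  bihomogeneous; \<open>k = 1\<close> is the case of \<open>kappa\<close>, \<open>k = 0\<close> that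
  of \<open>kos\<close>.\<close>

lemma wt_contr:
  assumes c: "\<And>t. c t = Poly_Mapping.single (\<nu> t) (b t)" "\<And>t. mdeg (\<nu> t) = k"
    and fg: "\<And>i m. f i (m + k) = g (Suc i) m"
  shows "wt f (contr c \<xi>) = contr c (wt g \<xi>)"
proof (induction \<xi> rule: ext_induct)
  case (basis I \<mu> r)
  have "wt f (Poly_Mapping.single (I - {t}) ((- 1) ^ card {s \<in> I. s < t} * (c t * Poly_Mapping.single \<mu> r))) =
      Poly_Mapping.single (I - {t})
        ((- 1) ^ card {s \<in> I. s < t} * (c t * Poly_Mapping.single \<mu> (const (g (card I) (mdeg \<mu>)) * r)))"
    if "t \<in> I" for t
  proof -
    have "Suc (card (I - {t})) = card I" using that by (simp add: card_Suc_Diff1 del: card_Diff_insert)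
    then have "f (card (I - {t})) (mdeg \<mu> + k) = g (card I) (mdeg \<mu>)" by (simp add: fg)
    then show ?thesis
      by (simp add: c mult_single minus_one_power_mult_single wt_basis mdeg_add add.commute mult.left_commute)
  qed
  then show ?case
    by (simp add: wt_basis contr_single wt_sum)
qed (auto simp: contr_add wt_add)

lemma wt_kappa:
  assumes "\<And>i m. f i (Suc m) = g (Suc i) m"
  shows "wt f (kappa \<xi>) = kappa (wt g \<xi>)"
  unfolding kappa_eq_contr
  by (rule wt_contr[where k = 1 and \<nu> = "\<lambda>t. Poly_Mapping.single t 1" and b = "\<lambda>_. 1"])
    (simp_all add: indet_def assms)

lemma wt_kos:
  assumes "\<And>i m. f i m = g (Suc i) m"
  shows "wt f (kos \<xi>) = kos (wt g \<xi>)"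
  unfolding kos_eq_contr
  by (rule wt_contr[where k = 0 and \<nu> = "\<lambda>_. 0" and b = "\<lambda>t. - indet t"]) (simp_all add: const_def single_uminus assms)

subsection \<open>The de Rham differential\<close>

text \<open>The partial derivative \<open>\<partial>/\<partial>y_t\<close>. Where truncated
  subtraction of exponents would be wrong, the factor \<open>lookup \<mu> t\<close> is
  \<open>0\<close>.\<close>

definition pd :: "'n \<Rightarrow> ('n::finite, 'k::field) polyS \<Rightarrow> ('n, 'k) polyS" where
  "pd t p = (\<Sum>\<mu>\<in>keys p. Poly_Mapping.single (\<mu> - Poly_Mapping.single t 1) (of_nat (lookup \<mu> t) * lookup p \<mu>))"

lemma pd_add: "pd t (p + q) = pd t p + pd t q"
  unfolding pd_def by (rule sum_keys_add) (simp_all add: distrib_left single_add)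

lemma pd_zero [simp]: "pd t 0 = 0"
  by (simp add: pd_def)

lemma pd_uminus: "pd t (- p) = - pd t p"
  by (metis add.inverse_unique add.right_inverse pd_add pd_zero)

lemma pd_single: "pd t (Poly_Mapping.single \<mu> r) =
    Poly_Mapping.single (\<mu> - Poly_Mapping.single t 1) (of_nat (lookup \<mu> t) * r)"
  by (cases "r = 0") (simp_all add: pd_def)

lemma polyS_induct [case_names zero add single]:
  fixes p :: "('n::finite, 'k::field) polyS"
  assumes "Q 0" "\<And>p q. Q p \<Longrightarrow> Q q \<Longrightarrow> Q (p + q)" "\<And>\<mu> r. Q (Poly_Mapping.single \<mu> r)"
  shows "Q p"
proof -
  have "Q (\<Sum>\<mu>\<in>A. Poly_Mapping.single \<mu> (lookup p \<mu>))" for A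
    by (induction A rule: infinite_finite_induct) (auto intro: assms)
  from this[of "keys p"] show ?thesis
    by (simp flip: poly_mapping_eq_sum_single)
qed

lemma pd_const_mult: "pd t (const r * p) = const r * pd t p"
  by (induction p rule: polyS_induct)
    (auto simp: pd_add distrib_left const_mult_single pd_single mult_ac)

lemma pd_indet_mult: "pd t (indet s * p) = (if s = t then p else 0) + indet s * pd t p"
proof (induction p rule: polyS_induct)
  case (single \<mu> r)
  let ?s = "Poly_Mapping.single s (1::nat)" and ?t = "Poly_Mapping.single t (1::nat)"
  show ?case
  \<comment> \<open>The exponents \<open>s + \<mu> - t\<close> and \<open>s + (\<mu> - t)\<close>
    agree under truncated subtraction if \<open>y_t\<close> divides \<open>y^\<mu>\<close>, but may
    differ otherwise.\<close>
  proof (cases "lookup \<mu> t = 0")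
    case True
    have "?t + \<mu> - ?t = \<mu>" by simp
    then show ?thesis using True
      by (auto simp: indet_def mult_single pd_single lookup_add lookup_single when_def)
  next
    case False
    then have "?s + \<mu> - ?t = ?s + (\<mu> - ?t)"
      by (intro poly_mapping_eqI) (auto simp: lookup_add lookup_minus lookup_single when_def)
    then show ?thesis
      by (auto simp: indet_def mult_single pd_single lookup_add lookup_single when_def distrib_right
          single_add[symmetric])
  qed
qed (auto simp: pd_add distrib_left)

definition deRham :: "('n::{finite,linorder}, 'k::field) extS \<Rightarrow> ('n, 'k) extS" where
  "deRham \<xi> = (\<Sum>I\<in>UNIV. \<Sum>t\<in>UNIV. ext_mult (gen t) (Poly_Mapping.single I (pd t (lookup \<xi> I))))"

lemma deRham_add: "deRham (\<xi> + \<eta>) = deRham \<xi> + deRham \<eta>"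
  by (simp add: deRham_def lookup_add pd_add single_add ext_mult_add_right sum.distrib)

lemma deRham_zero [simp]: "deRham 0 = 0"
  by (simp add: deRham_def)

lemma deRham_uminus: "deRham (- \<xi>) = - deRham \<xi>"
  by (metis add.inverse_unique add.right_inverse deRham_add deRham_zero)

lemma deRham_diff: "deRham (\<xi> - \<eta>) = deRham \<xi> - deRham \<eta>"
  by (metis add_diff_cancel_right' diff_add_cancel deRham_add)

lemma deRham_single: "deRham (Poly_Mapping.single I p) =
    (\<Sum>t\<in>UNIV. ext_mult (gen t) (Poly_Mapping.single I (pd t p)))"
proof -
  have "deRham (Poly_Mapping.single I p) = (\<Sum>J\<in>UNIV. if J = I then
      (\<Sum>t\<in>UNIV. ext_mult (gen t) (Poly_Mapping.single I (pd t p))) else 0)"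
    unfolding deRham_def by (intro sum.cong refl) (auto simp: lookup_single when_def)
  then show ?thesis by simp
qed

lemma deRham_const_mult: "deRham (ext_mult (ofS (const r)) \<xi>) = ext_mult (ofS (const r)) (deRham \<xi>)"
  by (induction \<xi> rule: ext_induct)
    (auto simp: ext_mult_add_right deRham_add ofS_mult_single deRham_single pd_const_mult
      ext_mult_sum_right ofS_mult_gen)

lemma deRham_gen_mult: "deRham (ext_mult (gen t) \<xi>) = - ext_mult (gen t) (deRham \<xi>)"
proof (induction \<xi> rule: ext_induct)
  case (basis I \<mu> r)
  have *: "ext_mult (gen t) (Poly_Mapping.single I (pd s p)) = (if t \<in> I then 0 else
      Poly_Mapping.single (insert t I) (pd s ((-1) ^ card {s\<in>I. s < t} * p)))"
    for s and p :: "('a, 'b) polyS"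
    by (auto simp: gen_mult_single minus_one_power_iff pd_uminus)
  have "deRham (ext_mult (gen t) (Poly_Mapping.single I p)) =
      (\<Sum>s\<in>UNIV. ext_mult (gen s) (ext_mult (gen t) (Poly_Mapping.single I (pd s p))))"
    for p :: "('a, 'b) polyS"
    unfolding * by (simp add: gen_mult_single deRham_single)
  then show ?case
    by (simp add: deRham_single ext_mult_sum_right sum_negf[symmetric]) (intro sum.cong refl gen_mult_gen)
qed (auto simp: ext_mult_add_right deRham_add)

lemma deRham_indet_mult:
  "deRham (ext_mult (ofS (indet t)) \<xi>) = ext_mult (gen t) \<xi> + ext_mult (ofS (indet t)) (deRham \<xi>)"
proof (induction \<xi> rule: ext_induct)
  case (basis I \<mu> r)
  have "ext_mult (gen s) (Poly_Mapping.single I (pd s (indet t * p))) =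
     (if t = s then ext_mult (gen t) (Poly_Mapping.single I p) else 0) +
     ext_mult (ofS (indet t)) (ext_mult (gen s) (Poly_Mapping.single I (pd s p)))"
    for s and p :: "('a, 'b) polyS"
    by (auto simp: pd_indet_mult single_add ext_mult_add_right ofS_mult_gen ofS_mult_single)
  then show ?case
    by (simp add: deRham_single ofS_mult_single sum.distrib ext_mult_sum_right)
qed (auto simp: ext_mult_add_right deRham_add)

lemma deRham_const [simp]: "deRham (ofS (const r)) = 0"
  by (simp add: deRham_single const_def pd_single)

lemma wt_deRham:
  assumes "\<And>i m. f (Suc i) m = g i (Suc m)"
  shows "wt f (deRham \<xi>) = deRham (wt g \<xi>)"
proof (induction \<xi> rule: ext_induct)
  case (basis I \<mu> r)
  have "wt f (ext_mult (gen t) (Poly_Mapping.single I (pd t (Poly_Mapping.single \<mu> r)))) =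
    ext_mult (gen t) (Poly_Mapping.single I (pd t (Poly_Mapping.single \<mu> (const (g (card I) (mdeg \<mu>)) * r))))" for t
  \<comment> \<open>Either the derivative vanishes or the polynomial degree drops by exactly one, as
    the shift of the weight requires.\<close>
  proof (cases "lookup \<mu> t = 0")
    case False
    then have "\<mu> - Poly_Mapping.single t 1 + Poly_Mapping.single t 1 = \<mu>"
      by (intro poly_mapping_eqI) (auto simp: lookup_add lookup_minus lookup_single when_def)
    then have "Suc (mdeg (\<mu> - Poly_Mapping.single t 1)) = mdeg \<mu>"
      by (metis mdeg_add mdeg_single add.commute plus_1_eq_Suc)
    then have "wt f (Poly_Mapping.single (insert t I) (Poly_Mapping.single (\<mu> - Poly_Mapping.single t 1) s)) =
      Poly_Mapping.single (insert t I) (Poly_Mapping.single (\<mu> - Poly_Mapping.single t 1)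
        (const (g (card I) (mdeg \<mu>)) * s))" if "t \<notin> I" for s
      using that by (simp add: wt_basis assms)
    then show ?thesis
      by (simp add: gen_mult_single pd_single minus_one_power_mult_single mult.left_commute)
  qed (simp add: pd_single)
  then show ?case by (simp add: wt_basis deRham_single wt_sum)
qed (auto simp: deRham_add wt_add)

lemma deRham_deRham: "deRham (deRham \<xi>) = 0"
  by (induction \<xi> rule: ext_gen_induct)
    (simp_all add: deRham_add deRham_gen_mult deRham_uminus deRham_indet_mult)

lemma deRham_mult:
  "deRham (ext_mult \<xi> \<eta>) = ext_mult (deRham \<xi>) \<eta> + ext_mult (grade_inv \<xi>) (deRham \<eta>)"
proof (induction \<xi> rule: ext_gen_induct)
  case (add \<xi> \<xi>')
  then show ?case by (simp add: ext_mult_add_left deRham_add wt_add)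
next
  case (const r)
  have "grade_inv (ofS (const r)) = ofS (const r)" by (simp add: const_def wt_basis)
  then show ?case by (simp add: deRham_const_mult)
next
  case (gen t \<xi>)
  then show ?case
    by (simp add: ext_mult_assoc deRham_gen_mult grade_inv_gen_mult ext_mult_add_right ext_mult_uminus_left)
next
  case (var t \<xi>)
  have "grade_inv (ext_mult (ofS (indet t)) \<xi>) = ext_mult (ofS (indet t)) (grade_inv \<xi>)"
    by (rule wt_indet_mult) simp
  then show ?case using var
    by (simp add: ext_mult_assoc deRham_indet_mult ext_mult_add_right ext_mult_add_left)
qed

lemma wt_add_fun: "wt (\<lambda>i m. f i m + g i m) \<xi> = wt f \<xi> + wt g \<xi>"
  by (rule ext_eqI) (simp add: lookup_wt lookup_add const_add distrib_right)

text \<open>Cartan's formula for the Euler field. The anticommutator of the two antiderivations is a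
  derivation that fixes every \<open>e_t\<close> and \<open>y_t\<close>, so it multiplies by the
  number \<open>i + m\<close> of generators.\<close>

lemma kappa_deRham: "kappa (deRham \<xi>) + deRham (kappa \<xi>) = wt (\<lambda>i m. of_nat (i + m)) \<xi>"
proof (induction \<xi> rule: ext_gen_induct)
  case (add \<xi> \<xi>')
  then show ?case by (simp add: kappa_eq_contr contr_add deRham_add wt_add algebra_simps)
next
  case (const r)
  show ?case by (simp add: kappa_eq_contr const_def wt_basis deRham_single pd_single)
next
  case (gen t \<xi>)
  have "wt (\<lambda>i m. of_nat (i + m)) (ext_mult (gen t) \<xi>) = ext_mult (gen t) (wt (\<lambda>i m. 1 + of_nat (i + m)) \<xi>)"
    by (rule wt_gen_mult) simp
  also have "wt (\<lambda>i m. 1 + of_nat (i + m)) \<xi> = \<xi> + (kappa (deRham \<xi>) + deRham (kappa \<xi>))"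
    by (simp only: wt_add_fun wt_one gen)
  finally show ?case
    by (simp add: kappa_eq_contr contr_gen_mult deRham_gen_mult contr_uminus deRham_diff
        deRham_indet_mult ext_mult_add_right)
next
  case (var t \<xi>)
  have "wt (\<lambda>i m. of_nat (i + m)) (ext_mult (ofS (indet t)) \<xi>) =
      ext_mult (ofS (indet t)) (wt (\<lambda>i m. 1 + of_nat (i + m)) \<xi>)"
    by (rule wt_indet_mult) simp
  also have "wt (\<lambda>i m. 1 + of_nat (i + m)) \<xi> = \<xi> + (kappa (deRham \<xi>) + deRham (kappa \<xi>))"
    by (simp only: wt_add_fun wt_one var)
  finally show ?case
    by (simp add: kappa_eq_contr contr_add contr_ofS_mult contr_gen_mult deRham_indet_mult ext_mult_add_right)
qed

text \<open>\<open>deRham\<close> preserves \<open>i + m\<close>, so the denominators may be applied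
  after it instead of before.\<close>

lemma sigma_eq_wt_deRham: "sigma \<xi> = wt (\<lambda>i m. 1 / of_nat (i + m)) (deRham \<xi>)"
proof -
  let ?f = "\<lambda>I \<mu> r. \<Sum>t\<in>keys \<mu>. ext_mult (Poly_Mapping.single {t} 1)
       (Poly_Mapping.single I (Poly_Mapping.single (\<mu> - Poly_Mapping.single t 1)
         (const (of_nat (lookup \<mu> t) / of_nat (card I + mdeg \<mu>)) * r)))"
  have sig: "sigma = ext_lin ?f" by (rule ext) (simp add: sigma_def ext_lin_def)
  have sig_add: "sigma (\<xi> + \<eta>) = sigma \<xi> + sigma \<eta>" for \<xi> \<eta> :: "('a, 'b) extS"
    unfolding sig by (rule ext_lin_add) (simp_all add: distrib_left single_add ext_mult_add_right sum.distrib)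
  show ?thesis
  proof (induction \<xi> rule: ext_induct)
    case zero
    show ?case by (simp add: sigma_def)
  next
    case (add \<xi> \<eta>)
    then show ?case by (simp add: sig_add wt_add deRham_add)
  next
    case (basis I \<mu> r)
    let ?N = "of_nat (card I + mdeg \<mu>) :: 'b"
    have c: "of_nat n = const (of_nat n :: 'b)" for n
      by (induction n) (simp_all add: const_add)
    have "wt (\<lambda>i m. 1 / of_nat (i + m)) (deRham (Poly_Mapping.single I (Poly_Mapping.single \<mu> r))) =
      deRham (wt (\<lambda>i m. 1 / of_nat (i + m)) (Poly_Mapping.single I (Poly_Mapping.single \<mu> r)))"
      by (rule wt_deRham) simp
    also have "\<dots> = (\<Sum>t\<in>UNIV. ext_mult (gen t) (Poly_Mapping.single I (Poly_Mapping.single (\<mu> - Poly_Mapping.single t 1)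
        (const (of_nat (lookup \<mu> t) / ?N) * r))))"
      unfolding wt_basis deRham_single pd_single c mult.assoc[symmetric] const_mult by simp
    \<comment> \<open>Variables that do not divide the monomial contribute zero.\<close>
    also have "\<dots> = ?f I \<mu> r"
      by (rule sum.mono_neutral_right) (auto simp: in_keys_iff)
    also have "\<dots> = sigma (Poly_Mapping.single I (Poly_Mapping.single \<mu> r))"
      unfolding sig by (rule ext_lin_basis[symmetric]) simp
    finally show ?case by simp
  qed
qed

subsection \<open>Evaluation\<close>

lemma evalS_add: "evalS (p + q) = evalS p + evalS q"
  unfolding evalS_def by (rule sum_keys_add) (simp_all add: distrib_right)

lemma evalS_zero [simp]: "evalS 0 = 0"
  by (simp add: evalS_def)

lemma evalS_uminus: "evalS (- p) = - evalS p"
  by (metis add.inverse_unique add.right_inverse evalS_add evalS_zero)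

lemma evalS_diff: "evalS (p - q) = evalS p - evalS q"
  by (metis add_diff_cancel_right' diff_add_cancel evalS_add)

lemma evalS_sum: "evalS (sum f A) = (\<Sum>x\<in>A. evalS (f x))"
  by (induction A rule: infinite_finite_induct) (simp_all add: evalS_add)

lemma evalS_single: "evalS (Poly_Mapping.single \<mu> r) = r * (\<Prod>t\<in>UNIV. indet t ^ lookup \<mu> t)"
  by (cases "r = 0") (simp_all add: evalS_def)

lemma evalS_const [simp]: "evalS (const r) = r"
  by (simp add: const_def evalS_single)

lemma evalS_const_mult: "evalS (const r * p) = r * evalS p"
  by (induction p rule: polyS_induct)
    (auto simp: distrib_left evalS_add const_mult_single evalS_single mult_ac)

lemma evalS_indet_mult: "evalS (indet t * p) = indet t * evalS p"
proof (induction p rule: polyS_induct)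
  case (single \<mu> r)
  have "(\<Prod>s\<in>UNIV. indet s ^ lookup (Poly_Mapping.single t 1 + \<mu>) s) =
      (\<Prod>s\<in>UNIV. if s = t then indet t else 1) * (\<Prod>s\<in>UNIV. indet s ^ lookup \<mu> s :: ('a, 'b) polyR)"
    unfolding prod.distrib[symmetric]
    by (rule prod.cong) (auto simp: lookup_add lookup_single when_def)
  then show ?case
    by (simp add: indet_def[of t, where 'c = "('a, 'b) polyR"] mult_single evalS_single mult.left_commute)
qed (auto simp: distrib_left evalS_add)

lemma kappa_plus_kos: "kappa \<xi> + kos \<xi> = contr (\<lambda>t. indet t - const (indet t)) \<xi>"
  unfolding kappa_eq_contr kos_eq_contr by (simp flip: contr_add_coeffs)

text \<open>The untruncated differential is the contraction with the elements
  \<open>y_t - x_t\<close>, whose multiples evaluate to \<open>0\<close>.\<close>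

lemma evalS_boundary: "evalS (lookup (kappa \<xi> + kos \<xi>) {}) = 0"
proof -
  have "evalS ((-1) ^ k * ((indet t - const (indet t)) * q)) = 0" for k t and q :: "('a, 'b) polyS"
    by (cases "even k") (simp_all add: left_diff_distrib evalS_diff evalS_uminus evalS_const_mult evalS_indet_mult)
  then show ?thesis
    unfolding kappa_plus_kos
    by (simp add: contr_def lookup_sum evalS_sum lookup_single when_def if_distrib[of evalS] cong: if_cong)
qed

subsection \<open>Bidegrees\<close>

text \<open>Membership becomes a fixed-point equation of a weight, so the commutation rules for
  weights can be used to track bidegrees.\<close>

lemma wt_indicator: "\<xi> \<in> bigraded P \<longleftrightarrow> wt (\<lambda>i m. if P i m then 1 else 0) \<xi> = \<xi>"
  using bipart_id[of \<xi> P] bipart_in_bigraded[OF bigraded_UNIV, of P \<xi>]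
  by (auto simp: bipart_eq_wt)

lemma wt_eq_self:
  assumes "\<xi> \<in> bigraded P" "\<And>i m. P i m \<Longrightarrow> f i m = 1"
  shows "wt f \<xi> = \<xi>"
  using wt_cong[OF assms(1), of f "\<lambda>_ _. 1"] assms(2) by (simp add: wt_one)

lemma bigraded_kappa:
  assumes "\<xi> \<in> bigraded P" "\<And>i m. P (Suc i) m \<Longrightarrow> Q i (Suc m)"
  shows "kappa \<xi> \<in> bigraded Q"
proof -
  \<comment> \<open>\<open>wt_kappa\<close> constrains \<open>?g\<close> in positive exterior degree
    only. In exterior degree \<open>0\<close>, which \<open>kappa\<close> kills, the value
    \<open>1\<close> is chosen so that \<open>?g\<close> fixes \<open>\<xi>\<close>.\<close>
  let ?g = "\<lambda>i m. case i of 0 \<Rightarrow> 1 | Suc j \<Rightarrow> if Q j (Suc m) then 1 else 0"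
  have "wt (\<lambda>i m. if Q i m then 1 else 0) (kappa \<xi>) = kappa (wt ?g \<xi>)"
    by (rule wt_kappa) simp
  also have "wt ?g \<xi> = \<xi>"
    by (rule wt_eq_self[OF assms(1)]) (auto simp: assms(2) split: nat.split)
  finally show ?thesis by (simp only: wt_indicator)
qed

lemma bigraded_kos:
  assumes "\<xi> \<in> bigraded P" "\<And>i m. P (Suc i) m \<Longrightarrow> Q i m"
  shows "kos \<xi> \<in> bigraded Q"
proof -
  let ?g = "\<lambda>i m. case i of 0 \<Rightarrow> 1 | Suc j \<Rightarrow> if Q j m then 1 else 0"
  have "wt (\<lambda>i m. if Q i m then 1 else 0) (kos \<xi>) = kos (wt ?g \<xi>)"
    by (rule wt_kos) simp
  also have "wt ?g \<xi> = \<xi>"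
    by (rule wt_eq_self[OF assms(1)]) (auto simp: assms(2) split: nat.split)
  finally show ?thesis by (simp only: wt_indicator)
qed

lemma bigraded_deRham:
  assumes "\<xi> \<in> bigraded P" "\<And>i m. P i (Suc m) \<Longrightarrow> Q (Suc i) m"
  shows "deRham \<xi> \<in> bigraded Q"
proof -
  \<comment> \<open>Here polynomial degree \<open>0\<close>, which \<open>deRham\<close> kills, gets
    the default value \<open>1\<close>.\<close>
  let ?g = "\<lambda>i m. case m of 0 \<Rightarrow> 1 | Suc l \<Rightarrow> if Q (Suc i) l then 1 else 0"
  have "wt (\<lambda>i m. if Q i m then 1 else 0) (deRham \<xi>) = deRham (wt ?g \<xi>)"
    by (rule wt_deRham) simp
  also have "wt ?g \<xi> = \<xi>"
    by (rule wt_eq_self[OF assms(1)]) (auto simp: assms(2) split: nat.split)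
  finally show ?thesis by (simp only: wt_indicator)
qed

lemma bigraded_sigma:
  assumes "\<xi> \<in> bigraded P" "\<And>i m. P i (Suc m) \<Longrightarrow> Q (Suc i) m"
  shows "sigma \<xi> \<in> bigraded Q"
  unfolding sigma_eq_wt_deRham by (rule bigraded_wt, rule bigraded_deRham, rule assms(1)) (rule assms(2))

lemma bigraded_False: "\<xi> \<in> bigraded (\<lambda>_ _. False) \<longleftrightarrow> \<xi> = 0"
  by (auto simp: bigraded_iff intro!: ext_eqI)

text \<open>Source of the bound \<open>i \<le> n\<close> behind the range
  \<open>i + m < a + n\<close>.\<close>

lemma bigraded_card_le: "\<xi> \<in> bigraded P \<Longrightarrow> \<xi> \<in> bigraded (\<lambda>i m. P i m \<and> i \<le> CARD('n))"
  for \<xi> :: "('n::finite, 'k::field) extS"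
  by (auto simp: bigraded_iff card_mono)

section \<open>Relations between \<open>kappa\<close>, \<open>kos\<close> and
  \<open>sigma\<close>\<close>

lemma kappa_add: "kappa (\<xi> + \<eta>) = kappa \<xi> + kappa \<eta>"
  and kappa_diff: "kappa (\<xi> - \<eta>) = kappa \<xi> - kappa \<eta>"
  and kappa_uminus: "kappa (- \<xi>) = - kappa \<xi>"
  and kappa_zero [simp]: "kappa 0 = 0"
  and kappa_kappa: "kappa (kappa \<xi>) = 0"
  and kappa_kos: "kappa (kos \<xi>) = - kos (kappa \<xi>)"
  and kos_add: "kos (\<xi> + \<eta>) = kos \<xi> + kos \<eta>"
  and kos_diff: "kos (\<xi> - \<eta>) = kos \<xi> - kos \<eta>"
  and kos_uminus: "kos (- \<xi>) = - kos \<xi>"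
  and kos_zero [simp]: "kos 0 = 0"
  and kos_kos: "kos (kos \<xi>) = 0"
  by (simp_all add: kappa_eq_contr kos_eq_contr contr_add contr_diff contr_uminus contr_contr
      contr_anticommute[of indet])

lemma kappa_scaleR: "kappa (scaleR_ext r \<xi>) = scaleR_ext r (kappa \<xi>)"
  and kos_scaleR: "kos (scaleR_ext r \<xi>) = scaleR_ext r (kos \<xi>)"
  by (simp_all add: kappa_eq_contr kos_eq_contr scaleR_ext_eq contr_ofS_mult)

lemma sigma_add: "sigma (\<xi> + \<eta>) = sigma \<xi> + sigma \<eta>"
  and sigma_diff: "sigma (\<xi> - \<eta>) = sigma \<xi> - sigma \<eta>"
  and sigma_uminus: "sigma (- \<xi>) = - sigma \<xi>"
  and sigma_zero [simp]: "sigma 0 = 0"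
  and sigma_scaleR: "sigma (scaleR_ext r \<xi>) = scaleR_ext r (sigma \<xi>)"
  by (simp_all add: sigma_eq_wt_deRham deRham_add deRham_diff deRham_uminus wt_add wt_diff wt_uminus
      scaleR_ext_eq deRham_const_mult wt_const_mult)

lemma sigma_sigma: "sigma (sigma \<xi>) = 0"
proof -
  have "deRham (wt (\<lambda>i m. 1 / of_nat (i + m)) (deRham \<xi>)) = wt (\<lambda>i m. 1 / of_nat (i + m)) (deRham (deRham \<xi>))"
    by (rule wt_deRham[symmetric]) simp
  then show ?thesis by (simp add: sigma_eq_wt_deRham deRham_deRham)
qed

text \<open>Division by zero is \<open>0\<close>, so this holds in every characteristic: the weight
  is \<open>1\<close> where \<open>i + m\<close> is invertible in \<open>k\<close> and
  \<open>0\<close> elsewhere.\<close>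

lemma kappa_sigma_wt:
  "kappa (sigma \<xi>) + sigma (kappa \<xi>) = wt (\<lambda>i m. of_nat (i + m) / of_nat (i + m)) \<xi>"
proof -
  let ?f = "\<lambda>i m. 1 / of_nat (i + m)"
  have "kappa (sigma \<xi>) = wt ?f (kappa (deRham \<xi>))"
    unfolding sigma_eq_wt_deRham by (rule wt_kappa[symmetric]) simp
  then have "kappa (sigma \<xi>) + sigma (kappa \<xi>) = wt ?f (kappa (deRham \<xi>) + deRham (kappa \<xi>))"
    by (simp add: sigma_eq_wt_deRham wt_add)
  also have "\<dots> = wt (\<lambda>i m. of_nat (i + m) / of_nat (i + m)) \<xi>"
    by (simp add: kappa_deRham wt_wt)
  finally show ?thesis .
qed

lemma of_nat_neq_0_char:
  assumes "CHAR('k) = 0 \<or> CHAR('k) \<ge> b" "0 < N" "N < b"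
  shows "of_nat N \<noteq> (0 :: 'k::field)"
proof
  assume "of_nat N = (0 :: 'k)"
  then have "CHAR('k) dvd N" by (simp add: of_nat_eq_0_iff_char_dvd)
  then show False using assms by (auto dest: dvd_imp_le)
qed

text \<open>The characteristic makes \<open>i + m\<close> invertible for
  \<open>0 < i + m < b\<close>. Only bidegree \<open>(0, 0)\<close> has weight \<open>0\<close>,
  whence the correction by the projection onto it.\<close>

lemma kappa_sigma:
  fixes \<xi> :: "('n::{finite,linorder}, 'k::field) extS"
  assumes "CHAR('k) = 0 \<or> CHAR('k) \<ge> b" "\<xi> \<in> bigraded (\<lambda>i m. i + m < b)"
  shows "kappa (sigma \<xi>) = \<xi> - bipart (\<lambda>i m. i = 0 \<and> m = 0) \<xi> - sigma (kappa \<xi>)"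
proof -
  have "wt (\<lambda>i m. of_nat (i + m) / of_nat (i + m)) \<xi> =
      wt (\<lambda>i m. 1 + - (if i = 0 \<and> m = 0 then 1 else 0)) \<xi>"
    using of_nat_neq_0_char[OF assms(1)] by (intro wt_cong[OF assms(2)]) (auto simp flip: of_nat_add)
  also have "\<dots> = \<xi> - bipart (\<lambda>i m. i = 0 \<and> m = 0) \<xi>"
    unfolding wt_add_fun wt_minus wt_one bipart_eq_wt by simp
  finally show ?thesis by (simp only: eq_diff_eq kappa_sigma_wt)
qed

text \<open>Up to units, \<open>\<sigma>\<close> is the derivation \<open>deRham\<close>, so its kernel is closed under products.\<close>

lemma sigma_eq_0_iff:
  fixes \<xi> :: "('n::{finite,linorder}, 'k::field) extS"
  assumes "CHAR('k) = 0 \<or> CHAR('k) \<ge> b" "\<xi> \<in> bigraded (\<lambda>i m. i + m < b)"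
  shows "sigma \<xi> = 0 \<longleftrightarrow> deRham \<xi> = 0"
proof
  assume 0: "sigma \<xi> = 0"
  \<comment> \<open>The image of \<open>deRham\<close> has positive exterior degree, so bidegree
    \<open>(0, 0)\<close> does not occur and the weight of \<open>sigma\<close> is invertible on
    it.\<close>
  have "deRham \<xi> \<in> bigraded (\<lambda>i m. 0 < i + m \<and> i + m < b)"
    by (rule bigraded_deRham[OF assms(2)]) simp
  then have "wt (\<lambda>i m. of_nat (i + m) * (1 / of_nat (i + m))) (deRham \<xi>) = deRham \<xi>"
    by (rule wt_eq_self) (use of_nat_neq_0_char[OF assms(1)] in \<open>auto simp flip: of_nat_add\<close>)
  then show "deRham \<xi> = 0"
    using 0 unfolding sigma_eq_wt_deRham wt_wt[symmetric] by simp
qed (simp add: sigma_eq_wt_deRham)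

lemma const_uminus: "const (- a) = - const a"
  by (simp add: const_def single_uminus)

subsection \<open>Neumann series\<close>

text \<open>A map that lowers the polynomial degree is locally nilpotent.\<close>

locale lowering =
  fixes A :: "('n::{finite,linorder}, 'k::field) extS \<Rightarrow> ('n, 'k) extS"
  assumes add: "A (\<xi> + \<eta>) = A \<xi> + A \<eta>"
    and lower: "\<xi> \<in> bigraded (\<lambda>i m. m < Suc k) \<Longrightarrow> A \<xi> \<in> bigraded (\<lambda>i m. m < k)"
begin

lemma zero [simp]: "A 0 = 0"
  using add[of 0 0] by simp

lemma sum: "A (sum f B) = (\<Sum>x\<in>B. A (f x))"
  by (induction B rule: infinite_finite_induct) (simp_all add: add)

lemma power_eq_0:
  assumes "\<xi> \<in> bigraded (\<lambda>i m. m < k)" "k \<le> j"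
  shows "(A ^^ j) \<xi> = 0"
proof -
  have "(A ^^ j) \<xi> \<in> bigraded (\<lambda>i m. m < k - j)" for j
  proof (induction j)
    case (Suc j)
    show ?case
    proof (cases "k - j")
      case 0
      then have "(A ^^ j) \<xi> = 0" using Suc by (simp add: bigraded_False)
      then show ?thesis by simp
    next
      case (Suc l)
      then have "k - Suc j = l" by simp
      then show ?thesis using Suc.IH lower Suc by simp
    qed
  qed (use assms in simp)
  from this[of j] show ?thesis using assms(2) by (simp add: bigraded_False)
qed

lemma ex_bound: "\<exists>k. \<xi> \<in> bigraded (\<lambda>i m. m < k)"
proof (induction \<xi> rule: ext_induct)
  case (add \<xi> \<eta>)
  then obtain k l where "\<xi> \<in> bigraded (\<lambda>i m. m < k)" "\<eta> \<in> bigraded (\<lambda>i m. m < l)" by blast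
  then have "\<xi> + \<eta> \<in> bigraded (\<lambda>i m. m < max k l)"
    by (intro bigraded_add) (auto elim!: bigraded_mono)
  then show ?case by blast
next
  case (basis I \<mu> r)
  show ?case by (rule exI[of _ "Suc (mdeg \<mu>)"]) (simp add: bigraded_basis)
qed simp

definition neumann :: "('n, 'k) extS \<Rightarrow> ('n, 'k) extS" where
  "neumann \<xi> = Sum_any (\<lambda>k. (A ^^ k) \<xi>)"

lemma neumann_eq_sum:
  assumes "\<xi> \<in> bigraded (\<lambda>i m. m < k)"
  shows "neumann \<xi> = (\<Sum>j<k. (A ^^ j) \<xi>)"
  unfolding neumann_def
  by (rule Sum_any.expand_superset) (use power_eq_0[OF assms] in \<open>auto simp: not_less[symmetric]\<close>)

lemma neumann_eq: "neumann \<xi> = \<xi> + A (neumann \<xi>)"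
proof -
  obtain k where k: "\<xi> \<in> bigraded (\<lambda>i m. m < k)" using ex_bound by blast
  have "\<xi> + A (neumann \<xi>) = \<xi> + (\<Sum>j<k. (A ^^ Suc j) \<xi>)"
    by (simp add: neumann_eq_sum[OF k] sum)
  also have "\<dots> = (\<Sum>j<Suc k. (A ^^ j) \<xi>)"
    by (subst sum.lessThan_Suc_shift) simp
  \<comment> \<open>The additional power of exponent \<open>k\<close> vanishes on
    \<open>\<xi>\<close>.\<close>
  also have "\<dots> = neumann \<xi>"
    by (simp add: neumann_eq_sum[OF k] power_eq_0[OF k])
  finally show ?thesis by simp
qed

text \<open>Injectivity of \<open>1 - A\<close>: a fixed point equals all its iterates, and high
  iterates vanish.\<close>

lemma fixpoint_eq_0: "\<xi> = A \<xi> \<Longrightarrow> \<xi> = 0"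
proof -
  assume "\<xi> = A \<xi>"
  then have "(A ^^ j) \<xi> = \<xi>" for j by (induction j) simp_all
  moreover obtain k where "\<xi> \<in> bigraded (\<lambda>i m. m < k)" using ex_bound by blast
  ultimately show "\<xi> = 0" using power_eq_0[of \<xi> k k] by simp
qed

lemma neumann_closed:
  assumes "\<xi> \<in> bigraded P" "\<And>\<eta>. \<eta> \<in> bigraded P \<Longrightarrow> A \<eta> \<in> bigraded P"
  shows "neumann \<xi> \<in> bigraded P"
proof -
  obtain k where k: "\<xi> \<in> bigraded (\<lambda>i m. m < k)" using ex_bound by blast
  have "(A ^^ j) \<xi> \<in> bigraded P" for j by (induction j) (use assms in auto)
  then show ?thesis by (simp add: neumann_eq_sum[OF k] bigraded_sum)
qed

text \<open>Uniqueness for the equation that characterizes the series; it replaces termwise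
  computations in what follows.\<close>

lemma neumann_eqI: "\<eta> = \<xi> + A \<eta> \<Longrightarrow> neumann \<xi> = \<eta>"
proof -
  assume \<eta>: "\<eta> = \<xi> + A \<eta>"
  have "neumann \<xi> - \<eta> = A (neumann \<xi>) - A \<eta>"
    by (subst neumann_eq, subst \<eta>) simp
  also have "\<dots> = A (neumann \<xi> - \<eta>)"
    by (metis add add_diff_cancel_right' diff_add_cancel)
  finally show "neumann \<xi> = \<eta>" using fixpoint_eq_0 by (metis eq_iff_diff_eq_0)
qed

lemma neumann_add: "neumann (\<xi> + \<eta>) = neumann \<xi> + neumann \<eta>"
proof (rule neumann_eqI)
  have "\<xi> + \<eta> + A (neumann \<xi> + neumann \<eta>) = (\<xi> + A (neumann \<xi>)) + (\<eta> + A (neumann \<eta>))"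
    by (simp add: add algebra_simps)
  then show "neumann \<xi> + neumann \<eta> = \<xi> + \<eta> + A (neumann \<xi> + neumann \<eta>)"
    by (simp only: neumann_eq[symmetric])
qed

end

section \<open>The \<open>R\<close>-module structure on \<open>\<Lambda> \<otimes> S\<close>\<close>

lemma scaleR_ext_add_right: "scaleR_ext r (\<xi> + \<eta>) = scaleR_ext r \<xi> + scaleR_ext r \<eta>"
  and scaleR_ext_add_left: "scaleR_ext (r + s) \<xi> = scaleR_ext r \<xi> + scaleR_ext s \<xi>"
  and scaleR_ext_scaleR_ext: "scaleR_ext r (scaleR_ext s \<xi>) = scaleR_ext (r * s) \<xi>"
  and scaleR_ext_one [simp]: "scaleR_ext 1 \<xi> = \<xi>"
  and scaleR_ext_uminus: "scaleR_ext r (- \<xi>) = - scaleR_ext r \<xi>"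
  and scaleR_ext_zero [simp]: "scaleR_ext r 0 = 0"
  and scaleR_ext_minus: "scaleR_ext (- r) \<xi> = - scaleR_ext r \<xi>"
  and scaleR_ext_diff: "scaleR_ext r (\<xi> - \<eta>) = scaleR_ext r \<xi> - scaleR_ext r \<eta>"
  for \<xi> :: "('n::{finite,linorder}, 'k::field) extS"
  by (simp_all add: scaleR_ext_eq ofS_mult_ofS const_mult const_add ext_mult_add_right ext_mult_uminus_right
      ext_mult_diff_right const_uminus single_uminus ext_mult_uminus_left single_add ext_mult_add_left)

lemma bigraded_scaleR: "\<xi> \<in> bigraded P \<Longrightarrow> scaleR_ext r \<xi> \<in> bigraded P"
  for \<xi> :: "('n::{finite,linorder}, 'k::field) extS"
  by (simp add: bigraded_iff scaleR_ext_eq lookup_ofS_mult lookup_const_mult)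

lemma module_scaleR_ext:
  "module (scaleR_ext :: ('n::{finite,linorder}, 'k::field) polyR \<Rightarrow> ('n, 'k) extS \<Rightarrow> ('n, 'k) extS)"
  by unfold_locales (simp_all add: scaleR_ext_add_right scaleR_ext_add_left scaleR_ext_scaleR_ext)

lemma ext_mult_scaleR_left: "ext_mult (scaleR_ext r \<xi>) \<eta> = scaleR_ext r (ext_mult \<xi> \<eta>)"
  by (simp add: scaleR_ext_eq ext_mult_assoc)

lemma ext_mult_scaleR_right: "ext_mult \<xi> (scaleR_ext r \<eta>) = scaleR_ext r (ext_mult \<xi> \<eta>)"
proof -
  have "ext_mult \<xi> (ofS (const r)) = ext_mult (ofS (const r)) \<xi>"
    by (induction \<xi> rule: ext_induct)
      (auto simp: ext_mult_add_left ext_mult_add_right ext_mult_single wedge_sign_def mult.commute)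
  then show ?thesis by (simp add: scaleR_ext_eq flip: ext_mult_assoc)
qed

lemma wt_const_fun: "wt (\<lambda>_ _. (-1) ^ k) \<xi> = scaleR_ext ((-1) ^ k) \<xi>"
  for \<xi> :: "('n::{finite,linorder}, 'k::field) extS"
  by (cases "even k") (simp_all add: wt_one wt_minus scaleR_ext_minus)

section \<open>The dg algebra \<open>\<X>\<^sub>a\<close>\<close>

lemma XX_simps [simp]:
  "action (XX a) = scaleR_ext"
  "component (XX a) j = bigraded (\<lambda>i m. i = j \<and> m < a)"
  "boundary (XX a) \<xi> = bipart (\<lambda>i m. m < a) (kappa \<xi> + kos \<xi>)"
  "product (XX a) \<xi> \<eta> = bipart (\<lambda>i m. m < a) (ext_mult \<xi> \<eta>)"
  "unit_elem (XX a) = Poly_Mapping.single {} 1"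
  by (simp_all add: XX_def)

lemma bipart_add: "bipart P (\<xi> + \<eta>) = bipart P \<xi> + bipart P \<eta>"
  and bipart_diff: "bipart P (\<xi> - \<eta>) = bipart P \<xi> - bipart P \<eta>"
  and bipart_zero [simp]: "bipart P 0 = 0"
  by (simp_all add: bipart_eq_wt wt_add wt_diff)

lemma bipart_scaleR: "bipart P (scaleR_ext r \<xi>) = scaleR_ext r (bipart P \<xi>)"
  for \<xi> :: "('n::{finite,linorder}, 'k::field) extS"
  by (simp add: bipart_eq_wt wt_scaleR)

lemma bipart_eq_0:
  assumes "\<xi> \<in> bigraded Q" "\<And>i m. Q i m \<Longrightarrow> \<not> P i m"
  shows "bipart P \<xi> = 0"
  using assms by (intro ext_eqI) (auto simp: lookup_bipart bigraded_iff)

lemma bipart_eq_self: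
  assumes "\<xi> \<in> bigraded Q" "\<And>i m. Q i m \<Longrightarrow> P i m"
  shows "bipart P \<xi> = \<xi>"
  by (rule bipart_id, rule bigraded_mono, rule assms(1), rule assms(2))

lemma lookup_empty_eq_0:
  assumes "\<xi> \<in> bigraded P" "\<And>m. \<not> P 0 m"
  shows "lookup \<xi> {} = 0"
  using assms by (intro poly_mapping_eqI) (auto simp: bigraded_iff)

lemma lookup_scaleR: "lookup (scaleR_ext r \<xi>) I = const r * lookup \<xi> I"
  for \<xi> :: "('n::{finite,linorder}, 'k::field) extS"
  by (simp add: scaleR_ext_eq lookup_ofS_mult)

lemma kappa_eq_0: "\<xi> \<in> bigraded P \<Longrightarrow> (\<And>i m. \<not> P (Suc i) m) \<Longrightarrow> kappa \<xi> = 0"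
  unfolding bigraded_False[symmetric] by (erule bigraded_kappa) simp

lemma kos_eq_0: "\<xi> \<in> bigraded P \<Longrightarrow> (\<And>i m. \<not> P (Suc i) m) \<Longrightarrow> kos \<xi> = 0"
  unfolding bigraded_False[symmetric] by (erule bigraded_kos) simp

text \<open>The part with \<open>m \<ge> a\<close> is a subcomplex, as \<open>\<kappa> + d\<close>
  never lowers the polynomial degree; truncating beforehand therefore changes nothing.\<close>

lemma bipart_boundary_bipart:
  "bipart (\<lambda>i m. m < a) (kappa (bipart (\<lambda>i m. m < a) \<xi>) + kos (bipart (\<lambda>i m. m < a) \<xi>)) =
   bipart (\<lambda>i m. m < a) (kappa \<xi> + kos \<xi>)"
proof -
  let ?T = "bipart (\<lambda>i m. m < a)"
  have 0: "\<xi> - ?T \<xi> \<in> bigraded (\<lambda>i m. a \<le> m)"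
    by (simp add: bigraded_iff lookup_minus lookup_bipart)
  have "kappa (\<xi> - ?T \<xi>) + kos (\<xi> - ?T \<xi>) \<in> bigraded (\<lambda>i m. a \<le> m)"
    by (intro bigraded_add bigraded_kappa[OF 0] bigraded_kos[OF 0]) simp_all
  then have "?T (kappa (\<xi> - ?T \<xi>) + kos (\<xi> - ?T \<xi>)) = 0"
    by (rule bipart_eq_0) simp
  then show ?thesis by (simp add: kappa_plus_kos contr_diff bipart_diff)
qed

lemma is_complex_XX: "is_complex (XX a :: (('n::{finite,linorder}, 'k::field) polyR, ('n, 'k) extS) dga)"
  unfolding is_complex_def
proof (intro conjI allI ballI)
  show "module (action (XX a :: (('n, 'k) polyR, ('n, 'k) extS) dga))"
    using module_scaleR_ext by simp
  show "module.subspace (action (XX a)) (component (XX a :: (('n, 'k) polyR, ('n, 'k) extS) dga) i)" for i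
    by (simp add: module.subspace_def[OF module_scaleR_ext] bigraded_add bigraded_scaleR)
next
  fix \<xi> :: "('n, 'k) extS" assume "\<xi> \<in> component (XX a) 0"
  then have "\<xi> \<in> bigraded (\<lambda>i m. i = 0 \<and> m < a)" by simp
  then show "boundary (XX a) \<xi> = 0" by (simp add: kappa_eq_0 kos_eq_0)
next
  fix i and \<xi> :: "('n, 'k) extS" assume "\<xi> \<in> component (XX a) (Suc i)"
  then have \<xi>: "\<xi> \<in> bigraded (\<lambda>j m. j = Suc i \<and> m < a)" by simp
  have "kappa \<xi> + kos \<xi> \<in> bigraded (\<lambda>j m. j = i)"
    by (intro bigraded_add bigraded_kappa[OF \<xi>] bigraded_kos[OF \<xi>]) auto
  then have "boundary (XX a) \<xi> \<in> bigraded (\<lambda>j m. m < a \<and> j = i)"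
    unfolding XX_simps by (rule bipart_in_bigraded)
  then show "boundary (XX a) \<xi> \<in> component (XX a) i"
    unfolding XX_simps by (rule bigraded_mono) simp
next
  fix \<xi> :: "('n, 'k) extS"
  show "boundary (XX a) (boundary (XX a) \<xi>) = 0"
    by (simp add: bipart_boundary_bipart) (simp add: kappa_add kos_add kappa_kappa kos_kos kappa_kos)
qed (simp_all add: kappa_add kos_add bipart_add bipart_scaleR kappa_scaleR kos_scaleR scaleR_ext_add_right)

lemma dg_algebra_XX:
  assumes "a > 0"
  shows "dg_algebra (XX a :: (('n::{finite,linorder}, 'k::field) polyR, ('n, 'k) extS) dga)"
  unfolding dg_algebra_def
proof (intro conjI allI ballI impI is_complex_XX)
  fix i j :: nat and \<xi> \<eta> :: "('n, 'k) extS"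
  assume "\<xi> \<in> component (XX a) i" "\<eta> \<in> component (XX a) j"
  then have xy: "\<xi> \<in> bigraded (\<lambda>k m. k = i \<and> m < a)" "\<eta> \<in> bigraded (\<lambda>k m. k = j \<and> m < a)" by simp_all
  have "ext_mult \<xi> \<eta> \<in> bigraded (\<lambda>k m. k = i + j)"
    by (rule bigraded_mult[OF xy]) simp
  then have "product (XX a) \<xi> \<eta> \<in> bigraded (\<lambda>k m. m < a \<and> k = i + j)"
    unfolding XX_simps by (rule bipart_in_bigraded)
  then show "product (XX a) \<xi> \<eta> \<in> component (XX a) (i + j)"
    unfolding XX_simps by (rule bigraded_mono) simp
  have "ext_mult \<xi> \<eta> = wt (\<lambda>_ _. (-1) ^ (i * j)) (ext_mult \<eta> \<xi>)"
    by (rule ext_mult_commute; rule bigraded_mono, rule xy, simp)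
  then show "product (XX a) \<xi> \<eta> = action (XX a) ((-1) ^ (i * j)) (product (XX a) \<eta> \<xi>)"
    by (simp add: wt_const_fun bipart_scaleR)
  \<comment> \<open>For a homogeneous left factor the involution is a sign; the antiderivation rule
    for \<open>\<kappa> + d\<close> then becomes the Leibniz rule once inner truncations are
    removed.\<close>
  have "grade_inv \<xi> = scaleR_ext ((-1) ^ i) \<xi>"
    unfolding wt_const_fun[symmetric] by (rule wt_cong[OF xy(1)]) simp
  then show "boundary (XX a) (product (XX a) \<xi> \<eta>) =
      product (XX a) (boundary (XX a) \<xi>) \<eta> +
      action (XX a) ((-1) ^ i) (product (XX a) \<xi> (boundary (XX a) \<eta>))"
    by (simp add: bipart_boundary_bipart bipart_ext_mult_bipart)
      (simp add: kappa_plus_kos contr_mult bipart_add ext_mult_scaleR_left bipart_scaleR)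
next
  fix i and \<xi> :: "('n, 'k) extS"
  assume "odd i" and "\<xi> \<in> component (XX a) i"
  then have "\<xi> \<in> bigraded (\<lambda>k m. k = i)" by (auto elim: bigraded_mono)
  then show "product (XX a) \<xi> \<xi> = 0" using \<open>odd i\<close> by (simp add: ext_mult_self_odd)
next
  \<comment> \<open>The unit has polynomial degree \<open>0\<close> and survives the truncation
    because \<open>a > 0\<close>.\<close>
  have "Poly_Mapping.single {} (Poly_Mapping.single 0 1) \<in> bigraded (\<lambda>i m. i = 0 \<and> m < a)"
    using assms by (intro bigraded_basis) simp
  then show "unit_elem (XX a) \<in> component (XX a :: (('n, 'k) polyR, ('n, 'k) extS) dga) 0" by simp
next
  fix i and \<xi> :: "('n, 'k) extS"
  assume "\<xi> \<in> component (XX a) i"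
  then have "bipart (\<lambda>i m. m < a) \<xi> = \<xi>" by (auto intro: bipart_eq_self)
  then show "product (XX a) (unit_elem (XX a)) \<xi> = \<xi>" "product (XX a) \<xi> (unit_elem (XX a)) = \<xi>"
    by simp_all
qed (simp_all add: ext_mult_add_left ext_mult_add_right bipart_add ext_mult_scaleR_left
    ext_mult_scaleR_right bipart_scaleR bipart_ext_mult_bipart ext_mult_assoc)

section \<open>The complex \<open>\<L>\<^sub>a\<close>\<close>

lemma LL_simps [simp]:
  "action (LL a) = (\<lambda>r (u, \<xi>). (r * u, scaleR_ext r \<xi>))"
  "component (LL a) 0 = UNIV \<times> {0}"
  "component (LL a) (Suc j) = {0} \<times> Lmod a j"
  "boundary (LL a) (u, \<xi>) = (- evalS (lookup \<xi> {}), - kos \<xi>)"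
  by (simp_all add: LL_def)

lemma Lmod_kappa: "\<xi> \<in> Lmod a j \<Longrightarrow> kappa \<xi> = 0"
  by (auto simp: Lmod_def kappa_kappa)

lemma Lmod_bigraded:
  fixes \<xi> :: "('n::{finite,linorder}, 'k::field) extS"
  assumes "a > 0" "\<xi> \<in> Lmod a j"
  shows "\<xi> \<in> bigraded (\<lambda>i m. i = j \<and> m = a \<and> i < CARD('n))"
proof -
  obtain \<zeta> where \<zeta>: "\<xi> = kappa \<zeta>" "\<zeta> \<in> bigraded (\<lambda>i m. i = j + 1 \<and> m = a - 1)"
    using assms(2) by (auto simp: Lmod_def)
  \<comment> \<open>\<open>\<kappa>\<close> lowers the exterior degree, which turns the bound
    \<open>n\<close> into a strict one, and raises \<open>a - 1\<close> to \<open>a\<close> because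
    \<open>a > 0\<close>.\<close>
  show ?thesis
    unfolding \<zeta>(1) by (rule bigraded_kappa[OF bigraded_card_le[OF \<zeta>(2)]]) (use assms(1) in auto)
qed

lemma Lmod_zero: "0 \<in> Lmod a j"
  unfolding Lmod_def by (rule image_eqI[of _ _ 0]) simp_all

lemma Lmod_add: "\<xi> \<in> Lmod a j \<Longrightarrow> \<eta> \<in> Lmod a j \<Longrightarrow> \<xi> + \<eta> \<in> Lmod a j"
  unfolding Lmod_def by (auto simp flip: kappa_add intro!: imageI bigraded_add)

lemma Lmod_scaleR: "\<xi> \<in> Lmod a j \<Longrightarrow> scaleR_ext r \<xi> \<in> Lmod a j"
  unfolding Lmod_def by (auto simp flip: kappa_scaleR intro!: imageI bigraded_scaleR)

lemma Lmod_uminus: "\<xi> \<in> Lmod a j \<Longrightarrow> - \<xi> \<in> Lmod a j"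
  using Lmod_scaleR[of \<xi> a j "- 1"] by (simp add: scaleR_ext_minus)

text \<open>Since \<open>d \<kappa> = - \<kappa> d\<close>, a preimage under \<open>\<kappa>\<close>
  of the new element is \<open>- d \<zeta>\<close>.\<close>

lemma Lmod_kos:
  assumes "\<xi> \<in> Lmod a (Suc j)"
  shows "kos \<xi> \<in> Lmod a j"
proof -
  obtain \<zeta> where \<zeta>: "\<xi> = kappa \<zeta>" "\<zeta> \<in> bigraded (\<lambda>i m. i = Suc j + 1 \<and> m = a - 1)"
    using assms by (auto simp: Lmod_def)
  have "kos \<zeta> \<in> bigraded (\<lambda>i m. i = j + 1 \<and> m = a - 1)"
    by (rule bigraded_kos[OF \<zeta>(2)]) simp
  then have "kappa (- kos \<zeta>) \<in> Lmod a j"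
    unfolding Lmod_def by (intro imageI bigraded_uminus)
  then show ?thesis by (simp add: \<zeta>(1) kappa_uminus kappa_kos)
qed

lemma is_complex_LL:
  assumes "a > 0"
  shows "is_complex (LL a :: (('n::{finite,linorder}, 'k::field) polyR, ('n, 'k) polyR \<times> ('n, 'k) extS) cpx)"
  (is "is_complex ?L")
  unfolding is_complex_def
proof (intro conjI allI ballI)
  have m: "module (\<lambda>r (u :: ('n, 'k) polyR, \<xi> :: ('n, 'k) extS). (r * u, scaleR_ext r \<xi>))"
    by unfold_locales (auto simp: scaleR_ext_add_right scaleR_ext_add_left scaleR_ext_scaleR_ext algebra_simps)
  then show "module (action ?L)" by simp
  show "module.subspace (action ?L) (component ?L i)" for i
    by (cases i) (auto simp: module.subspace_def[OF m] Lmod_zero Lmod_add Lmod_scaleR zero_prod_def)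
next
  fix x assume "x \<in> component ?L 0"
  then show "boundary ?L x = 0" by (auto simp: zero_prod_def)
next
  fix i x assume "x \<in> component ?L (Suc i)"
  then obtain \<xi> where \<xi>: "x = (0, \<xi>)" "\<xi> \<in> Lmod a i" by auto
  note b = Lmod_bigraded[OF assms \<xi>(2)]
  \<comment> \<open>One of the two coordinates always vanishes: \<open>d\<close> kills exterior
    degree \<open>0\<close>, and in positive exterior degree the coefficient at \<open>{}\<close> is
    zero.\<close>
  show "boundary ?L x \<in> component ?L i"
  proof (cases i)
    case 0
    have "kos \<xi> = 0" by (rule kos_eq_0[OF b]) (simp add: 0)
    then show ?thesis by (simp add: 0 \<xi>)
  next
    case (Suc j)
    have "lookup \<xi> {} = 0" by (rule lookup_empty_eq_0[OF b]) (simp add: Suc)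
    then show ?thesis using \<xi>(2) by (simp add: Suc \<xi>(1) Lmod_kos Lmod_uminus)
  qed
next
  fix i x assume "x \<in> component ?L i"
  show "boundary ?L (boundary ?L x) = 0"
  proof (cases i)
    case 0
    then show ?thesis using \<open>x \<in> component ?L i\<close> by (auto simp: zero_prod_def)
  next
    case (Suc j)
    then obtain \<xi> \<zeta> where \<xi>: "x = (0, \<xi>)" "\<xi> = kappa \<zeta>"
      using \<open>x \<in> component ?L i\<close> by (auto simp: Lmod_def)
    \<comment> \<open>Here
      \<open>d \<xi> = d \<kappa> \<zeta> = - (\<kappa> + d)(d \<zeta>)\<close>, an untruncated
      boundary, on which evaluation vanishes.\<close>
    have "evalS (lookup (kos \<xi>) {}) = 0"
      using evalS_boundary[of "kos \<zeta>"] by (simp add: \<xi>(2) kappa_kos kos_kos lookup_uminus evalS_uminus)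
    then show ?thesis by (simp add: \<xi>(1) kos_uminus kos_kos lookup_uminus evalS_uminus zero_prod_def)
  qed
next
  fix x y r
  show "boundary ?L (x + y) = boundary ?L x + boundary ?L y"
    by (cases x; cases y) (simp add: lookup_add evalS_add kos_add)
  show "boundary ?L (action ?L r x) = action ?L r (boundary ?L x)"
    by (cases x) (simp add: kos_scaleR scaleR_ext_uminus lookup_scaleR evalS_const_mult)
qed

section \<open>The retract\<close>

text \<open>\<open>d\<close> keeps the polynomial degree and \<open>\<sigma>\<close> lowers it, so
  both series terminate: \<open>L\<close> serves \<open>i_inf\<close>, and \<open>H\<close> below
  serves \<open>h_inf\<close>.\<close>

interpretation L: lowering "\<lambda>\<eta> :: ('n::{finite,linorder}, 'k::field) extS. - sigma (kos \<eta>)"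
proof
  fix \<xi> :: "('n, 'k) extS" and k
  assume \<xi>: "\<xi> \<in> bigraded (\<lambda>i m. m < Suc k)"
  have "kos \<xi> \<in> bigraded (\<lambda>i m. m < Suc k)" by (rule bigraded_kos[OF \<xi>])
  then show "- sigma (kos \<xi>) \<in> bigraded (\<lambda>i m. m < k)"
    by (intro bigraded_uminus, elim bigraded_sigma) simp
qed (simp add: kos_add sigma_add)

interpretation H: lowering "\<lambda>\<eta> :: ('n::{finite,linorder}, 'k::field) extS. - kos (sigma \<eta>)"
proof
  fix \<xi> :: "('n, 'k) extS" and k
  assume \<xi>: "\<xi> \<in> bigraded (\<lambda>i m. m < Suc k)"
  have "sigma \<xi> \<in> bigraded (\<lambda>i m. m < k)" by (rule bigraded_sigma[OF \<xi>]) simp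
  then show "- kos (sigma \<xi>) \<in> bigraded (\<lambda>i m. m < k)"
    by (intro bigraded_uminus, elim bigraded_kos) simp
qed (simp add: kos_add sigma_add)

section \<open>Fixed-point equations, linearity and degrees of \<open>i_inf\<close> and
  \<open>h_inf\<close>\<close>

lemma i_inf_eq: "i_inf (u, \<xi>) = Poly_Mapping.single {} (const u) + L.neumann (sigma \<xi>)"
  by (simp add: i_inf_def L.neumann_def)

lemma h_inf_eq: "h_inf \<xi> = - sigma (H.neumann \<xi>)"
  by (simp add: h_inf_def H.neumann_def)

text \<open>Because \<open>\<sigma> (d \<sigma>)^k = (\<sigma> d)^k \<sigma>\<close>, the series in
  \<open>- d \<sigma>\<close> gives an equation for \<open>- \<sigma> d\<close>, the operator that
  also governs \<open>i_inf\<close>.\<close>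

lemma h_inf_fixpoint: "h_inf \<xi> = - sigma \<xi> - sigma (kos (h_inf \<xi>))"
proof -
  have "h_inf \<xi> = - sigma (\<xi> + - kos (sigma (H.neumann \<xi>)))"
    unfolding h_inf_eq H.neumann_eq[symmetric] ..
  also have "\<dots> = - sigma \<xi> - sigma (kos (- sigma (H.neumann \<xi>)))"
    by (simp add: sigma_diff sigma_uminus kos_uminus)
  finally show ?thesis by (simp only: h_inf_eq)
qed

lemma sigma_const [simp]: "sigma (ofS (const u)) = 0"
  by (simp add: sigma_eq_wt_deRham)

text \<open>\<open>\<sigma>\<close> is the outermost map in each term of the series and
  \<open>\<sigma> \<sigma> = 0\<close>; constants have derivative zero.\<close>

lemma sigma_i_inf: "sigma (i_inf y) = 0"
proof (cases y)
  case (Pair u \<xi>)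
  have "sigma (L.neumann (sigma \<xi>)) = sigma (sigma \<xi> + - sigma (kos (L.neumann (sigma \<xi>))))"
    unfolding L.neumann_eq[symmetric] ..
  also have "\<dots> = 0" by (simp add: sigma_diff sigma_sigma)
  finally show ?thesis by (simp add: Pair i_inf_eq sigma_add)
qed

lemma i_inf_add: "i_inf (x + y) = i_inf x + i_inf y"
  by (cases x; cases y) (simp add: i_inf_eq const_add single_add sigma_add L.neumann_add)

text \<open>The scaled series solves the fixed-point equation of the scaled argument, so uniqueness
  applies.\<close>

lemma i_inf_scaleR: "i_inf (r * u, scaleR_ext r \<xi>) = scaleR_ext r (i_inf (u, \<xi>))"
proof -
  have "L.neumann (sigma (scaleR_ext r \<xi>)) = scaleR_ext r (L.neumann (sigma \<xi>))"
  proof (rule L.neumann_eqI)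
    have "scaleR_ext r (L.neumann (sigma \<xi>)) =
        scaleR_ext r (sigma \<xi> + - sigma (kos (L.neumann (sigma \<xi>))))"
      unfolding L.neumann_eq[symmetric] ..
    also have "\<dots> = sigma (scaleR_ext r \<xi>) + - sigma (kos (scaleR_ext r (L.neumann (sigma \<xi>))))"
      by (simp add: kos_scaleR sigma_scaleR scaleR_ext_diff)
    finally show "scaleR_ext r (L.neumann (sigma \<xi>)) =
        sigma (scaleR_ext r \<xi>) + - sigma (kos (scaleR_ext r (L.neumann (sigma \<xi>))))" .
  qed
  then show ?thesis
    by (simp add: i_inf_eq scaleR_ext_add_right scaleR_ext_eq[of r "ofS _"] ofS_mult_single const_mult)
qed

lemma h_inf_add: "h_inf (\<xi> + \<eta>) = h_inf \<xi> + h_inf \<eta>"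
  by (simp add: h_inf_eq H.neumann_add sigma_add)

lemma h_inf_scaleR: "h_inf (scaleR_ext r \<xi>) = scaleR_ext r (h_inf \<xi>)"
proof -
  have "H.neumann (scaleR_ext r \<xi>) = scaleR_ext r (H.neumann \<xi>)"
  proof (rule H.neumann_eqI)
    have "scaleR_ext r (H.neumann \<xi>) = scaleR_ext r (\<xi> + - kos (sigma (H.neumann \<xi>)))"
      unfolding H.neumann_eq[symmetric] ..
    also have "\<dots> = scaleR_ext r \<xi> + - kos (sigma (scaleR_ext r (H.neumann \<xi>)))"
      by (simp add: kos_scaleR sigma_scaleR scaleR_ext_diff)
    finally show "scaleR_ext r (H.neumann \<xi>) = scaleR_ext r \<xi> + - kos (sigma (scaleR_ext r (H.neumann \<xi>)))" .
  qed
  then show ?thesis by (simp add: h_inf_eq sigma_scaleR scaleR_ext_uminus)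
qed

lemma L_neumann_bigraded:
  assumes "\<xi> \<in> bigraded (\<lambda>i m. i = j \<and> m < a)"
  shows "L.neumann \<xi> \<in> bigraded (\<lambda>i m. i = j \<and> m < a)"
  using assms
proof (rule L.neumann_closed)
  fix \<eta> :: "('a, 'b) extS" assume \<eta>: "\<eta> \<in> bigraded (\<lambda>i m. i = j \<and> m < a)"
  have "kos \<eta> \<in> bigraded (\<lambda>i m. Suc i = j \<and> m < a)" by (rule bigraded_kos[OF \<eta>]) simp
  then show "- sigma (kos \<eta>) \<in> bigraded (\<lambda>i m. i = j \<and> m < a)"
    by (intro bigraded_uminus, elim bigraded_sigma) simp
qed

text \<open>The room \<open>Suc m < a\<close> lets \<open>\<kappa>\<close> be applied to
  \<open>h_inf \<xi>\<close> without leaving the range \<open>m < a\<close>.\<close>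

lemma h_inf_bigraded:
  assumes "\<xi> \<in> bigraded (\<lambda>i m. i = j \<and> m < a)"
  shows "h_inf \<xi> \<in> bigraded (\<lambda>i m. i = Suc j \<and> Suc m < a)"
proof -
  have "H.neumann \<xi> \<in> bigraded (\<lambda>i m. i = j \<and> m < a)"
    using assms
  proof (rule H.neumann_closed)
    fix \<eta> :: "('a, 'b) extS" assume \<eta>: "\<eta> \<in> bigraded (\<lambda>i m. i = j \<and> m < a)"
    have "sigma \<eta> \<in> bigraded (\<lambda>i m. i = Suc j \<and> m < a)" by (rule bigraded_sigma[OF \<eta>]) simp
    then show "- kos (sigma \<eta>) \<in> bigraded (\<lambda>i m. i = j \<and> m < a)"
      by (intro bigraded_uminus, elim bigraded_kos) simp
  qed
  then show ?thesis
    unfolding h_inf_eq by (intro bigraded_uminus, elim bigraded_sigma) simp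
qed

section \<open>The maps \<open>i_inf\<close> and \<open>p_inf\<close> between the two
  complexes\<close>

lemma i_inf_component:
  assumes "a > 0" "y \<in> component (LL a) j"
  shows "i_inf y \<in> component (XX a) j"
proof (cases j)
  case 0
  then obtain u where "y = (u, 0)" using assms(2) by auto
  moreover have "Poly_Mapping.single {} (Poly_Mapping.single 0 u) \<in> bigraded (\<lambda>i m. i = 0 \<and> m < a)"
    using assms(1) by (intro bigraded_basis) simp
  moreover have "L.neumann 0 = (0 :: ('a, 'b) extS)" by (rule L.neumann_eqI) simp
  ultimately show ?thesis by (simp add: 0 i_inf_eq const_def)
next
  case (Suc k)
  then obtain \<xi> where y: "y = (0, \<xi>)" "\<xi> \<in> Lmod a k" using assms(2) by auto
  have "sigma \<xi> \<in> bigraded (\<lambda>i m. i = j \<and> m < a)"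
    by (rule bigraded_sigma[OF Lmod_bigraded[OF assms(1) y(2)]]) (simp add: Suc)
  then show ?thesis by (simp add: y(1) i_inf_eq L_neumann_bigraded)
qed

text \<open>In positive degree \<open>p_inf\<close> sees only the leading term
  \<open>\<sigma> \<xi>\<close> of the series, the other terms having polynomial degree below
  \<open>a - 1\<close>. As \<open>\<kappa> \<xi> = 0\<close>, the homotopy identity gives
  \<open>\<kappa> \<sigma> \<xi> = \<xi>\<close>.\<close>

lemma p_i_inf:
  fixes y :: "('n::{finite,linorder}, 'k::field) polyR \<times> ('n, 'k) extS"
  assumes "a > 0" "CHAR('k) = 0 \<or> CHAR('k) \<ge> a + CARD('n)" "y \<in> component (LL a) j"
  shows "p_inf a (i_inf y) = y"
proof (cases j)
  case 0
  then obtain u where y: "y = (u, 0)" using assms(3) by auto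
  have "L.neumann 0 = (0 :: ('n, 'k) extS)" by (rule L.neumann_eqI) simp
  then have i: "i_inf y = ofS (const u)" by (simp add: y i_inf_eq)
  have "ofS (const u) \<in> bigraded (\<lambda>i m. i = 0)"
    unfolding const_def by (rule bigraded_basis) simp
  then have "bipart (\<lambda>i m. 0 < i \<and> m = a - 1) (ofS (const u)) = 0"
    by (rule bipart_eq_0) simp
  then show ?thesis by (simp add: p_inf_def i) (simp add: y)
next
  case (Suc k)
  then obtain \<xi> where y: "y = (0, \<xi>)" "\<xi> \<in> Lmod a k" using assms(3) by auto
  note b = Lmod_bigraded[OF assms(1) y(2)]
  define \<eta> where "\<eta> = i_inf y"
  have \<eta>: "\<eta> \<in> bigraded (\<lambda>i m. i = j \<and> m < a)"
    using i_inf_component[OF assms(1,3)] by (simp add: \<eta>_def)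
  have eq: "\<eta> = sigma \<xi> - sigma (kos \<eta>)"
    using L.neumann_eq[of "sigma \<xi>"] by (simp add: \<eta>_def y(1) i_inf_eq)
  have "lookup \<eta> {} = 0" by (rule lookup_empty_eq_0[OF \<eta>]) (simp add: Suc)
  moreover have "kappa (bipart (\<lambda>i m. 0 < i \<and> m = a - 1) \<eta>) = \<xi>"
  proof -
    have "kos \<eta> \<in> bigraded (\<lambda>i m. m < a)" by (rule bigraded_kos[OF \<eta>]) simp
    then have "sigma (kos \<eta>) \<in> bigraded (\<lambda>i m. Suc m < a)" by (rule bigraded_sigma) simp
    then have "bipart (\<lambda>i m. 0 < i \<and> m = a - 1) (sigma (kos \<eta>)) = 0" by (rule bipart_eq_0) auto
    moreover have "sigma \<xi> \<in> bigraded (\<lambda>i m. 0 < i \<and> m = a - 1)" by (rule bigraded_sigma[OF b]) auto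
    then have "bipart (\<lambda>i m. 0 < i \<and> m = a - 1) (sigma \<xi>) = sigma \<xi>" by (rule bipart_id)
    ultimately have "bipart (\<lambda>i m. 0 < i \<and> m = a - 1) \<eta> = sigma \<xi>"
      by (subst eq) (simp add: bipart_diff)
    \<comment> \<open>Here \<open>m = a\<close>, so the strict bound \<open>i < n\<close> on
      \<open>Lmod\<close> matters.\<close>
    moreover have "\<xi> \<in> bigraded (\<lambda>i m. i + m < a + CARD('n))" by (rule bigraded_mono[OF b]) auto
    moreover have "bipart (\<lambda>i m. i = 0 \<and> m = 0) \<xi> = 0" by (rule bipart_eq_0[OF b]) (use assms(1) in auto)
    ultimately show ?thesis by (simp add: kappa_sigma[OF assms(2)] Lmod_kappa[OF y(2)])
  qed
  ultimately show ?thesis by (simp add: p_inf_def \<eta>_def y(1))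
qed

text \<open>Only \<open>\<kappa>\<close> of the top row \<open>m = a - 1\<close> leaves the range
  \<open>m < a\<close>; subtracting it expresses the truncated boundary through untruncated
  maps.\<close>

lemma top_boundary:
  fixes \<xi> :: "('n::{finite,linorder}, 'k::field) extS"
  assumes "a > 0" "\<xi> \<in> bigraded (\<lambda>i m. i = j \<and> m < a)"
  shows "bipart (\<lambda>i m. m < a) (kappa \<xi> + kos \<xi>) =
    kappa \<xi> + kos \<xi> - kappa (bipart (\<lambda>i m. m = a - 1) \<xi>)"
proof -
  let ?T = "bipart (\<lambda>i m. m < a)" and ?t = "bipart (\<lambda>i m. m = a - 1) \<xi>"
  have "?t \<in> bigraded (\<lambda>i m. m = a - 1)"
    using bipart_in_bigraded[OF assms(2)] by (rule bigraded_mono) simp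
  then have "kappa ?t \<in> bigraded (\<lambda>i m. m = a)"
    by (rule bigraded_kappa) (use assms(1) in simp)
  then have 0: "?T (kappa ?t) = 0" by (rule bipart_eq_0) simp
  have "\<xi> - ?t \<in> bigraded (\<lambda>i m. Suc m < a)"
    unfolding bigraded_iff
  proof (intro allI impI)
    fix I and \<mu> :: "'n \<Rightarrow>\<^sub>0 nat" assume "\<not> Suc (mdeg \<mu>) < a"
    then have "mdeg \<mu> = a - 1 \<or> \<not> mdeg \<mu> < a" by linarith
    then show "lookup (lookup (\<xi> - ?t) I) \<mu> = 0"
      using assms(2) by (auto simp: bigraded_iff lookup_minus lookup_bipart)
  qed
  then have "kappa (\<xi> - ?t) \<in> bigraded (\<lambda>i m. m < a)" by (rule bigraded_kappa)
  moreover have "kos \<xi> \<in> bigraded (\<lambda>i m. m < a)" by (rule bigraded_kos[OF assms(2)]) simp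
  ultimately have "?T (kappa (\<xi> - ?t) + kos \<xi>) = kappa (\<xi> - ?t) + kos \<xi>"
    by (intro bipart_id bigraded_add)
  then show ?thesis using 0 by (simp add: kappa_diff bipart_diff bipart_add algebra_simps)
qed

lemma chain_map_p_inf:
  assumes "a > 0"
  shows "chain_map (XX a :: (('n::{finite,linorder}, 'k::field) polyR, ('n, 'k) extS) dga) (LL a) (p_inf a)"
  unfolding chain_map_def graded_linear_def
proof (intro conjI allI ballI is_complex_XX is_complex_LL[OF assms])
  fix j and \<xi> :: "('n, 'k) extS"
  assume "\<xi> \<in> component (XX a) j"
  then have \<xi>: "\<xi> \<in> bigraded (\<lambda>i m. i = j \<and> m < a)" by simp
  let ?t = "bipart (\<lambda>i m. 0 < i \<and> m = a - 1) \<xi>"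
  show "p_inf a \<xi> \<in> component (LL a) (j + 0)"
  proof (cases j)
    case 0
    have "?t = 0" by (rule bipart_eq_0[OF \<xi>]) (simp add: 0)
    then show ?thesis by (simp add: p_inf_def 0)
  next
    case (Suc k)
    have "lookup \<xi> {} = 0" by (rule lookup_empty_eq_0[OF \<xi>]) (simp add: Suc)
    moreover have "?t \<in> bigraded (\<lambda>i m. i = k + 1 \<and> m = a - 1)"
      using bipart_in_bigraded[OF \<xi>] by (rule bigraded_mono) (simp add: Suc)
    then have "kappa ?t \<in> Lmod a k" unfolding Lmod_def by (rule imageI)
    ultimately show ?thesis by (simp add: p_inf_def Suc)
  qed
  show "p_inf a (boundary (XX a) \<xi>) = boundary (LL a) (p_inf a \<xi>)"
  proof (cases j)
    case 0
    have "kappa \<xi> + kos \<xi> = 0" using kappa_eq_0[OF \<xi>] kos_eq_0[OF \<xi>] 0 by simp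
    moreover have "?t = 0" by (rule bipart_eq_0[OF \<xi>]) (simp add: 0)
    ultimately show ?thesis by (simp add: p_inf_def zero_prod_def)
  next
    case (Suc k)
    let ?d = "kappa \<xi> + kos \<xi>"
    have t: "?t = bipart (\<lambda>i m. m = a - 1) \<xi>"
      using \<xi> by (intro ext_eqI) (auto simp: lookup_bipart bigraded_iff Suc)
    have \<xi>0: "lookup \<xi> {} = 0" by (rule lookup_empty_eq_0[OF \<xi>]) (simp add: Suc)
    \<comment> \<open>The untruncated boundary evaluates to \<open>0\<close>, so only the discarded
      term \<open>\<kappa> ?t\<close> contributes.\<close>
    have 1: "evalS (lookup (boundary (XX a) \<xi>) {}) = - evalS (lookup (kappa ?t) {})"
      unfolding XX_simps top_boundary[OF assms \<xi>] t lookup_minus evalS_diff evalS_boundary by simp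
    \<comment> \<open>Row \<open>a - 1\<close> of the boundary is \<open>\<kappa>\<close> of the row
      below plus \<open>d\<close> of row \<open>a - 1\<close>. A further \<open>\<kappa>\<close>
      kills the first summand and anticommutes with \<open>d\<close> on the second.\<close>
    have 2: "kappa (bipart (\<lambda>i m. 0 < i \<and> m = a - 1) (boundary (XX a) \<xi>)) = - kos (kappa ?t)"
    proof -
      let ?P = "bipart (\<lambda>i m. 0 < i \<and> m = a - 1)" and ?Q = "bipart (\<lambda>i m. m = a - 1)"
      \<comment> \<open>\<open>?P\<close> and \<open>?Q\<close> differ only in exterior degree
        \<open>0\<close>, which \<open>\<kappa>\<close> kills.\<close>
      have PQ: "kappa (?P \<zeta>) = kappa (?Q \<zeta>)" for \<zeta> :: "('n, 'k) extS"
      proof -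
        have "?Q \<zeta> - ?P \<zeta> \<in> bigraded (\<lambda>i m. i = 0)"
          by (simp add: bigraded_iff lookup_minus lookup_bipart)
        then have "kappa (?Q \<zeta> - ?P \<zeta>) = 0" by (rule kappa_eq_0) simp
        then show ?thesis by (simp add: kappa_diff)
      qed
      have b1: "?P (boundary (XX a) \<xi>) = ?P (kappa \<xi>) + ?P (kos \<xi>)"
        unfolding bipart_add[symmetric] using assms by (intro ext_eqI) (simp add: lookup_bipart)
      \<comment> \<open>Written with \<open>Suc m = a - 1\<close>, so that for \<open>a = 1\<close>
        the row below is empty.\<close>
      have b2: "?Q (kappa \<xi>) = kappa (wt (\<lambda>i m. if Suc m = a - 1 then 1 else 0) \<xi>)"
        unfolding bipart_eq_wt by (rule wt_kappa) simp
      have b3: "?Q (kos \<xi>) = kos (?Q \<xi>)"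
        unfolding bipart_eq_wt by (rule wt_kos) simp
      show ?thesis
        by (simp only: b1 b2 b3 kappa_add PQ kappa_kappa kappa_kos add_0)
    qed
    show ?thesis using 1 2 by (simp add: p_inf_def \<xi>0)
  qed
qed (auto simp: p_inf_def lookup_add lookup_scaleR evalS_add evalS_const_mult bipart_add bipart_scaleR
    kappa_add kappa_scaleR)


text \<open>The difference of two preimages under \<open>1 + \<sigma> d\<close> is a fixed point of
  the locally nilpotent map \<open>- \<sigma> d\<close>.\<close>

lemma U_inj: "v + sigma (kos v) = w + sigma (kos w) \<Longrightarrow> v = w"
proof -
  assume "v + sigma (kos v) = w + sigma (kos w)"
  then have "v - w = - sigma (kos (v - w))" by (simp add: kos_diff sigma_diff algebra_simps)
  then have "v - w = 0" by (rule L.fixpoint_eq_0)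
  then show "v = w" by simp
qed

text \<open>
  Both sides of \<open>i p = 1 + \<partial> h + h \<partial>\<close> agree after applying the injective map \<open>1 + \<sigma> d\<close>, under which
  \<open>h\<close> becomes \<open>- \<sigma>\<close> and \<open>i\<close> becomes \<open>\<sigma>\<close>.
\<close>

lemma i_p_inf:
  fixes \<xi> :: "('n::{finite,linorder}, 'k::field) extS"
  assumes "a > 0" "CHAR('k) = 0 \<or> CHAR('k) \<ge> a + CARD('n)" "\<xi> \<in> component (XX a) j"
  shows "i_inf (p_inf a \<xi>) = \<xi> + boundary (XX a) (h_inf \<xi>) + h_inf (boundary (XX a) \<xi>)"
proof -
  let ?E = "bipart (\<lambda>i m. i = 0 \<and> m = 0)" and ?t = "bipart (\<lambda>i m. m = a - 1) \<xi>"
  have \<xi>: "\<xi> \<in> bigraded (\<lambda>i m. i = j \<and> m < a)" using assms(3) by simp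
  define y where "y = h_inf \<xi>"
  define b where "b = boundary (XX a) \<xi>"
  \<comment> \<open>The right-hand side of the homotopy formula, with the boundary of
    \<open>h_inf \<xi>\<close> written untruncated.\<close>
  define \<pi> where "\<pi> = \<xi> + (kappa y + kos y) + h_inf b"
  have y: "y \<in> bigraded (\<lambda>i m. i = Suc j \<and> Suc m < a)"
    unfolding y_def by (rule h_inf_bigraded[OF \<xi>])
  have Uy: "sigma (kos y) = - sigma \<xi> - y"
    using h_inf_fixpoint[of \<xi>] by (simp add: y_def algebra_simps)
  have "kappa y + kos y \<in> bigraded (\<lambda>i m. m < a)"
    by (intro bigraded_add bigraded_kappa[OF y] bigraded_kos[OF y]) simp_all
  then have \<pi>: "\<xi> + boundary (XX a) (h_inf \<xi>) + h_inf (boundary (XX a) \<xi>) = \<pi>"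
    by (simp add: \<pi>_def b_def bipart_id flip: y_def)
  have bd: "kos y \<in> bigraded (\<lambda>i m. i = j \<and> m < a)" by (rule bigraded_kos[OF y]) simp
  \<comment> \<open>\<open>i \<le> n\<close> and \<open>m < a\<close> place these elements in the
    range where the characteristic hypothesis makes positive \<open>i + m\<close>
    invertible.\<close>
  have small: "\<zeta> \<in> bigraded (\<lambda>i m. i + m < a + CARD('n))" if "\<zeta> \<in> bigraded (\<lambda>i m. i = j \<and> m < a)"
    for \<zeta> :: "('n, 'k) extS"
    by (rule bigraded_mono[OF bigraded_card_le[OF that]]) simp
  \<comment> \<open>Anticommute \<open>d\<close> past \<open>\<kappa>\<close>, apply the homotopy
    identity for \<open>\<sigma>\<close> to \<open>d y\<close>, and replace
    \<open>\<sigma> d y\<close> by \<open>- \<sigma> \<xi> - y\<close>.\<close>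
  have 1: "sigma (kos (kappa y)) = - kos y + ?E (kos y) - kappa (sigma \<xi>) - kappa y"
  proof -
    have "sigma (kos (kappa y)) = - sigma (kappa (kos y))" by (simp add: kappa_kos sigma_uminus)
    also have "\<dots> = - kos y + ?E (kos y) + kappa (sigma (kos y))"
      by (simp add: kappa_sigma[OF assms(2) small[OF bd]])
    finally show ?thesis by (simp add: Uy kappa_diff kappa_uminus)
  qed
  have 2: "h_inf b + sigma (kos (h_inf b)) = - sigma b"
    using h_inf_fixpoint[of b] by (simp add: algebra_simps)
  have 3: "sigma b = sigma (kappa \<xi>) + sigma (kos \<xi>) - sigma (kappa ?t)"
    by (simp add: b_def top_boundary[OF assms(1) \<xi>] sigma_diff sigma_add)
  have 4: "kappa (sigma \<xi>) = \<xi> - ?E \<xi> - sigma (kappa \<xi>)"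
    by (rule kappa_sigma[OF assms(2) small[OF \<xi>]])
  have "\<pi> + sigma (kos \<pi>) = \<xi> + kappa y + kos y + sigma (kos \<xi>) + sigma (kos (kappa y)) +
      (h_inf b + sigma (kos (h_inf b)))"
    by (simp add: \<pi>_def kos_add sigma_add kos_kos)
  also have "\<dots> = ?E \<xi> + ?E (kos y) + sigma (kappa ?t)"
    unfolding 1 2 3 4 by (simp add: algebra_simps)
  finally have U\<pi>: "\<pi> + sigma (kos \<pi>) = ?E \<xi> + ?E (kos y) + sigma (kappa ?t)" .
  show ?thesis
  proof (cases j)
    case (Suc k)
    have "?E \<xi> = 0" "?E (kos y) = 0" by (rule bipart_eq_0[OF \<xi>] bipart_eq_0[OF bd]; simp add: Suc)+
    then have U: "\<pi> + sigma (kos \<pi>) = sigma (kappa ?t)" using U\<pi> by simp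
    have t: "bipart (\<lambda>i m. 0 < i \<and> m = a - 1) \<xi> = ?t"
      using \<xi> by (intro ext_eqI) (auto simp: lookup_bipart bigraded_iff Suc)
    have "lookup \<xi> {} = 0" by (rule lookup_empty_eq_0[OF \<xi>]) (simp add: Suc)
    then have "i_inf (p_inf a \<xi>) = L.neumann (sigma (kappa ?t))"
      unfolding p_inf_def i_inf_eq t by simp
    also have "\<dots> = \<pi>" by (rule L.neumann_eqI) (simp only: U[symmetric], simp)
    finally show ?thesis by (simp only: \<pi>)
  next
    case 0
    have t: "bipart (\<lambda>i m. 0 < i \<and> m = a - 1) \<xi> = 0" by (rule bipart_eq_0[OF \<xi>]) (simp add: 0)
    have "?t \<in> bigraded (\<lambda>i m. i = 0)"
      using bipart_in_bigraded[OF \<xi>] by (rule bigraded_mono) (simp add: 0)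
    then have kt: "kappa ?t = 0" by (rule kappa_eq_0) simp
    \<comment> \<open>In degree \<open>0\<close> the right-hand side is a constant killed by
      \<open>d\<close>, so \<open>1 + \<sigma> d\<close> takes equal values at \<open>\<pi>\<close>
      and \<open>e\<close>. Evaluation then identifies the constant.\<close>
    define e where "e = ?E \<xi> + ?E (kos y)"
    have e: "e \<in> bigraded (\<lambda>i m. i = 0 \<and> m = 0)"
      unfolding e_def bipart_add[symmetric] using bipart_in_bigraded[OF bigraded_UNIV] by (rule bigraded_mono) simp
    have "kos e = 0" by (rule kos_eq_0[OF e]) simp
    then have "\<pi> + sigma (kos \<pi>) = e + sigma (kos e)" using U\<pi> kt by (simp add: e_def)
    then have "\<pi> = e" by (rule U_inj)
    have "e = ofS (const (lookup (lookup e {}) 0))"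
    proof (rule ext_eqI)
      fix I :: "'n set" and \<mu> :: "'n \<Rightarrow>\<^sub>0 nat"
      have "mdeg \<mu> = 0 \<longleftrightarrow> \<mu> = 0"
        by (auto simp: mdeg_def intro!: poly_mapping_eqI)
      then show "lookup (lookup e I) \<mu> = lookup (lookup (ofS (const (lookup (lookup e {}) 0))) I) \<mu>"
        using e by (auto simp: bigraded_iff lookup_single when_def const_def card_eq_0_iff)
    qed
    then obtain u where u: "e = ofS (const u)" ..
    have "kappa \<xi> + kos \<xi> = 0" using kappa_eq_0[OF \<xi>] kos_eq_0[OF \<xi>] 0 by simp
    then have "h_inf b = 0" using h_inf_add[of 0 0] by (simp add: b_def)
    \<comment> \<open>\<open>e\<close> differs from \<open>\<xi>\<close> by the untruncated boundary
      \<open>\<kappa> y + d y\<close>, which evaluates to \<open>0\<close>.\<close>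
    then have "evalS (lookup e {}) = evalS (lookup \<xi> {})"
      unfolding \<open>\<pi> = e\<close>[symmetric] \<pi>_def lookup_add[of _ "h_inf b"] lookup_add[of \<xi>] evalS_add evalS_boundary
      by simp
    then have u': "u = evalS (lookup \<xi> {})" by (simp add: u)
    have "L.neumann 0 = (0 :: ('n, 'k) extS)" by (rule L.neumann_eqI) simp
    then have "i_inf (p_inf a \<xi>) = \<pi>"
      unfolding \<open>\<pi> = e\<close> u u' p_inf_def i_inf_eq t by simp
    then show ?thesis by (simp only: \<pi>)
  qed
qed

lemma deformation_retract_XX_LL:
  fixes a :: nat
  assumes "a > 0" "CHAR('k) = 0 \<or> CHAR('k) \<ge> a + CARD('n)"
  shows "deformation_retract (XX a :: (('n::{finite,linorder}, 'k::field) polyR, ('n, 'k) extS) dga)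
    (LL a) i_inf (p_inf a) h_inf"
proof (rule deformation_retractI)
  show "chain_map (XX a :: (('n, 'k) polyR, ('n, 'k) extS) dga) (LL a) (p_inf a)"
    by (rule chain_map_p_inf[OF assms(1)])
  show "graded_linear 0 (LL a) (XX a :: (('n, 'k) polyR, ('n, 'k) extS) dga) i_inf"
    unfolding graded_linear_def
    using i_inf_component[OF assms(1)] by (auto simp: i_inf_add i_inf_scaleR)
  show "graded_linear 1 (XX a :: (('n, 'k) polyR, ('n, 'k) extS) dga) (XX a) h_inf"
    unfolding graded_linear_def
    by (auto simp: h_inf_add h_inf_scaleR intro: bigraded_mono[OF h_inf_bigraded])
qed (use i_p_inf[OF assms] p_i_inf[OF assms] in auto)

section \<open>The product on \<open>\<L>\<^sub>a\<close>\<close>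

lemma LL_dga_simps:
  "action (LL_dga a) = action (LL a)"
  "component (LL_dga a) = component (LL a)"
  "boundary (LL_dga a) = boundary (LL a)"
  "product (LL_dga a) \<alpha> \<beta> = p_inf a (product (XX a) (i_inf \<alpha>) (i_inf \<beta>))"
  "unit_elem (LL_dga a) = (1, 0)"
  by (simp_all add: LL_dga_def cpx.defs dga.defs)

lemma chain_map_LL_dga:
  "chain_map (LL_dga a) X f \<longleftrightarrow> chain_map (LL a) X f"
  "chain_map X (LL_dga a) g \<longleftrightarrow> chain_map X (LL a) g"
  by (simp_all only: chain_map_def is_complex_def graded_linear_def LL_dga_simps)

text \<open>The kernel of the antiderivation \<open>deRham\<close> is closed under products, and
  truncation preserves it because \<open>deRham\<close> is bihomogeneous.\<close>

lemma sigma_product_eq_0: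
  fixes \<xi> \<eta> :: "('n::{finite,linorder}, 'k::field) extS"
  assumes "CHAR('k) = 0 \<or> CHAR('k) \<ge> a + CARD('n)"
    and "\<xi> \<in> component (XX a) i" "\<eta> \<in> component (XX a) j" "sigma \<xi> = 0" "sigma \<eta> = 0"
  shows "sigma (product (XX a) \<xi> \<eta>) = 0"
proof -
  have "deRham \<zeta> = 0" if "\<zeta> \<in> component (XX a) l" "sigma \<zeta> = 0" for l and \<zeta> :: "('n, 'k) extS"
  proof -
    have "\<zeta> \<in> bigraded (\<lambda>i m. (i = l \<and> m < a) \<and> i \<le> CARD('n))"
      using that(1) by (intro bigraded_card_le) simp
    then have "\<zeta> \<in> bigraded (\<lambda>i m. i + m < a + CARD('n))" by (rule bigraded_mono) linarith
    then show ?thesis using that(2) sigma_eq_0_iff[OF assms(1)] by blast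
  qed
  then have "deRham \<xi> = 0" "deRham \<eta> = 0" using assms(2-5) by blast+
  then have "deRham (ext_mult \<xi> \<eta>) = 0" by (simp add: deRham_mult)
  \<comment> \<open>Truncating at \<open>m < a\<close> before \<open>deRham\<close> amounts to
    truncating at \<open>Suc m < a\<close> after it.\<close>
  moreover have "wt (\<lambda>i m. if Suc m < a then 1 else 0) (deRham (ext_mult \<xi> \<eta>)) =
      deRham (product (XX a) \<xi> \<eta>)"
    unfolding XX_simps bipart_eq_wt by (rule wt_deRham) simp
  ultimately show ?thesis by (simp add: sigma_eq_wt_deRham)
qed

text \<open>If \<open>\<sigma> \<zeta> = 0\<close>, then \<open>h_inf \<zeta>\<close> is a fixed
  point of \<open>- \<sigma> d\<close>, hence \<open>0\<close>. So both homotopy terms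
  vanish.\<close>

lemma i_p_inf_eq_self:
  fixes \<xi> :: "('n::{finite,linorder}, 'k::field) extS"
  assumes "a > 0" "CHAR('k) = 0 \<or> CHAR('k) \<ge> a + CARD('n)" "\<xi> \<in> component (XX a) j"
    and "sigma \<xi> = 0" "sigma (boundary (XX a) \<xi>) = 0"
  shows "i_inf (p_inf a \<xi>) = \<xi>"
proof -
  have h0: "h_inf \<zeta> = 0" if "sigma \<zeta> = 0" for \<zeta> :: "('n, 'k) extS"
    using h_inf_fixpoint[of \<zeta>] that L.fixpoint_eq_0[of "h_inf \<zeta>"] by simp
  have "h_inf \<xi> = 0" "h_inf (boundary (XX a) \<xi>) = 0" using assms(4,5) by (auto intro: h0)
  then show ?thesis using i_p_inf[OF assms(1-3)] by simp
qed

theorem theorem4p10: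
  fixes a :: nat
  assumes "a > 0"
    and "CHAR('k) = 0 \<or> CHAR('k) \<ge> a + CARD('n)"
  shows "deformation_retract
           (XX a :: (('n::{finite,linorder}, 'k::field) polyR, ('n, 'k) extS) dga)
           (LL a) i_inf (p_inf a) h_inf \<and>
         dg_algebra (LL_dga a :: (('n, 'k) polyR, ('n, 'k) polyR \<times> ('n, 'k) extS) dga) \<and>
         dg_algebra_hom
           (LL_dga a) (XX a :: (('n, 'k) polyR, ('n, 'k) extS) dga) i_inf"
proof -
  let ?X = "XX a :: (('n, 'k) polyR, ('n, 'k) extS) dga"
    and ?A = "LL_dga a :: (('n, 'k) polyR, ('n, 'k) polyR \<times> ('n, 'k) extS) dga"
  note retract = deformation_retract_XX_LL[OF assms]
  note X = dg_algebra_XX[OF assms(1), where 'n = 'n and 'k = 'k]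
  have i: "chain_map ?A ?X i_inf" and p: "chain_map ?X ?A (p_inf a)"
    using retract by (auto simp: deformation_retract_def quasi_isomorphism_def chain_map_LL_dga)
  have "dg_algebra ?A \<and> dg_algebra_hom ?A ?X i_inf"
  proof (rule dg_algebra_transfer[OF X i p])
    show "p_inf a (i_inf y) = y" if "y \<in> component ?A j" for j y
      using p_i_inf[OF assms] that by (simp add: LL_dga_simps)
    show "i_inf (p_inf a (product ?X (i_inf x) (i_inf y))) = product ?X (i_inf x) (i_inf y)"
      if x: "x \<in> component ?A j" and y: "y \<in> component ?A k" for j k x y
    proof -
      have ic: "i_inf z \<in> component ?X l" if "z \<in> component ?A l" for z l
        using i_inf_component[OF assms(1)] that by (simp add: LL_dga_simps)
      have bc: "boundary ?X (i_inf z) \<in> component ?X (l - 1)" if "z \<in> component ?A l" for z l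
        using is_complex_XX[of a, where 'n = 'n and 'k = 'k] ic[OF that] component_zero[OF is_complex_XX]
        unfolding is_complex_def by (cases l) auto
      \<comment> \<open>As \<open>i_inf\<close> is a chain map, the boundary stays in its image,
        where \<open>\<sigma>\<close> vanishes.\<close>
      have sb: "sigma (boundary ?X (i_inf z)) = 0" if "z \<in> component ?A l" for z l
        using i that sigma_i_inf[of "boundary ?A z"] unfolding chain_map_def by metis
      show ?thesis
      proof (rule i_p_inf_eq_self[OF assms dga_closed[OF X ic[OF x] ic[OF y]]])
        show "sigma (product ?X (i_inf x) (i_inf y)) = 0"
          by (rule sigma_product_eq_0[OF assms(2) ic[OF x] ic[OF y]]) (simp_all add: sigma_i_inf)
        \<comment> \<open>By the Leibniz rule it suffices to treat the two products in which one
          factor is replaced by its boundary.\<close>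
        have "sigma (product ?X (boundary ?X (i_inf x)) (i_inf y)) = 0"
          by (rule sigma_product_eq_0[OF assms(2) bc[OF x] ic[OF y] sb[OF x] sigma_i_inf])
        moreover have "sigma (product ?X (i_inf x) (boundary ?X (i_inf y))) = 0"
          by (rule sigma_product_eq_0[OF assms(2) ic[OF x] bc[OF y] sigma_i_inf sb[OF y]])
        ultimately show "sigma (boundary ?X (product ?X (i_inf x) (i_inf y))) = 0"
          unfolding dga_leibniz[OF X ic[OF x] ic[OF y]] XX_simps(1) by (simp only: sigma_add sigma_scaleR scaleR_ext_zero add_0)
      qed
    qed
    have "L.neumann 0 = (0 :: ('n, 'k) extS)" by (rule L.neumann_eqI) simp
    then show "i_inf (unit_elem ?A) = unit_elem ?X"
      by (simp add: LL_dga_simps i_inf_eq)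
  qed (simp_all only: LL_dga_simps LL_simps, simp)
  then show ?thesis using retract by blast
qed

end
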